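(* Let $G$ be a discrete amenable group acting by homeomorphisms on a compact Hausdorff space $X$. For each $k\ge1$ the set of IE-tuples of length $k$ in $X^k$ is equal to the closure in $X^k$ of the union of the sets $\mathrm{IE}^\mu_k(X)$ over all $G$-invariant regular Borel probability measures $\mu$ on $X$.
   Context: Limits. For finite $K\subseteq G$ and $\delta>0$, $M(K,\delta)$ is the set of nonempty finite $F\subseteq G$ with $|\{s\in F:Ks\subseteq F\}|\ge(1-\delta)|F|$. For a real-valued $\varphi$ on finite subsets of $G$, the limit supremum of $\varphi(F)/|F|$ as $F$ becomes more and more invariant is $\lim_{(K,\delta)}\sup_{F\in M(K,\delta)}\varphi(F)/|F|$, where $(K,\delta)\succ(K',\delta')$ if $K\supseteq K'$ and $\delta\le\delta'$; the limit infimum is defined with $\inf$, and the limit exists if they coincide. Independence. For a tuple $\boldsymbol A=(A_1,\dots,A_k)$ of subsets of $X$ and $D\subseteq X$, a set $J\subseteq G$ is an independence set for $\boldsymbol A$ relative to $D$ if $D\cap\bigcap_{s\in F}s^{-1}A_{\sigma(s)}\ne\emptyset$ for every nonempty finite $F\subseteq J$ and every $\sigma:F\to\{1,\dots,k\}$; it is an independence set for $\boldsymbol A$ if this holds with $D=X$. IE-tuples. $(x_1,\dots,x_k)\in X^k$ is an IE-tuple if for every product neighbourhood $U_1\times\cdots\times U_k$ of it, the limit of $\frac1{|F|}\max\{|F\cap J|:J\text{ is an independence set for }(U_1,\dots,U_k)\}$ as $F$ becomes more and more invariant (this limit exists) is positive. $\mu$-IE-tuples. Let $\mu$ be a $G$-invariant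 regular Borel probability measure on $X$, let $\mathscr B(\mu,\delta)$ be the set of Borel $D\subseteq X$ with $\mu(D)\ge1-\delta$, and put $\varphi_{\boldsymbol A,\delta}(F)=\min_{D\in\mathscr B(\mu,\delta)}\max\{|F\cap J|:J\text{ is an independence set for }\boldsymbol A\text{ relative to }D\}$. $\overline{\mathrm I}_\mu(\boldsymbol A,\delta)$ is the limit supremum of $\varphi_{\boldsymbol A,\delta}(F)/|F|$ as $F$ becomes more and more invariant, and $\overline{\mathrm I}_\mu(\boldsymbol A)=\sup_{\delta>0}\overline{\mathrm I}_\mu(\boldsymbol A,\delta)$ is the upper $\mu$-independence density. $(x_1,\dots,x_k)\in X^k$ is a $\mu$-IE-tuple if $\overline{\mathrm I}_\mu((U_1,\dots,U_k))>0$ for every product neighbourhood $U_1\times\cdots\times U_k$ of it. $\mathrm{IE}^\mu_k(X)$ is the set of $\mu$-IE-tuples of length $k$. *)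

theory Defs
  imports "HOL-Algebra.Group_Action" "HOL-Analysis.Analysis" "HOL-Probability.Probability_Measure"
begin

text \<open>
  Amenability of a discrete group, in von Neumann's sense: there is a left-invariant finitely
  additive probability measure defined on all subsets of the group.
\<close>

definition amenable_group :: "('g, 'm) monoid_scheme \<Rightarrow> bool" where
  "amenable_group G \<longleftrightarrow> group G \<and>
     (\<exists>m :: 'g set \<Rightarrow> real.
        (\<forall>A. A \<subseteq> carrier G \<longrightarrow> 0 \<le> m A) \<and>
        m (carrier G) = 1 \<and>
        (\<forall>A B. A \<subseteq> carrier G \<longrightarrow> B \<subseteq> carrier G \<longrightarrow> A \<inter> B = {} \<longrightarrow> m (A \<union> B) = m A + m B) \<and>
        (\<forall>g\<in>carrier G. \<forall>A. A \<subseteq> carrier G \<longrightarrow> m (g <#\<^bsub>G\<^esub> A) = m A))"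

definition almost_invariant :: "('g, 'm) monoid_scheme \<Rightarrow> 'g set \<Rightarrow> real \<Rightarrow> 'g set set" where
  "almost_invariant G K \<delta> =
     {F. finite F \<and> F \<noteq> {} \<and> F \<subseteq> carrier G \<and>
         real (card {s \<in> F. K #>\<^bsub>G\<^esub> s \<subseteq> F}) \<ge> (1 - \<delta>) * real (card F)}"

text \<open>
  The directed set of pairs \<open>(K, \<delta>)\<close>, as an index set and as the filter generated by its tails.
\<close>

definition invariance_index :: "('g, 'm) monoid_scheme \<Rightarrow> ('g set \<times> real) set" where
  "invariance_index G = {(K, \<delta>). finite K \<and> K \<subseteq> carrier G \<and> \<delta> > 0}"

definition invariance_net :: "('g, 'm) monoid_scheme \<Rightarrow> ('g set \<times> real) filter" where
  "invariance_net G =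
     (INF (K', \<delta>')\<in>invariance_index G.
        principal {(K, \<delta>) \<in> invariance_index G. K' \<subseteq> K \<and> \<delta> \<le> \<delta>'})"

definition inv_limsup :: "('g, 'm) monoid_scheme \<Rightarrow> ('g set \<Rightarrow> real) \<Rightarrow> ereal" where
  "inv_limsup G f =
     Lim (invariance_net G) (\<lambda>(K, \<delta>). SUP F\<in>almost_invariant G K \<delta>. ereal (f F / real (card F)))"

definition inv_liminf :: "('g, 'm) monoid_scheme \<Rightarrow> ('g set \<Rightarrow> real) \<Rightarrow> ereal" where
  "inv_liminf G f =
     Lim (invariance_net G) (\<lambda>(K, \<delta>). INF F\<in>almost_invariant G K \<delta>. ereal (f F / real (card F)))"

definition has_inv_limit :: "('g, 'm) monoid_scheme \<Rightarrow> ('g set \<Rightarrow> real) \<Rightarrow> ereal \<Rightarrow> bool" where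
  "has_inv_limit G f L \<longleftrightarrow> inv_limsup G f = L \<and> inv_liminf G f = L"

text \<open>
  Both nets are monotone, so the limits above always exist and \<^const>\<open>Lim\<close> is not applied to a
  divergent net.
\<close>

lemma almost_invariant_antimono:
  assumes "K' \<subseteq> K" "\<delta> \<le> \<delta>'"
  shows "almost_invariant G K \<delta> \<subseteq> almost_invariant G K' \<delta>'"
proof
  fix F assume F: "F \<in> almost_invariant G K \<delta>"
  then have fin: "finite F" by (simp add: almost_invariant_def)
  have "K' #>\<^bsub>G\<^esub> s \<subseteq> K #>\<^bsub>G\<^esub> s" for s
    using assms(1) by (auto simp: r_coset_def)
  then have "card {s \<in> F. K #>\<^bsub>G\<^esub> s \<subseteq> F} \<le> card {s \<in> F. K' #>\<^bsub>G\<^esub> s \<subseteq> F}"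
    using fin by (intro card_mono) auto
  moreover have "(1 - \<delta>') * real (card F) \<le> (1 - \<delta>) * real (card F)"
    using assms(2) by (intro mult_right_mono) auto
  ultimately show "F \<in> almost_invariant G K' \<delta>'"
    using F unfolding almost_invariant_def by fastforce
qed

lemma eventually_invariance_net:
  "eventually P (invariance_net G) \<longleftrightarrow>
     (\<exists>K' \<delta>'. (K', \<delta>') \<in> invariance_index G \<and>
        (\<forall>K \<delta>. (K, \<delta>) \<in> invariance_index G \<longrightarrow> K' \<subseteq> K \<longrightarrow> \<delta> \<le> \<delta>' \<longrightarrow> P (K, \<delta>)))"
proof -
  let ?T = "\<lambda>p. {(K, \<delta>) \<in> invariance_index G. fst p \<subseteq> K \<and> \<delta> \<le> snd p}"
  have net: "invariance_net G = (INF p\<in>invariance_index G. principal (?T p))"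
    unfolding invariance_net_def by (simp add: case_prod_beta)
  have ne: "invariance_index G \<noteq> {}"
    by (auto simp: invariance_index_def intro!: exI[of _ "{}"] exI[of _ "1::real"])
  have "eventually P (invariance_net G) \<longleftrightarrow>
      (\<exists>p\<in>invariance_index G. eventually P (principal (?T p)))"
    unfolding net
  proof (rule eventually_INF_base[OF ne])
    fix p q assume "p \<in> invariance_index G" "q \<in> invariance_index G"
    then have "(fst p \<union> fst q, min (snd p) (snd q)) \<in> invariance_index G"
      by (auto simp: invariance_index_def)
    then show "\<exists>r\<in>invariance_index G. principal (?T r) \<le> inf (principal (?T p)) (principal (?T q))"
      by (rule bexI[rotated]) auto
  qed
  then show ?thesis
    unfolding eventually_principal Bex_def Ball_def split_paired_Ex split_paired_All by (simp add: imp_conjL)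
qed

lemma invariance_net_neq_bot: "invariance_net G \<noteq> bot"
  unfolding trivial_limit_def eventually_invariance_net by blast

lemma inv_limsup_tendsto:
  shows "((\<lambda>(K, \<delta>). SUP F\<in>almost_invariant G K \<delta>. ereal (f F / real (card F)))
           \<longlongrightarrow> inv_limsup G f) (invariance_net G)" (is "(?g \<longlongrightarrow> _) _")
    and "inv_limsup G f =
           (INF (K, \<delta>)\<in>invariance_index G. SUP F\<in>almost_invariant G K \<delta>. ereal (f F / real (card F)))"
proof -
  have mono: "?g (K, \<delta>) \<le> ?g (K', \<delta>')" if "K' \<subseteq> K" "\<delta> \<le> \<delta>'" for K K' \<delta> \<delta>'
    using almost_invariant_antimono[OF that, of G] by (auto intro: SUP_subset_mono)
  have lim: "(?g \<longlongrightarrow> (INF p\<in>invariance_index G. ?g p)) (invariance_net G)"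
  proof (rule order_tendstoI)
    fix a assume a: "a < (INF p\<in>invariance_index G. ?g p)"
    have "a < ?g (K, \<delta>)" if "(K, \<delta>) \<in> invariance_index G" for K \<delta>
      using a INF_lower[OF that, of ?g] by (rule less_le_trans)
    moreover have "({}, 1) \<in> invariance_index G" by (simp add: invariance_index_def)
    ultimately show "eventually (\<lambda>p. a < ?g p) (invariance_net G)"
      unfolding eventually_invariance_net by blast
  next
    fix a assume "(INF p\<in>invariance_index G. ?g p) < a"
    then obtain K' \<delta>' where *: "(K', \<delta>') \<in> invariance_index G" "?g (K', \<delta>') < a"
      unfolding INF_less_iff by force
    have "?g (K, \<delta>) < a" if "K' \<subseteq> K" "\<delta> \<le> \<delta>'" for K \<delta>
      using mono[OF that] *(2) by (rule le_less_trans)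
    with *(1) show "eventually (\<lambda>p. ?g p < a) (invariance_net G)"
      unfolding eventually_invariance_net by blast
  qed
  then show eq: "inv_limsup G f = (INF (K, \<delta>)\<in>invariance_index G.
      SUP F\<in>almost_invariant G K \<delta>. ereal (f F / real (card F)))"
    unfolding inv_limsup_def by (rule tendsto_Lim[OF invariance_net_neq_bot])
  show "(?g \<longlongrightarrow> inv_limsup G f) (invariance_net G)"
    using lim unfolding eq .
qed

lemma inv_liminf_tendsto:
  shows "((\<lambda>(K, \<delta>). INF F\<in>almost_invariant G K \<delta>. ereal (f F / real (card F)))
           \<longlongrightarrow> inv_liminf G f) (invariance_net G)" (is "(?g \<longlongrightarrow> _) _")
    and "inv_liminf G f =
           (SUP (K, \<delta>)\<in>invariance_index G. INF F\<in>almost_invariant G K \<delta>. ereal (f F / real (card F)))"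
proof -
  have mono: "?g (K', \<delta>') \<le> ?g (K, \<delta>)" if "K' \<subseteq> K" "\<delta> \<le> \<delta>'" for K K' \<delta> \<delta>'
    using almost_invariant_antimono[OF that, of G] by (auto intro: INF_superset_mono)
  have lim: "(?g \<longlongrightarrow> (SUP p\<in>invariance_index G. ?g p)) (invariance_net G)"
  proof (rule order_tendstoI)
    fix a assume a: "(SUP p\<in>invariance_index G. ?g p) < a"
    have "?g (K, \<delta>) < a" if "(K, \<delta>) \<in> invariance_index G" for K \<delta>
      using SUP_upper[OF that, of ?g] a by (rule le_less_trans)
    moreover have "({}, 1) \<in> invariance_index G" by (simp add: invariance_index_def)
    ultimately show "eventually (\<lambda>p. ?g p < a) (invariance_net G)"
      unfolding eventually_invariance_net by blast
  next
    fix a assume "a < (SUP p\<in>invariance_index G. ?g p)"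
    then obtain K' \<delta>' where *: "(K', \<delta>') \<in> invariance_index G" "a < ?g (K', \<delta>')"
      unfolding less_SUP_iff by force
    have "a < ?g (K, \<delta>)" if "K' \<subseteq> K" "\<delta> \<le> \<delta>'" for K \<delta>
      using *(2) mono[OF that] by (rule less_le_trans)
    with *(1) show "eventually (\<lambda>p. a < ?g p) (invariance_net G)"
      unfolding eventually_invariance_net by blast
  qed
  then show eq: "inv_liminf G f = (SUP (K, \<delta>)\<in>invariance_index G.
      INF F\<in>almost_invariant G K \<delta>. ereal (f F / real (card F)))"
    unfolding inv_liminf_def by (rule tendsto_Lim[OF invariance_net_neq_bot])
  show "(?g \<longlongrightarrow> inv_liminf G f) (invariance_net G)"
    using lim unfolding eq .
qed

text \<open>
  A \<open>k\<close>-tuple is a function on \<open>{1..k}\<close>; values of \<open>A\<close> and \<open>U\<close> outside \<open>{1..k}\<close> are irrelevant.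
  The set \<open>s\<inverse>A\<close> is the preimage \<open>\<phi> s -` A\<close>.
\<close>

definition independence_set ::
  "('g, 'm) monoid_scheme \<Rightarrow> ('g \<Rightarrow> 'x \<Rightarrow> 'x) \<Rightarrow> nat \<Rightarrow> (nat \<Rightarrow> 'x set) \<Rightarrow> 'x set \<Rightarrow> 'g set \<Rightarrow> bool"
  where
  "independence_set G \<phi> k A D J \<longleftrightarrow> J \<subseteq> carrier G \<and>
     (\<forall>F \<sigma>. F \<noteq> {} \<longrightarrow> finite F \<longrightarrow> F \<subseteq> J \<longrightarrow> \<sigma> \<in> F \<rightarrow> {1..k} \<longrightarrow>
        D \<inter> (\<Inter>s\<in>F. \<phi> s -` A (\<sigma> s)) \<noteq> {})"

definition max_independence ::
  "('g, 'm) monoid_scheme \<Rightarrow> ('g \<Rightarrow> 'x \<Rightarrow> 'x) \<Rightarrow> nat \<Rightarrow> (nat \<Rightarrow> 'x set) \<Rightarrow> 'x set \<Rightarrow> 'g set \<Rightarrow> nat"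
  where
  "max_independence G \<phi> k A D F = Max ((\<lambda>J. card (F \<inter> J)) ` {J. independence_set G \<phi> k A D J})"

definition IE_tuples ::
  "('g, 'm) monoid_scheme \<Rightarrow> ('g \<Rightarrow> 'x::topological_space \<Rightarrow> 'x) \<Rightarrow> nat \<Rightarrow> (nat \<Rightarrow> 'x) set" where
  "IE_tuples G \<phi> k =
     {x \<in> {1..k} \<rightarrow>\<^sub>E UNIV. \<forall>U. (\<forall>i\<in>{1..k}. x i \<in> interior (U i)) \<longrightarrow>
        (\<exists>L>0. has_inv_limit G (\<lambda>F. real (max_independence G \<phi> k U UNIV F)) L)}"

definition borel_large :: "'x::topological_space measure \<Rightarrow> real \<Rightarrow> 'x set set" where
  "borel_large \<mu> \<delta> = {D \<in> sets borel. measure \<mu> D \<ge> 1 - \<delta>}"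

definition mu_max_independence ::
  "('g, 'm) monoid_scheme \<Rightarrow> ('g \<Rightarrow> 'x::topological_space \<Rightarrow> 'x) \<Rightarrow> 'x measure \<Rightarrow> nat \<Rightarrow>
     (nat \<Rightarrow> 'x set) \<Rightarrow> real \<Rightarrow> 'g set \<Rightarrow> nat" where
  "mu_max_independence G \<phi> \<mu> k A \<delta> F =
     Min ((\<lambda>D. max_independence G \<phi> k A D F) ` borel_large \<mu> \<delta>)"

definition upper_mu_density ::
  "('g, 'm) monoid_scheme \<Rightarrow> ('g \<Rightarrow> 'x::topological_space \<Rightarrow> 'x) \<Rightarrow> 'x measure \<Rightarrow> nat \<Rightarrow>
     (nat \<Rightarrow> 'x set) \<Rightarrow> ereal" where
  "upper_mu_density G \<phi> \<mu> k A =
     (SUP \<delta>\<in>{0<..}. inv_limsup G (\<lambda>F. real (mu_max_independence G \<phi> \<mu> k A \<delta> F)))"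

definition mu_IE_tuples ::
  "('g, 'm) monoid_scheme \<Rightarrow> ('g \<Rightarrow> 'x::topological_space \<Rightarrow> 'x) \<Rightarrow> 'x measure \<Rightarrow> nat \<Rightarrow>
     (nat \<Rightarrow> 'x) set" where
  "mu_IE_tuples G \<phi> \<mu> k =
     {x \<in> {1..k} \<rightarrow>\<^sub>E UNIV. \<forall>U. (\<forall>i\<in>{1..k}. x i \<in> interior (U i)) \<longrightarrow>
        upper_mu_density G \<phi> \<mu> k U > 0}"

definition regular_borel_prob :: "'x::topological_space measure \<Rightarrow> bool" where
  "regular_borel_prob \<mu> \<longleftrightarrow> prob_space \<mu> \<and> sets \<mu> = sets borel \<and>
     (\<forall>B\<in>sets borel.
        emeasure \<mu> B = (SUP K\<in>{K. compact K \<and> K \<subseteq> B}. emeasure \<mu> K) \<and>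
        emeasure \<mu> B = (INF U\<in>{U. open U \<and> B \<subseteq> U}. emeasure \<mu> U))"

definition invariant_measures ::
  "('g, 'm) monoid_scheme \<Rightarrow> ('g \<Rightarrow> 'x::topological_space \<Rightarrow> 'x) \<Rightarrow> 'x measure set" where
  "invariant_measures G \<phi> =
     {\<mu>. regular_borel_prob \<mu> \<and> (\<forall>g\<in>carrier G. distr \<mu> borel (\<phi> g) = \<mu>)}"

end

theory Submission imports Defs begin

text \<open>
  Both sides of the theorem are about densities of independence sets. Call a tuple \<open>A\<close> of sets dense
  if the limit supremum of the size of its largest independence sets is positive, and
  \<open>\<mu>\<close>-dense if its upper \<open>\<mu>\<close>-independence density is positive.

  Independence sets are hereditary and stable under right translation. Averaging
  \<open>card (F0 s \<inter> J)\<close> over the elements \<open>s\<close> of an almost invariant set \<open>F\<close> therefore bounds the limit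
  supremum by the value at every finite set \<open>F0\<close> (\<open>inv_limsup_le_finite\<close>). So the limit is an
  infimum, it always exists, and an IE-tuple is a tuple all of whose neighbourhoods are dense
  (\<open>IE_tuples_iff\<close>). The limits over almost invariant sets are meaningful because such sets exist: if
  not, some finite \<open>S\<close> would satisfy \<open>card (S F) \<ge> 2 card F\<close> for all finite \<open>F\<close>, and Hall's
  marriage theorem would turn this into two disjoint copies of the group inside itself, which an
  invariant mean forbids (\<open>almost_invariant_nonempty\<close>).

  A \<open>\<mu>\<close>-dense tuple is dense, so \<open>\<mu>\<close>-IE-tuples are IE-tuples, and the IE-tuples form a closed set. This is
  the easy inclusion.

  For the other inclusion let \<open>A\<close> consist of closed neighbourhoods of the entries of an IE-tuple. Every
  almost invariant \<open>F\<close> contains an independence set \<open>J\<close> with \<open>card J \<ge> L card F\<close>. Choose for each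
  labelling \<open>\<sigma>\<close> of \<open>J\<close> a point \<open>x \<sigma>\<close> with \<open>s (x \<sigma>) \<in> A (\<sigma> s)\<close> on \<open>J\<close>, and spread mass uniformly over the
  points \<open>s (x \<sigma>)\<close>, \<open>s \<in> F\<close>. A cluster point of these averages is an invariant finitely additive
  probability, and its regularisation is an invariant regular Borel measure \<open>\<mu>\<close>
  (\<open>invariant_measure_of_mean\<close>). If \<open>D\<close> misses little of \<open>\<mu>\<close>, then \<open>s (x \<sigma>)\<close> is close to \<open>D\<close> for most pairs
  \<open>(s, \<sigma>)\<close>; so for any finite \<open>F0\<close> some \<open>s\<close> gives a set \<open>{t \<in> F0. t s \<in> J}\<close> that is a proportional part
  of \<open>F0\<close> and on which most patterns are realised near \<open>D\<close>. Then all patterns are realised on a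
  proportional subset (\<open>dense_patterns_independent\<close>), and \<open>A\<close> is \<open>\<mu>\<close>-dense
  (\<open>exists_measure_of_positive_density\<close>).

  Finally, \<open>\<mu>\<close>-density is partition regular: if one entry of a \<open>\<mu>\<close>-dense tuple is split in two, one of
  the two resulting tuples is \<open>\<mu>\<close>-dense (\<open>upper_mu_density_split\<close>). By compactness a \<open>\<mu>\<close>-dense closed
  tuple contains a \<open>\<mu>\<close>-IE-tuple (\<open>mu_IE_tuple_exists\<close>), so the given IE-tuple is a limit of
  \<open>\<mu>\<close>-IE-tuples for varying \<open>\<mu>\<close>.

  The two combinatorial facts, on dense sets of patterns and on splitting, both follow from one
  statement about cover numbers: a set of patterns on \<open>Z\<close> that cannot be covered by exponentially few
  boxes, each forbidding one label per coordinate, shatters a proportional part of \<open>Z\<close>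
  (\<open>large_cover_number_shatters\<close>). Cover numbers are submultiplicative under splitting, which plain
  cardinalities are not.
\<close>

section \<open>Almost invariant sets from an invariant mean\<close>

definition hall_condition :: "'i set \<Rightarrow> ('i \<Rightarrow> 'a set) \<Rightarrow> bool" where
  "hall_condition J A \<longleftrightarrow> (\<forall>I\<subseteq>J. finite I \<longrightarrow> card I \<le> card (\<Union>i\<in>I. A i))"

text \<open>
  If both removals failed, with witnesses \<open>I1\<close> and \<open>I2\<close>, then both contain \<open>j\<close>, and the two unions
  together contain all neighbours of \<open>I1 \<union> I2\<close> while their intersection contains all neighbours of
  \<open>I1 \<inter> I2 - {j}\<close>. Inclusion-exclusion then contradicts the condition for these two index sets.
\<close>

lemma hall_condition_remove_one:
  assumes h: "hall_condition J A" and fin: "\<And>i. i \<in> J \<Longrightarrow> finite (A i)"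
    and j: "j \<in> J" and xy: "x \<in> A j" "y \<in> A j" "x \<noteq> y"
  shows "hall_condition J (A(j := A j - {x})) \<or> hall_condition J (A(j := A j - {y}))"
proof (rule ccontr)
  let ?U = "\<lambda>B I. \<Union>i\<in>I. B i"
  assume "\<not> ?thesis"
  then obtain I1 I2 where I1: "I1 \<subseteq> J" "finite I1" "card (?U (A(j := A j - {x})) I1) < card I1"
    and I2: "I2 \<subseteq> J" "finite I2" "card (?U (A(j := A j - {y})) I2) < card I2"
    unfolding hall_condition_def by (auto simp: not_le)
  let ?P = "?U (A(j := A j - {x})) I1" and ?Q = "?U (A(j := A j - {y})) I2"
  have jI: "j \<in> I" if "I \<subseteq> J" "finite I" "card (?U (A(j := A j - {u})) I) < card I" for I u
  proof (rule ccontr)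
    assume "j \<notin> I"
    then have "?U (A(j := A j - {u})) I = ?U A I" by (intro SUP_cong) auto
    moreover have "card I \<le> card (?U A I)" using h that(1,2) by (simp add: hall_condition_def)
    ultimately show False using that(3) by (metis leD)
  qed
  have j1: "j \<in> I1" and j2: "j \<in> I2" using jI I1 I2 by blast+
  have finA: "finite (?U A I)" if "I \<subseteq> J" "finite I" for I using that fin by blast
  have fP: "finite ?P" by (rule finite_subset[OF _ finA[OF I1(1,2)]]) (auto split: if_splits)
  have fQ: "finite ?Q" by (rule finite_subset[OF _ finA[OF I2(1,2)]]) (auto split: if_splits)
  have "?U A (I1 \<union> I2) \<subseteq> ?P \<union> ?Q"
  proof
    fix a assume "a \<in> ?U A (I1 \<union> I2)"
    then obtain i where i: "i \<in> I1 \<union> I2" "a \<in> A i" by blast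
    show "a \<in> ?P \<union> ?Q"
    proof (cases "i = j")
      case True
      then have "a \<in> (A(j := A j - {x})) j \<or> a \<in> (A(j := A j - {y})) j" using i(2) xy(3) by auto
      then show ?thesis using j1 j2 by blast
    next
      case False
      then have "a \<in> (A(j := A j - {x})) i" "a \<in> (A(j := A j - {y})) i" using i(2) by auto
      then show ?thesis using i(1) by blast
    qed
  qed
  then have "card (?U A (I1 \<union> I2)) \<le> card (?P \<union> ?Q)"
    using fP fQ by (intro card_mono) auto
  moreover have "card (I1 \<union> I2) \<le> card (?U A (I1 \<union> I2))"
    using h I1(1,2) I2(1,2) unfolding hall_condition_def by (meson Un_least finite_Un)
  moreover have "?U A (I1 \<inter> I2 - {j}) \<subseteq> ?P \<inter> ?Q"
    by auto
  then have "card (?U A (I1 \<inter> I2 - {j})) \<le> card (?P \<inter> ?Q)"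
    using fP by (intro card_mono) auto
  moreover have "card (I1 \<inter> I2 - {j}) \<le> card (?U A (I1 \<inter> I2 - {j}))"
    using h[unfolded hall_condition_def, rule_format, of "I1 \<inter> I2 - {j}"] I1(1,2) by auto
  moreover have "card (I1 \<inter> I2) = Suc (card (I1 \<inter> I2 - {j}))"
    using I1(2) j1 j2 by (subst card_Suc_Diff1) auto
  moreover have "card I1 + card I2 = card (I1 \<union> I2) + card (I1 \<inter> I2)"
    by (rule card_Un_Int[OF I1(2) I2(2)])
  moreover have "card ?P + card ?Q = card (?P \<union> ?Q) + card (?P \<inter> ?Q)"
    by (rule card_Un_Int[OF fP fQ])
  ultimately show False using I1(3) I2(3) by linarith
qed

text \<open>
  Rado's proof of the marriage theorem
    for infinitely many finite sets: remove as many pairs \<open>(i, a)\<close> as Hall's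
  condition permits. Zorn's lemma applies because the condition speaks of finitely many finite sets at
  a time, and by the previous lemma nothing can be removed only when every set is a singleton.
\<close>

lemma hall_marriage:
  assumes h: "hall_condition J A" and fin: "\<And>i. i \<in> J \<Longrightarrow> finite (A i)"
  shows "\<exists>h. inj_on h J \<and> (\<forall>i\<in>J. h i \<in> A i)"
proof -
  define B where "B D = (\<lambda>i. A i - {a. (i, a) \<in> D})" for D
  have "\<exists>M\<in>{D. hall_condition J (B D)}. \<forall>D\<in>{D. hall_condition J (B D)}. M \<subseteq> D \<longrightarrow> D = M"
  proof (rule subset_Zorn)
    fix C assume C: "subset.chain {D. hall_condition J (B D)} C"
    show "\<exists>U\<in>{D. hall_condition J (B D)}. \<forall>X\<in>C. X \<subseteq> U"
    proof (cases "C = {}")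
      case True
      have "hall_condition J (B {})" using h by (simp add: B_def)
      then show ?thesis using True by blast
    next
      case False
      have "hall_condition J (B (\<Union>C))"
        unfolding hall_condition_def
      proof (intro allI impI)
        fix I assume I: "I \<subseteq> J" "finite I"
        \<comment> \<open>Only the finitely many pairs in \<open>Sigma I A\<close> matter for \<open>I\<close>, so one member of the chain decides.\<close>
        let ?R = "\<Union>C \<inter> Sigma I A"
        have "finite (Sigma I A)" using I fin by (intro finite_SigmaI) auto
        then have "finite ?R" by simp
        then obtain D where D: "D \<in> C" "?R \<subseteq> D"
          using finite_subset_Union_chain[of ?R C] False C by (metis inf_le1)
        have "(\<Union>i\<in>I. B (\<Union>C) i) = (\<Union>i\<in>I. B D i)"
          using D unfolding B_def by blast
        moreover have "hall_condition J (B D)" using C D(1) by (auto simp: subset.chain_def)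
        ultimately show "card I \<le> card (\<Union>i\<in>I. B (\<Union>C) i)"
          using I by (simp add: hall_condition_def)
      qed
      then show ?thesis by blast
    qed
  qed
  then obtain M where M: "hall_condition J (B M)" and max: "\<And>D. hall_condition J (B D) \<Longrightarrow> M \<subseteq> D \<Longrightarrow> D = M"
    by blast
  have finB: "finite (B M i)" if "i \<in> J" for i using fin[OF that] by (simp add: B_def)
  have uniq: "x = y" if i: "i \<in> J" and x: "x \<in> B M i" and y: "y \<in> B M i" for i x y
  proof (rule ccontr)
    assume "x \<noteq> y"
    have upd: "(B M)(i := B M i - {u}) = B (insert (i, u) M)" for u
      by (rule ext) (auto simp: B_def)
    have False if "hall_condition J (B (insert (i, u) M))" "u \<in> B M i" for u
      using max[OF that(1)] that(2) by (auto simp: B_def)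
    then show False
      using hall_condition_remove_one[OF M finB i x y \<open>x \<noteq> y\<close>] x y unfolding upd by blast
  qed
  have ne: "B M i \<noteq> {}" if "i \<in> J" for i
    using M[unfolded hall_condition_def, rule_format, of "{i}"] that by auto
  define f where "f i = (SOME a. a \<in> B M i)" for i
  have f: "f i \<in> B M i" if "i \<in> J" for i
    unfolding f_def using ne[OF that] by (simp add: some_in_eq)
  have "inj_on f J"
  proof (rule inj_onI, rule ccontr)
    fix i j assume ij: "i \<in> J" "j \<in> J" "f i = f j" "i \<noteq> j"
    have "(\<Union>l\<in>{i, j}. B M l) \<subseteq> {f i}"
      using uniq f ij by auto
    then have "card (\<Union>l\<in>{i, j}. B M l) \<le> 1"
      using card_mono[of "{f i}"] by fastforce
    moreover have "card {i, j} \<le> card (\<Union>l\<in>{i, j}. B M l)"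
      using M[unfolded hall_condition_def, rule_format, of "{i, j}"] ij by blast
    ultimately show False using ij(4) by simp
  qed
  moreover have "\<forall>i\<in>J. f i \<in> A i" using f by (auto simp: B_def)
  ultimately show ?thesis by blast
qed

text \<open>
  Doubling is Hall's condition for two disjoint copies of the group, an element \<open>g\<close> of either copy being
  allowed to move to \<open>S g\<close>. The resulting injection cuts each copy into finitely many pieces
  that are translated to pairwise disjoint sets, whose total mean would be 2.
\<close>

lemma (in group) no_mean_if_doubling:
  assumes S: "finite S" "S \<subseteq> carrier G"
    and doubling: "\<And>F. finite F \<Longrightarrow> F \<subseteq> carrier G \<Longrightarrow> 2 * card F \<le> card (S <#> F)"
  shows "\<not> amenable_group G"
proof
  assume "amenable_group G"
  then obtain m :: "'a set \<Rightarrow> real" where m: "\<forall>A. A \<subseteq> carrier G \<longrightarrow> 0 \<le> m A"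
    "m (carrier G) = 1"
    "\<forall>A B. A \<subseteq> carrier G \<longrightarrow> B \<subseteq> carrier G \<longrightarrow> A \<inter> B = {} \<longrightarrow> m (A \<union> B) = m A + m B"
    "\<forall>g\<in>carrier G. \<forall>A. A \<subseteq> carrier G \<longrightarrow> m (g <# A) = m A"
    unfolding amenable_group_def by (elim conjE exE) (rule that; assumption)
  note nonneg = m(1)[rule_format] and one = m(2) and add = m(3)[rule_format] and inv = m(4)[rule_format]
  have m0: "m {} = 0" using add[of "{}" "{}"] by simp
  have mUN: "m (\<Union>i\<in>I. E i) = (\<Sum>i\<in>I. m (E i))"
    if "finite I" "\<And>i. i \<in> I \<Longrightarrow> E i \<subseteq> carrier G" "disjoint_family_on E I" for I :: "'i set" and E
    using that
  proof (induction I rule: finite_induct)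
    case empty then show ?case by (simp add: m0)
  next
    case (insert i I)
    have "m (E i \<union> \<Union>(E ` I)) = m (E i) + m (\<Union>(E ` I))"
    proof (rule add)
      show "E i \<subseteq> carrier G" "\<Union>(E ` I) \<subseteq> carrier G" using insert.prems(1) by auto
      show "E i \<inter> \<Union>(E ` I) = {}"
        using insert.prems(2) insert.hyps(2) unfolding disjoint_family_on_def by fastforce
    qed
    moreover have "disjoint_family_on E I"
      using insert.prems(2) by (rule disjoint_family_on_mono[rotated]) blast
    ultimately show ?case using insert by simp
  qed
  let ?J = "carrier G \<times> (UNIV :: bool set)"
  let ?A = "\<lambda>(g, b :: bool). S #> g"
  have "hall_condition ?J ?A"
    unfolding hall_condition_def
  proof (intro allI impI)
    fix I :: "('a \<times> bool) set" assume I: "I \<subseteq> ?J" "finite I"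
    have "card I \<le> card (fst ` I \<times> (UNIV :: bool set))"
      using I by (intro card_mono) (auto intro: rev_image_eqI)
    also have "\<dots> = 2 * card (fst ` I)" by (simp add: card_cartesian_product)
    also have "\<dots> \<le> card (S <#> fst ` I)"
      using I by (intro doubling) auto
    also have "S <#> fst ` I = (\<Union>i\<in>I. ?A i)"
      by (auto simp: set_mult_def r_coset_def split: prod.splits) force+
    finally show "card I \<le> card (\<Union>i\<in>I. ?A i)" .
  qed
  moreover have "finite (?A i)" for i
    using S(1) by (auto simp: r_coset_def split: prod.splits)
  ultimately obtain h where h: "inj_on h ?J" "\<forall>i\<in>?J. h i \<in> ?A i"
    using hall_marriage[of ?J ?A] by blast
  define E where "E = (\<lambda>(b, s). {g \<in> carrier G. h (g, b) = s \<otimes> g})"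
  have Ec: "E p \<subseteq> carrier G" for p by (auto simp: E_def split: prod.splits)
  have part: "(\<Sum>s\<in>S. m (E (b, s))) = 1" for b
  proof -
    have "disjoint_family_on (\<lambda>s. E (b, s)) S"
      using S(2) by (auto simp: disjoint_family_on_def E_def subset_iff)
    moreover have "(\<Union>s\<in>S. E (b, s)) = carrier G"
      using h(2) by (fastforce simp: E_def r_coset_def)
    ultimately show ?thesis
      using mUN[OF S(1), of "\<lambda>s. E (b, s)"] Ec one by simp
  qed
  let ?F = "\<lambda>p. snd p <# E p"
  have dis: "disjoint_family_on ?F ((UNIV :: bool set) \<times> S)"
  proof (unfold disjoint_family_on_def, intro ballI impI)
    fix p q assume p: "p \<in> (UNIV :: bool set) \<times> S" and q: "q \<in> (UNIV :: bool set) \<times> S" and "p \<noteq> q"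
    show "?F p \<inter> ?F q = {}"
    proof (rule ccontr)
      assume "\<not> ?thesis"
      then obtain g g' where g: "g \<in> E p" "g' \<in> E q" "snd p \<otimes> g = snd q \<otimes> g'"
        by (auto simp: l_coset_def)
      then have "h (g, fst p) = h (g', fst q)" by (auto simp: E_def split: prod.splits)
      then have e: "g = g'" "fst p = fst q"
        using inj_onD[OF h(1), of "(g, fst p)" "(g', fst q)"] subsetD[OF Ec g(1)] subsetD[OF Ec g(2)]
          by auto
      have "g \<in> carrier G" "snd p \<in> carrier G" "snd q \<in> carrier G" using g(1) p q S(2) Ec by auto
      then have "snd p = snd q" using g(3) unfolding e(1)[symmetric] by (simp add: right_cancel)
      then show False using e \<open>p \<noteq> q\<close> by (simp add: prod_eq_iff)
    qed
  qed
  have Fc: "?F p \<subseteq> carrier G" if "p \<in> (UNIV :: bool set) \<times> S" for p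
    using that S(2) Ec by (intro l_coset_subset_G) auto
  have "m (\<Union>p\<in>(UNIV :: bool set) \<times> S. ?F p) = (\<Sum>p\<in>(UNIV :: bool set) \<times> S. m (?F p))"
    using S(1) Fc dis by (intro mUN) auto
  also have "\<dots> = (\<Sum>p\<in>(UNIV :: bool set) \<times> S. m (E p))"
    using S(2) Ec by (intro sum.cong refl inv) auto
  also have "\<dots> = (\<Sum>b\<in>(UNIV :: bool set). \<Sum>s\<in>S. m (E (b, s)))"
    by (simp add: sum.cartesian_product)
  also have "\<dots> = 2" by (simp add: part)
  finally have two: "m (\<Union>p\<in>(UNIV :: bool set) \<times> S. ?F p) = 2" .
  let ?X = "\<Union>p\<in>(UNIV :: bool set) \<times> S. ?F p"
  have X: "?X \<subseteq> carrier G" using Fc by blast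
  then have "m (?X \<union> (carrier G - ?X)) = m ?X + m (carrier G - ?X)" by (intro add) auto
  moreover have "?X \<union> (carrier G - ?X) = carrier G" using X by blast
  moreover have "m (carrier G - ?X) \<ge> 0" by (rule nonneg) blast
  ultimately show False using two one by simp
qed

text \<open>
  Folner's theorem. If \<open>L\<close> contains \<open>K\<close> and the unit, every \<open>s \<in> F\<close> satisfies \<open>K s \<subseteq> L F\<close>. So if \<open>L F\<close> is
  not almost invariant, then \<open>L F\<close> is larger than \<open>F\<close> by the fixed factor \<open>1 / (1 - \<delta>)\<close>, and a power of
  \<open>L\<close> doubles every finite set.
\<close>

lemma almost_invariant_nonempty:
  fixes G (structure)
  assumes am: "amenable_group G" and K: "finite K" "K \<subseteq> carrier G" and \<delta>: "\<delta> > 0"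
  shows "almost_invariant G K \<delta> \<noteq> {}"
proof
  assume empty: "almost_invariant G K \<delta> = {}"
  interpret group G using am by (simp add: amenable_group_def)
  have "{\<one>} \<in> almost_invariant G K \<delta>" if "\<delta> \<ge> 1"
    using that by (auto simp: almost_invariant_def)
  then have \<delta>1: "\<delta> < 1" using empty by fastforce
  define r where "r = 1 / (1 - \<delta>)"
  have r: "r > 1" using \<delta> \<delta>1 by (simp add: r_def field_simps)
  define L where "L = insert \<one> K"
  have L: "finite L" "L \<subseteq> carrier G" "\<one> \<in> L" "K \<subseteq> L" using K by (auto simp: L_def)
  have fin_mult: "finite (A <#> B)" if "finite A" "finite B" for A B
    using that by (auto simp: set_mult_def)
  have grow: "r * card F \<le> card (L <#> F)" if F: "finite F" "F \<subseteq> carrier G" for F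
  proof (cases "F = {}")
    case False
    let ?F = "L <#> F"
    have F': "finite ?F" "?F \<subseteq> carrier G"
      using F L fin_mult[of L F] set_mult_closed[of L F] by simp_all
    have sub: "F \<subseteq> {s \<in> ?F. K #> s \<subseteq> ?F}"
    proof
      fix s assume s: "s \<in> F"
      then have "\<one> \<otimes> s \<in> ?F" using L(3) unfolding set_mult_def by blast
      then have "s \<in> ?F" using s F(2) by (simp add: subset_iff)
      moreover have "K #> s \<subseteq> ?F" using s L(4) unfolding set_mult_def r_coset_def by blast
      ultimately show "s \<in> {s \<in> ?F. K #> s \<subseteq> ?F}" by blast
    qed
    then have "card F \<le> card {s \<in> ?F. K #> s \<subseteq> ?F}"
      using F' by (intro card_mono) auto
    moreover have "?F \<noteq> {}" using sub False by blast
    then have "real (card {s \<in> ?F. K #> s \<subseteq> ?F}) < (1 - \<delta>) * real (card ?F)"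
      using empty F' by (auto simp: almost_invariant_def not_le)
    ultimately have "real (card F) \<le> (1 - \<delta>) * real (card ?F)" by linarith
    then show ?thesis using \<delta>1 by (simp add: r_def field_simps)
  qed simp
  have iter: "\<exists>S. finite S \<and> S \<subseteq> carrier G \<and>
      (\<forall>F. finite F \<longrightarrow> F \<subseteq> carrier G \<longrightarrow> r ^ n * card F \<le> card (S <#> F))" for n
  proof (induction n)
    case 0
    have "{\<one>} <#> F = F" if "F \<subseteq> carrier G" for F using that by (auto simp: set_mult_def subset_iff)
    then show ?case by (intro exI[of _ "{\<one>}"]) auto
  next
    case (Suc n)
    then obtain S where S: "finite S" "S \<subseteq> carrier G"
      "\<And>F. finite F \<Longrightarrow> F \<subseteq> carrier G \<Longrightarrow> r ^ n * card F \<le> card (S <#> F)" by blast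
    have "r ^ Suc n * card F \<le> card ((L <#> S) <#> F)" if F: "finite F" "F \<subseteq> carrier G" for F
    proof -
      have "r ^ Suc n * card F = r * (r ^ n * card F)" by simp
      also have "\<dots> \<le> r * card (S <#> F)" using S(3)[OF F] r by (intro mult_left_mono) auto
      also have "\<dots> \<le> card (L <#> (S <#> F))"
        using S F by (intro grow fin_mult set_mult_closed)
      also have "L <#> (S <#> F) = (L <#> S) <#> F"
        using L S F by (intro set_mult_assoc[symmetric])
      finally show ?thesis .
    qed
    then show ?case using fin_mult[OF L(1) S(1)] set_mult_closed[OF L(2) S(2)] by blast
  qed
  obtain n where n: "2 < r ^ n" using real_arch_pow[OF r] by blast
  obtain S where S: "finite S" "S \<subseteq> carrier G"
      "\<And>F. finite F \<Longrightarrow> F \<subseteq> carrier G \<Longrightarrow> r ^ n * card F \<le> card (S <#> F)" using iter[of n] by blast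
  have "2 * card F \<le> card (S <#> F)" if "finite F" "F \<subseteq> carrier G" for F
  proof -
    have "2 * real (card F) \<le> r ^ n * card F" using n by (intro mult_right_mono) auto
    with S(3)[OF that] have "2 * real (card F) \<le> card (S <#> F)" by linarith
    then show ?thesis by linarith
  qed
  then show False using no_mean_if_doubling[OF S(1,2)] am by blast
qed

section \<open>Densities of independence sets\<close>

lemma inv_limsup_pos_iff:
  "inv_limsup G f > 0 \<longleftrightarrow>
     (\<exists>\<epsilon>>0. \<forall>K \<delta>. (K, \<delta>) \<in> invariance_index G \<longrightarrow>
        (\<exists>F\<in>almost_invariant G K \<delta>. f F \<ge> \<epsilon> * real (card F)))"
proof
  assume "inv_limsup G f > 0"
  then obtain e where e: "0 < ereal e" "ereal e < inv_limsup G f"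
    using ereal_dense2 by blast
  have "\<exists>F\<in>almost_invariant G K \<delta>. f F \<ge> e * real (card F)" if i: "(K, \<delta>) \<in> invariance_index G" for K \<delta>
  proof -
    have "inv_limsup G f \<le> (case (K, \<delta>) of (K, \<delta>) \<Rightarrow> SUP F\<in>almost_invariant G K \<delta>. ereal
      (f F / real (card F)))"
      unfolding inv_limsup_tendsto(2) by (rule INF_lower[OF i])
    with e(2) have "ereal e < (SUP F\<in>almost_invariant G K \<delta>. ereal (f F / real (card F)))"
      by (simp add: less_le_trans)
    then obtain F where F: "F \<in> almost_invariant G K \<delta>" "e < f F / real (card F)"
      by (auto simp: less_SUP_iff)
    have "card F > 0" using F(1) by (auto simp: almost_invariant_def card_gt_0_iff)
    with F show ?thesis by (intro bexI[of _ F]) (auto simp: field_simps)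
  qed
  with e(1) show "\<exists>\<epsilon>>0. \<forall>K \<delta>. (K, \<delta>) \<in> invariance_index G \<longrightarrow>
        (\<exists>F\<in>almost_invariant G K \<delta>. f F \<ge> \<epsilon> * real (card F))"
    by (intro exI[of _ e]) simp
next
  assume "\<exists>\<epsilon>>0. \<forall>K \<delta>. (K, \<delta>) \<in> invariance_index G \<longrightarrow>
        (\<exists>F\<in>almost_invariant G K \<delta>. f F \<ge> \<epsilon> * real (card F))"
  then obtain \<epsilon> where \<epsilon>: "\<epsilon> > 0" "\<And>K \<delta>. (K, \<delta>) \<in> invariance_index G \<Longrightarrow>
        \<exists>F\<in>almost_invariant G K \<delta>. f F \<ge> \<epsilon> * real (card F)" by blast
  have "ereal \<epsilon> \<le> inv_limsup G f"
    unfolding inv_limsup_tendsto(2)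
  proof (rule INF_greatest, clarify)
    fix K \<delta> assume "(K, \<delta>) \<in> invariance_index G"
    from \<epsilon>(2)[OF this] obtain F where F: "F \<in> almost_invariant G K \<delta>" "f F \<ge> \<epsilon> * real (card F)" by blast
    have "card F > 0" using F(1) by (auto simp: almost_invariant_def card_gt_0_iff)
    then have "ereal \<epsilon> \<le> ereal (f F / real (card F))" using F(2) by (simp add: field_simps)
    then show "ereal \<epsilon> \<le> (SUP F\<in>almost_invariant G K \<delta>. ereal (f F / real (card F)))"
      by (rule SUP_upper2[OF F(1)])
  qed
  then show "inv_limsup G f > 0" using \<epsilon>(1) by (metis ereal_less(2) less_le_trans)
qed

lemma independence_set_mono:
  "independence_set G \<phi> k A D J \<Longrightarrow> J' \<subseteq> J \<Longrightarrow> D \<subseteq> D' \<Longrightarrow> (\<And>i. i \<in> {1..k} \<Longrightarrow> A i \<subseteq> A' i)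
    \<Longrightarrow> independence_set G \<phi> k A' D' J'"
  unfolding independence_set_def
proof (intro conjI allI impI)
  fix F \<sigma>
  assume h: "J \<subseteq> carrier G \<and> (\<forall>F \<sigma>. F \<noteq> {} \<longrightarrow> finite F \<longrightarrow> F \<subseteq> J \<longrightarrow> \<sigma> \<in> F \<rightarrow> {1..k} \<longrightarrow>
        D \<inter> (\<Inter>s\<in>F. \<phi> s -` A (\<sigma> s)) \<noteq> {})" "J' \<subseteq> J" "D \<subseteq> D'" "\<And>i. i \<in> {1..k} \<Longrightarrow> A i \<subseteq> A' i"
    "F \<noteq> {}" "finite F" "F \<subseteq> J'" "\<sigma> \<in> F \<rightarrow> {1..k}"
  then have "D \<inter> (\<Inter>s\<in>F. \<phi> s -` A (\<sigma> s)) \<noteq> {}" by (meson order_trans)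
  then obtain p where p: "p \<in> D" "\<And>s. s \<in> F \<Longrightarrow> \<phi> s p \<in> A (\<sigma> s)" by auto
  have "\<phi> s p \<in> A' (\<sigma> s)" if "s \<in> F" for s
    using p(2)[OF that] h(4)[OF funcset_mem[OF h(8) that]] by blast
  then have "p \<in> D' \<inter> (\<Inter>s\<in>F. \<phi> s -` A' (\<sigma> s))" using p(1) h(3) by auto
  then show "D' \<inter> (\<Inter>s\<in>F. \<phi> s -` A' (\<sigma> s)) \<noteq> {}" by blast
qed auto

lemma independence_set_finite_iff:
  assumes "finite J" "J \<noteq> {}" "k \<ge> 1"
  shows "independence_set G \<phi> k A D J \<longleftrightarrow> J \<subseteq> carrier G \<and>
    (\<forall>\<sigma>\<in>J \<rightarrow> {1..k}. \<exists>p\<in>D. \<forall>s\<in>J. \<phi> s p \<in> A (\<sigma> s))"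
proof
  assume h: "independence_set G \<phi> k A D J"
  have "\<exists>p\<in>D. \<forall>s\<in>J. \<phi> s p \<in> A (\<sigma> s)" if \<sigma>: "\<sigma> \<in> J \<rightarrow> {1..k}" for \<sigma>
  proof -
    have "D \<inter> (\<Inter>s\<in>J. \<phi> s -` A (\<sigma> s)) \<noteq> {}"
      using h[unfolded independence_set_def, THEN conjunct2, rule_format, of J \<sigma>] assms \<sigma> by blast
    then show ?thesis by auto
  qed
  then show "J \<subseteq> carrier G \<and> (\<forall>\<sigma>\<in>J \<rightarrow> {1..k}. \<exists>p\<in>D. \<forall>s\<in>J. \<phi> s p \<in> A (\<sigma> s))"
    using h[unfolded independence_set_def, THEN conjunct1] by blast
next
  assume h: "J \<subseteq> carrier G \<and> (\<forall>\<sigma>\<in>J \<rightarrow> {1..k}. \<exists>p\<in>D. \<forall>s\<in>J. \<phi> s p \<in> A (\<sigma> s))"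
  show "independence_set G \<phi> k A D J"
    unfolding independence_set_def
  proof (intro conjI allI impI)
    fix F and \<sigma> :: "'a \<Rightarrow> nat" assume F: "F \<noteq> {}" "finite F" "F \<subseteq> J" "\<sigma> \<in> F \<rightarrow> {1..k}"
    let ?\<sigma> = "\<lambda>s. if s \<in> F then \<sigma> s else 1"
    have "?\<sigma> \<in> J \<rightarrow> {1..k}" using F(4) assms(3) by auto
    from bspec[OF conjunct2[OF h] this] obtain p where p: "p \<in> D" "\<forall>s\<in>J. \<phi> s p \<in> A (?\<sigma> s)"
      by (elim bexE) (rule that)
    have "\<phi> s p \<in> A (\<sigma> s)" if "s \<in> F" for s using bspec[OF p(2) subsetD[OF F(3) that]] that by simp
    then have "p \<in> D \<inter> (\<Inter>s\<in>F. \<phi> s -` A (\<sigma> s))" using p(1) by auto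
    then show "D \<inter> (\<Inter>s\<in>F. \<phi> s -` A (\<sigma> s)) \<noteq> {}" by blast
  qed (rule conjunct1[OF h])
qed

lemma independence_set_empty: "independence_set G \<phi> k A D {}"
  by (auto simp: independence_set_def)

lemma max_independence_finite:
  assumes "finite F"
  shows "finite ((\<lambda>J. card (F \<inter> J)) ` {J. independence_set G \<phi> k A D J})"
    and "(\<lambda>J. card (F \<inter> J)) ` {J. independence_set G \<phi> k A D J} \<noteq> {}"
proof -
  have "(\<lambda>J. card (F \<inter> J)) ` {J. independence_set G \<phi> k A D J} \<subseteq> {..card F}"
    using assms by (auto intro: card_mono)
  then show "finite ((\<lambda>J. card (F \<inter> J)) ` {J. independence_set G \<phi> k A D J})"
    by (rule finite_subset) simp
  show "(\<lambda>J. card (F \<inter> J)) ` {J. independence_set G \<phi> k A D J} \<noteq> {}"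
    using independence_set_empty by blast
qed

lemma card_le_max_independence:
  assumes "finite F" "independence_set G \<phi> k A D J" "J \<subseteq> F"
  shows "card J \<le> max_independence G \<phi> k A D F"
proof -
  have "card (F \<inter> J) \<le> max_independence G \<phi> k A D F"
    unfolding max_independence_def using assms(2)
    by (intro Max_ge max_independence_finite[OF assms(1)]) blast
  then show ?thesis using assms(3) by (simp add: Int_absorb1)
qed

lemma max_independence_attained:
  assumes "finite F"
  obtains J where "J \<subseteq> F" "independence_set G \<phi> k A D J" "card J = max_independence G \<phi> k A D F"
proof -
  have "max_independence G \<phi> k A D F \<in> (\<lambda>J. card (F \<inter> J)) ` {J. independence_set G \<phi> k A D J}"
    unfolding max_independence_def by (intro Max_in max_independence_finite[OF assms])
  then obtain J where "independence_set G \<phi> k A D J" "card (F \<inter> J) = max_independence G \<phi> k A D F" by auto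
  then show ?thesis
    by (intro that[of "F \<inter> J"]) (auto elim!: independence_set_mono)
qed

lemma max_independence_mono:
  assumes "finite F" "D \<subseteq> D'" "\<And>i. i \<in> {1..k} \<Longrightarrow> A i \<subseteq> A' i"
  shows "max_independence G \<phi> k A D F \<le> max_independence G \<phi> k A' D' F"
proof -
  obtain J where J: "J \<subseteq> F" "independence_set G \<phi> k A D J" "card J = max_independence G \<phi> k A D F"
    by (rule max_independence_attained[OF assms(1)])
  have "independence_set G \<phi> k A' D' J"
    by (rule independence_set_mono[OF J(2) order_refl assms(2,3)])
  from card_le_max_independence[OF assms(1) this J(1)] show ?thesis using J(3) by simp
qed

lemma max_independence_le_card:
  assumes "finite F" shows "max_independence G \<phi> k A D F \<le> card F"
proof -
  obtain J where J: "J \<subseteq> F" "independence_set G \<phi> k A D J" "card J = max_independence G \<phi> k A D F"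
    by (rule max_independence_attained[OF assms(1)])
  show ?thesis using card_mono[OF assms J(1)] J(3) by simp
qed

lemma mu_max_independence_attained:
  assumes "finite F" "borel_large \<mu> \<delta> \<noteq> {}"
  obtains D where "D \<in> borel_large \<mu> \<delta>" "mu_max_independence G \<phi> \<mu> k A \<delta> F = max_independence G \<phi> k A D F"
    and "\<And>D'. D' \<in> borel_large \<mu> \<delta> \<Longrightarrow> mu_max_independence G \<phi> \<mu> k A \<delta> F \<le> max_independence G \<phi> k A D' F"
proof -
  let ?S = "(\<lambda>D. max_independence G \<phi> k A D F) ` borel_large \<mu> \<delta>"
  have "?S \<subseteq> {..card F}" using max_independence_le_card[OF assms(1)] by auto
  then have fin: "finite ?S" by (rule finite_subset) simp
  then have "Min ?S \<in> ?S" using assms(2) by (intro Min_in) auto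
  then obtain D where "D \<in> borel_large \<mu> \<delta>" "Min ?S = max_independence G \<phi> k A D F" by auto
  moreover have "Min ?S \<le> max_independence G \<phi> k A D' F" if "D' \<in> borel_large \<mu> \<delta>" for D'
    using that by (intro Min_le[OF fin] imageI)
  ultimately show ?thesis
    by (intro that[of D]) (simp_all only: mu_max_independence_def)
qed

text \<open>
  Double counting of the pairs \<open>(t, s)\<close> with \<open>t s \<in> J\<close>. For fixed \<open>t\<close>, the map \<open>s \<mapsto> inv t s\<close> sends the part
  of \<open>J\<close> that lies in the almost invariant core of \<open>F\<close> injectively into \<open>{s \<in> F. t s \<in> J}\<close>.
\<close>

lemma (in group) sum_card_translates:
  fixes \<delta> :: real
  assumes F0: "finite F0" "F0 \<subseteq> carrier G" and F: "finite F" "F \<subseteq> carrier G"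
    and J: "J \<subseteq> F"
    and inv: "(1 - \<delta>) * card F \<le> card {s \<in> F. (\<lambda>t. inv t) ` F0 #> s \<subseteq> F}"
  shows "(\<Sum>s\<in>F. real (card {t \<in> F0. t \<otimes> s \<in> J})) \<ge> real (card F0) * (real (card J) - \<delta> * real (card F))"
proof -
  have finJ: "finite J" using J F(1) by (rule finite_subset)
  let ?I = "{s \<in> F. (\<lambda>t. inv t) ` F0 #> s \<subseteq> F}"
  have each: "real (card J) - \<delta> * real (card F) \<le> card {s \<in> F. t \<otimes> s \<in> J}" if t: "t \<in> F0" for t
  proof -
    have tc: "t \<in> carrier G" using t F0 by blast
    have inj: "inj_on (\<lambda>s. inv t \<otimes> s) (J \<inter> ?I)"
      using J F(2) tc by (intro inj_onI) (simp add: subset_iff)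
    have "(\<lambda>s. inv t \<otimes> s) ` (J \<inter> ?I) \<subseteq> {s \<in> F. t \<otimes> s \<in> J}"
    proof
      fix u assume "u \<in> (\<lambda>s. inv t \<otimes> s) ` (J \<inter> ?I)"
      then obtain s where s: "s \<in> J" "s \<in> ?I" "u = inv t \<otimes> s" by blast
      then have "u \<in> F" using t by (auto simp: r_coset_def)
      moreover have "t \<otimes> u = s" using s J F(2) tc by (simp add: m_assoc[symmetric] subset_iff)
      ultimately show "u \<in> {s \<in> F. t \<otimes> s \<in> J}" using s(1) by simp
    qed
    then have "card (J \<inter> ?I) \<le> card {s \<in> F. t \<otimes> s \<in> J}"
      using card_inj_on_le[OF inj] F(1) by simp
    moreover have "card J + card ?I \<le> card F + card (J \<inter> ?I)"
    proof -
      have "card J + card ?I = card (J \<union> ?I) + card (J \<inter> ?I)"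
        using finJ F(1) by (intro card_Un_Int) auto
      moreover have "card (J \<union> ?I) \<le> card F" using J F(1) by (intro card_mono) auto
      ultimately show ?thesis by simp
    qed
    then have "real (card J) + real (card ?I) \<le> real (card F) + real (card (J \<inter> ?I))"
      by linarith
    ultimately show ?thesis using inv by (simp add: algebra_simps)
  qed
  have cd: "real (card {x \<in> A. P x}) = (\<Sum>x\<in>A. if P x then 1 else 0)" if "finite A" for A :: "'a set" and P
    using that by (simp add: sum.If_cases Int_def)
  have "real (card F0) * (real (card J) - \<delta> * real (card F)) =
    (\<Sum>t\<in>F0. real (card J) - \<delta> * real (card F))" by simp
  also have "\<dots> \<le> (\<Sum>t\<in>F0. real (card {s \<in> F. t \<otimes> s \<in> J}))"
    by (rule sum_mono) (rule each)
  also have "\<dots> = (\<Sum>t\<in>F0. \<Sum>s\<in>F. if t \<otimes> s \<in> J then 1 else 0)"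
    using F(1) by (simp add: cd)
  also have "\<dots> = (\<Sum>s\<in>F. \<Sum>t\<in>F0. if t \<otimes> s \<in> J then 1 else 0)"
    by (rule sum.swap)
  also have "\<dots> = (\<Sum>s\<in>F. real (card {t \<in> F0. t \<otimes> s \<in> J}))"
    using F0(1) by (simp add: cd)
  finally show ?thesis .
qed

text \<open>
  A pattern on \<open>T\<close> is realised at \<open>s p\<close> as soon as the translated pattern on \<open>T s\<close> is realised at \<open>p\<close>.
\<close>

lemma independence_set_translate:
  fixes G (structure)
  assumes "group_action G UNIV \<phi>" and J: "independence_set G \<phi> k A UNIV J" and s: "s \<in> carrier G"
    and T: "T \<subseteq> carrier G" "finite T" "\<And>t. t \<in> T \<Longrightarrow> t \<otimes> s \<in> J" and k: "k \<ge> 1"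
  shows "independence_set G \<phi> k A UNIV T"
proof (cases "T = {}")
  case True
  then show ?thesis by (simp add: independence_set_empty)
next
  case False
  interpret group_action G UNIV \<phi> by fact
  interpret group G using group_hom group_hom.axioms(1) by blast
  let ?T = "(\<lambda>t. t \<otimes> s) ` T"
  have "independence_set G \<phi> k A UNIV ?T"
    by (rule independence_set_mono[OF J]) (use T(3) in auto)
  then have h: "\<forall>\<sigma>\<in>?T \<rightarrow> {1..k}. \<exists>p\<in>UNIV. \<forall>s\<in>?T. \<phi> s p \<in> A (\<sigma> s)"
    using independence_set_finite_iff[of ?T k G \<phi> A UNIV] False T(2) k by simp
  have "\<exists>p\<in>UNIV. \<forall>t\<in>T. \<phi> t p \<in> A (\<sigma> t)" if \<sigma>: "\<sigma> \<in> T \<rightarrow> {1..k}" for \<sigma>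
  proof -
    have cancel: "t \<otimes> s \<otimes> inv s = t" if "t \<in> T" for t
      using that T(1) s by (simp add: m_assoc subset_iff)
    have "(\<lambda>u. \<sigma> (u \<otimes> inv s)) \<in> ?T \<rightarrow> {1..k}" using \<sigma> cancel by auto
    from bspec[OF h this] obtain p where p: "\<forall>u\<in>?T. \<phi> u p \<in> A (\<sigma> (u \<otimes> inv s))"
      by (elim bexE) (rule that)
    have "\<phi> t (\<phi> s p) \<in> A (\<sigma> t)" if t: "t \<in> T" for t
    proof -
      have "\<phi> (t \<otimes> s) p \<in> A (\<sigma> (t \<otimes> s \<otimes> inv s))" using p t by blast
      then show ?thesis using cancel[OF t] composition_rule[of p t s] t T(1) s by auto
    qed
    then show ?thesis by blast
  qed
  then show ?thesis using independence_set_finite_iff[OF T(2) False k, of G \<phi> A UNIV] T(1) by blast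
qed

text \<open>
  An independence set \<open>J\<close> of density \<open>b\<close> in a very invariant \<open>F\<close> meets the translates \<open>F0 s\<close>, on average
  over \<open>s\<close>, in a proportion of almost \<open>b\<close>. Each such intersection translates back to an independence set
  inside \<open>F0\<close>. This replaces the quasi-tiling argument that a merely subadditive function would need.
\<close>

lemma inv_limsup_le_finite:
  fixes G (structure)
  assumes act: "group_action G UNIV \<phi>" and k: "k \<ge> 1"
    and F0: "finite F0" "F0 \<subseteq> carrier G" "F0 \<noteq> {}"
  shows "inv_limsup G (\<lambda>F. real (max_independence G \<phi> k A UNIV F))
           \<le> ereal (max_independence G \<phi> k A UNIV F0 / card F0)"
proof (rule ccontr)
  interpret group_action G UNIV \<phi> by fact
  interpret group G using group_hom group_hom.axioms(1) by blast
  let ?f = "\<lambda>F. real (max_independence G \<phi> k A UNIV F)"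
  assume "\<not> ?thesis"
  then obtain b where b: "ereal (?f F0 / card F0) < ereal b" "ereal b < inv_limsup G ?f"
    using ereal_dense2 by (metis not_le)
  define \<delta> where "\<delta> = b - ?f F0 / card F0"
  have \<delta>: "\<delta> > 0" using b(1) by (simp add: \<delta>_def)
  let ?K = "(\<lambda>t. inv t) ` F0"
  have i: "(?K, \<delta>) \<in> invariance_index G" using F0 \<delta> by (auto simp: invariance_index_def)
  have "inv_limsup G ?f \<le> (case (?K, \<delta>) of (K, \<delta>) \<Rightarrow> SUP F\<in>almost_invariant G K \<delta>. ereal
    (?f F / real (card F)))"
    unfolding inv_limsup_tendsto(2) by (rule INF_lower[OF i])
  with b(2) have "ereal b < (SUP F\<in>almost_invariant G ?K \<delta>. ereal (?f F / real (card F)))"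
    by (simp add: less_le_trans)
  then obtain F where F: "F \<in> almost_invariant G ?K \<delta>" "b < ?f F / real (card F)"
    by (auto simp: less_SUP_iff)
  then have F': "finite F" "F \<noteq> {}" "F \<subseteq> carrier G" "(1 - \<delta>) * card F \<le> card {s \<in> F. ?K #> s \<subseteq> F}"
    by (auto simp: almost_invariant_def)
  obtain J where J: "J \<subseteq> F" "independence_set G \<phi> k A UNIV J" "card J = max_independence G \<phi> k A UNIV F"
    by (rule max_independence_attained[OF F'(1)])
  have pos: "card F > 0" "card F0 > 0" using F' F0 by (auto simp: card_gt_0_iff)
  have "(\<Sum>s\<in>F. real (card {t \<in> F0. t \<otimes> s \<in> J})) \<le> (\<Sum>s\<in>F. ?f F0)"
  proof (rule sum_mono)
    fix s assume s: "s \<in> F"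
    have "independence_set G \<phi> k A UNIV {t \<in> F0. t \<otimes> s \<in> J}"
      by (rule independence_set_translate[OF act J(2), of s]) (use F'(3) F0 s k in auto)
    then show "real (card {t \<in> F0. t \<otimes> s \<in> J}) \<le> ?f F0"
      using card_le_max_independence[OF F0(1), of G \<phi> k A UNIV "{t \<in> F0. t \<otimes> s \<in> J}"] by auto
  qed
  also have "\<dots> = card F * ?f F0" by simp
  finally have "card F0 * (card J - \<delta> * card F) \<le> card F * ?f F0"
    using sum_card_translates[OF F0(1,2) F'(1,3) J(1) F'(4)] by linarith
  moreover have "card J > b * card F" using F(2) pos J(3) by (simp add: field_simps)
  then have "real (card F0) * (b * card F - \<delta> * card F) < card F0 * (card J - \<delta> * card F)"
    using pos by (intro mult_strict_left_mono) auto
  ultimately have "real (card F0) * (b * card F - \<delta> * card F) < card F * ?f F0" by linarith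
  then have "real (card F) * (card F0 * (b - \<delta>)) < real (card F) * ?f F0"
    by (simp add: algebra_simps)
  then have "card F0 * (b - \<delta>) < ?f F0" using pos by (simp add: mult_less_cancel_left_pos)
  then show False using pos by (simp add: \<delta>_def)
qed

lemma has_inv_limit_max_independence:
  fixes G (structure)
  assumes am: "amenable_group G" and act: "group_action G UNIV \<phi>" and k: "k \<ge> 1"
  shows "has_inv_limit G (\<lambda>F. real (max_independence G \<phi> k A UNIV F))
           (inv_limsup G (\<lambda>F. real (max_independence G \<phi> k A UNIV F)))"
proof -
  let ?f = "\<lambda>F. real (max_independence G \<phi> k A UNIV F)"
  have "inv_liminf G ?f \<le> inv_limsup G ?f"
  proof (rule tendsto_le[OF invariance_net_neq_bot inv_limsup_tendsto(1) inv_liminf_tendsto(1)])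
    have "(INF F\<in>almost_invariant G K \<delta>. ereal (?f F / card F)) \<le>
      (SUP F\<in>almost_invariant G K \<delta>. ereal (?f F / card F))"
      if "(K, \<delta>) \<in> invariance_index G" for K \<delta>
      using that almost_invariant_nonempty[OF am, of K \<delta>]
      by (intro INF_le_SUP) (simp add: invariance_index_def)
    moreover have "({}, 1) \<in> invariance_index G" by (simp add: invariance_index_def)
    ultimately show "\<forall>\<^sub>F x in invariance_net G.
        (case x of (K, \<delta>) \<Rightarrow> INF F\<in>almost_invariant G K \<delta>. ereal (?f F / real (card F)))
        \<le> (case x of (K, \<delta>) \<Rightarrow> SUP F\<in>almost_invariant G K \<delta>. ereal (?f F / real (card F)))"
      unfolding eventually_invariance_net by fastforce
  qed
  moreover have "inv_limsup G ?f \<le> inv_liminf G ?f"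
  proof -
    \<comment> \<open>Every nonempty finite subset of the group is almost invariant for this index.\<close>
    have i: "({}, 1) \<in> invariance_index G" by (simp add: invariance_index_def)
    have "inv_limsup G ?f \<le> (INF F\<in>almost_invariant G {} 1. ereal (?f F / real (card F)))"
      by (rule INF_greatest, rule inv_limsup_le_finite[OF act k]) (auto simp: almost_invariant_def)
    also have "\<dots> \<le> inv_liminf G ?f"
      unfolding inv_liminf_tendsto(2) by (rule SUP_upper2[OF i]) simp
    finally show ?thesis .
  qed
  ultimately show ?thesis unfolding has_inv_limit_def by simp
qed

lemma IE_tuples_iff:
  fixes G (structure)
  assumes am: "amenable_group G" and act: "group_action G UNIV \<phi>" and k: "k \<ge> 1"
  shows "x \<in> IE_tuples G \<phi> k \<longleftrightarrow> x \<in> {1..k} \<rightarrow>\<^sub>E UNIV \<and>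
     (\<forall>U. (\<forall>i\<in>{1..k}. x i \<in> interior (U i)) \<longrightarrow>
        inv_limsup G (\<lambda>F. real (max_independence G \<phi> k U UNIV F)) > 0)"
proof -
  have "(\<exists>L>0. has_inv_limit G (\<lambda>F. real (max_independence G \<phi> k U UNIV F)) L)
    \<longleftrightarrow> inv_limsup G (\<lambda>F. real (max_independence G \<phi> k U UNIV F)) > 0" for U
    using has_inv_limit_max_independence[OF am act k, of U] unfolding has_inv_limit_def by blast
  then show ?thesis unfolding IE_tuples_def by simp
qed

section \<open>Cover numbers and shattered sets\<close>

text \<open>
  An \<open>\<iota> \<in> V\<close> stands for the box of all patterns that differ from \<open>\<iota>\<close> at every coordinate in \<open>Z\<close>. Patterns
  may also take the value 0, which lies outside the labels \<open>{1..k}\<close> and so never obstructs a box.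
\<close>

definition cover_by :: "nat \<Rightarrow> 'z set \<Rightarrow> ('z \<Rightarrow> nat) set \<Rightarrow> ('z \<Rightarrow> nat) set \<Rightarrow> bool" where
  "cover_by k Z S V \<longleftrightarrow> finite V \<and> (\<forall>\<iota>\<in>V. \<forall>z. \<iota> z \<in> {1..k}) \<and> (\<forall>y\<in>S. \<exists>\<iota>\<in>V. \<forall>z\<in>Z. y z \<noteq> \<iota> z)"

definition cover_number :: "nat \<Rightarrow> 'z set \<Rightarrow> ('z \<Rightarrow> nat) set \<Rightarrow> nat" where
  "cover_number k Z S = (LEAST n. \<exists>V. cover_by k Z S V \<and> card V = n)"

definition shattered :: "nat \<Rightarrow> 'z set \<Rightarrow> ('z \<Rightarrow> nat) set \<Rightarrow> 'z set set" where
  "shattered k Z S = {W. W \<subseteq> Z \<and> (\<forall>\<sigma>\<in>W \<rightarrow> {1..k}. \<exists>y\<in>S. \<forall>w\<in>W. y w = \<sigma> w)}"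

lemma cover_by_exists:
  assumes "finite Z" "k \<ge> 2"
  shows "\<exists>V. cover_by k Z S V"
proof -
  let ?ext = "\<lambda>f z. if z \<in> Z then f z else 1 :: nat"
  let ?V = "?ext ` (Z \<rightarrow>\<^sub>E {1..k})"
  have "\<exists>\<iota>\<in>?V. \<forall>z\<in>Z. y z \<noteq> \<iota> z" for y :: "'a \<Rightarrow> nat"
  proof
    show "?ext (\<lambda>z\<in>Z. if y z = 1 then 2 else 1) \<in> ?V"
      using assms(2) by (intro imageI) auto
  qed auto
  moreover have "finite ?V"
    using assms by (intro finite_imageI finite_PiE) auto
  moreover have "\<forall>\<iota>\<in>?V. \<forall>z. \<iota> z \<in> {1..k}"
    using assms(2) by (fastforce simp: PiE_iff)
  ultimately show ?thesis
    unfolding cover_by_def by blast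
qed

lemma cover_number_le: "cover_by k Z S V \<Longrightarrow> cover_number k Z S \<le> card V"
  unfolding cover_number_def by (rule Least_le) blast

lemma cover_number_attained:
  assumes "finite Z" "k \<ge> 2"
  obtains V where "cover_by k Z S V" "card V = cover_number k Z S"
proof -
  have "\<exists>V. cover_by k Z S V \<and> card V = cover_number k Z S"
    unfolding cover_number_def
    by (rule LeastI_ex) (use cover_by_exists[OF assms] in blast)
  then show ?thesis using that by blast
qed

lemma cover_number_Un:
  assumes "finite Z" "k \<ge> 2"
  shows "cover_number k Z (S \<union> T) \<le> cover_number k Z S + cover_number k Z T"
proof -
  obtain V where V: "cover_by k Z S V" "card V = cover_number k Z S"
    by (rule cover_number_attained[OF assms])
  obtain W where W: "cover_by k Z T W" "card W = cover_number k Z T"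
    by (rule cover_number_attained[OF assms])
  have "cover_by k Z (S \<union> T) (V \<union> W)"
    using V(1) W(1) by (simp add: cover_by_def ball_Un bex_Un)
  then have "cover_number k Z (S \<union> T) \<le> card (V \<union> W)"
    by (rule cover_number_le)
  also have "\<dots> \<le> card V + card W" by (rule card_Un_le)
  finally show ?thesis using V W by simp
qed

text \<open>
  If no pattern uses the label \<open>i\<close> at \<open>z\<close>, every box can forbid \<open>i\<close> at \<open>z\<close>, so the new coordinate
  costs nothing.
\<close>

lemma cover_number_insert:
  assumes "finite Z" "k \<ge> 2" "i \<in> {1..k}" "\<And>y. y \<in> S \<Longrightarrow> y z \<noteq> i"
  shows "cover_number k (insert z Z) S \<le> cover_number k Z S"
proof -
  obtain V where V: "cover_by k Z S V" "card V = cover_number k Z S"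
    by (rule cover_number_attained[OF assms(1,2)])
  let ?W = "(\<lambda>\<iota>. \<iota>(z := i)) ` V"
  have "cover_by k (insert z Z) S ?W"
    using V(1) assms(3,4) unfolding cover_by_def by fastforce
  then have "cover_number k (insert z Z) S \<le> card ?W"
    by (rule cover_number_le)
  also have "\<dots> \<le> card V"
    using V(1) by (intro card_image_le) (simp add: cover_by_def)
  finally show ?thesis using V by simp
qed

lemma cover_number_empty_coords:
  assumes "k \<ge> 2"
  shows "cover_number k {} S \<le> 1"
proof -
  have "cover_by k {} S {\<lambda>_. 1}"
    using assms by (simp add: cover_by_def)
  from cover_number_le[OF this] show ?thesis by simp
qed

lemma cover_number_empty: "cover_number k Z {} = 0"
  using cover_number_le[of k Z "{}" "{}"] by (simp add: cover_by_def)

text \<open>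
  An element counted \<open>k\<close> times on the left lies in the intersection; all others are counted at most
  \<open>k - 1\<close> times.
\<close>

lemma sum_card_le_card_UN_INT:
  fixes A :: "nat \<Rightarrow> 'a set"
  assumes "k \<ge> 1" "\<And>i. i \<in> {1..k} \<Longrightarrow> finite (A i)"
  shows "(\<Sum>i\<in>{1..k}. card (A i)) \<le> (k - 1) * card (\<Union>i\<in>{1..k}. A i) + card (\<Inter>i\<in>{1..k}. A i)"
proof -
  define U where "U = (\<Union>i\<in>{1..k}. A i)"
  define I where "I = (\<Inter>i\<in>{1..k}. A i)"
  have fin: "finite U" unfolding U_def using assms(2) by blast
  have IU: "I \<subseteq> U" using assms(1) by (fastforce simp: U_def I_def)
  have "(\<Sum>i\<in>{1..k}. card (A i)) = (\<Sum>i\<in>{1..k}. \<Sum>w\<in>U. if w \<in> A i then 1 else 0)"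
  proof (rule sum.cong[OF refl])
    fix i assume i: "i \<in> {1..k}"
    then have "U \<inter> {w. w \<in> A i} = A i" by (auto simp: U_def)
    then show "card (A i) = (\<Sum>w\<in>U. if w \<in> A i then 1 else 0)"
      using fin by (simp add: sum.If_cases)
  qed
  also have "\<dots> = (\<Sum>w\<in>U. \<Sum>i\<in>{1..k}. if w \<in> A i then 1 else 0)"
    by (rule sum.swap)
  also have "\<dots> \<le> (\<Sum>w\<in>U. (k - 1) + (if w \<in> I then 1 else 0))"
  proof (rule sum_mono)
    fix w
    have e: "(\<Sum>i\<in>{1..k}. if w \<in> A i then 1 else 0) = card ({1..k} \<inter> {i. w \<in> A i})"
      by (simp add: sum.If_cases)
    show "(\<Sum>i\<in>{1..k}. if w \<in> A i then 1 else 0) \<le> (k - 1) + (if w \<in> I then 1 else 0)"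
    proof (cases "w \<in> I")
      case True
      have "card ({1..k} \<inter> {i. w \<in> A i}) \<le> card {1..k}" by (intro card_mono) auto
      with True e assms(1) show ?thesis by simp
    next
      case False
      then have "{1..k} \<inter> {i. w \<in> A i} \<subset> {1..k}" by (auto simp: I_def)
      then have "card ({1..k} \<inter> {i. w \<in> A i}) < card {1..k}" by (intro psubset_card_mono) auto
      with False e show ?thesis by simp
    qed
  qed
  also have "\<dots> = (k - 1) * card U + card (U \<inter> I)"
    using fin by (simp add: sum.distrib sum.If_cases)
  also have "U \<inter> I = I"
    using IU by blast
  finally show ?thesis unfolding U_def I_def .
qed

text \<open>
  Induction on the number of coordinates. Fix a coordinate \<open>z\<close>. If some label \<open>i\<close> is rare at \<open>z\<close>, in the
  sense that the patterns using it have cover number below the fraction \<open>\<epsilon>\<close>, discard these patterns; the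
  rest avoids \<open>i\<close>, so \<open>z\<close> can be forgotten at the cost of a factor \<open>1 - \<epsilon>\<close>. If no label is rare, let
  \<open>A i\<close> be the family shattered by the patterns with label \<open>i\<close> at \<open>z\<close>. Every member of the union of
  these families is shattered, and every member of their intersection remains so after adding \<open>z\<close>. The
  two families together have at least \<open>k / (k - 1)\<close> times as many members as the smallest \<open>A i\<close>, and the
  condition on \<open>a\<close> says that this gain pays for the loss of the factor \<open>\<epsilon>\<close>.
\<close>

lemma card_shattered_ge:
  fixes \<epsilon> a :: real
  assumes "finite Z" "k \<ge> 2" "0 < \<epsilon>" "\<epsilon> < 1" "a > 0"
    and a: "real k / real (k - 1) * \<epsilon> powr a \<ge> 1"
  shows "real (card (shattered k Z S)) \<ge> ((1 - \<epsilon>) ^ card Z * real (cover_number k Z S)) powr a"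
  using assms(1)
proof (induction Z arbitrary: S rule: finite_induct)
  case empty
  show ?case
  proof (cases "S = {}")
    case True
    then show ?thesis using \<open>a > 0\<close> by (simp add: cover_number_empty)
  next
    case False
    then have "shattered k {} S = {{}}"
      by (auto simp: shattered_def)
    moreover have "real (cover_number k {} S) powr a \<le> 1 powr a"
      using cover_number_empty_coords[OF assms(2), of S] \<open>a > 0\<close> by (intro powr_mono2) auto
    ultimately show ?thesis by simp
  qed
next
  case (insert z Z)
  have finZ: "finite (insert z Z)" using insert by simp
  have fin_sh: "finite (shattered k Z' T)" if "finite Z'" for Z' and T :: "('a \<Rightarrow> nat) set"
    using that finite_subset[of "shattered k Z' T" "Pow Z'"] by (auto simp: shattered_def)
  let ?n = "card Z" and ?N = "real (cover_number k (insert z Z) S)"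
  let ?Si = "\<lambda>i. {y \<in> S. y z = i}"
  show ?case
  proof (cases "\<exists>i\<in>{1..k}. real (cover_number k (insert z Z) (?Si i)) < \<epsilon> * ?N")
    case True
    then obtain i where i: "i \<in> {1..k}" "real (cover_number k (insert z Z) (?Si i)) < \<epsilon> * ?N"
      by blast
    let ?T = "{y \<in> S. y z \<noteq> i}"
    have "S = ?Si i \<union> ?T" by blast
    then have "?N \<le> real (cover_number k (insert z Z) (?Si i)) + real (cover_number k (insert z Z) ?T)"
      using cover_number_Un[OF finZ assms(2), of "?Si i" ?T] by simp
    then have "(1 - \<epsilon>) * ?N \<le> real (cover_number k (insert z Z) ?T)"
      using i(2) by (simp add: algebra_simps)
    also have "\<dots> \<le> real (cover_number k Z ?T)"
      using cover_number_insert[OF insert(1) assms(2) i(1), of ?T z] by simp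
    finally have "(1 - \<epsilon>) ^ card (insert z Z) * ?N \<le> (1 - \<epsilon>) ^ ?n * real (cover_number k Z ?T)"
      using insert(1,2) assms(4) by (simp add: mult.assoc mult.left_commute[of "1-\<epsilon>"] mult_left_mono)
    then have "((1 - \<epsilon>) ^ card (insert z Z) * ?N) powr a \<le>
      ((1 - \<epsilon>) ^ ?n * real (cover_number k Z ?T)) powr a"
      using assms(4,5) by (intro powr_mono2) auto
    also have "\<dots> \<le> card (shattered k Z ?T)"
      by (rule insert.IH)
    also have "\<dots> \<le> card (shattered k (insert z Z) S)"
    proof -
      have "shattered k Z ?T \<subseteq> shattered k (insert z Z) S"
        unfolding shattered_def by blast
      from card_mono[OF fin_sh[OF finZ] this] show ?thesis by simp
    qed
    finally show ?thesis .
  next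
    case False
    define A where "A i = shattered k Z (?Si i)" for i
    define M where "M = ((1 - \<epsilon>) ^ ?n * (\<epsilon> * ?N)) powr a"
    have finA: "finite (A i)" for i unfolding A_def by (rule fin_sh[OF insert(1)])
    have MA: "M \<le> card (A i)" if i: "i \<in> {1..k}" for i
    proof -
      \<comment> \<open>All patterns carry the label \<open>i\<close> at \<open>z\<close>, so any other label is avoided there; this uses \<open>k \<ge> 2\<close>.\<close>
      obtain j where j: "j \<in> {1..k}" "j \<noteq> i"
        using assms(2) by (metis atLeastAtMost_iff le_numeral_extra(4) one_le_numeral order_trans
            numeral_eq_one_iff semiring_norm(85))
      have "\<epsilon> * ?N \<le> real (cover_number k (insert z Z) (?Si i))"
        using False i by (simp add: not_less)
      also have "\<dots> \<le> real (cover_number k Z (?Si i))"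
        using cover_number_insert[OF insert(1) assms(2) j(1), of "?Si i" z] j(2) by simp
      finally have "M \<le> ((1 - \<epsilon>) ^ ?n * real (cover_number k Z (?Si i))) powr a"
        unfolding M_def using assms(3-5) by (intro powr_mono2 mult_left_mono) auto
      also have "\<dots> \<le> card (A i)" unfolding A_def by (rule insert.IH)
      finally show ?thesis .
    qed
    let ?U = "\<Union>i\<in>{1..k}. A i" and ?I = "\<Inter>i\<in>{1..k}. A i"
    have one: "1 \<in> {1..k}" using assms(2) by simp
    have finU: "finite ?U" and finI: "finite ?I" using finA one by blast+
    have zA: "z \<notin> W" if "W \<in> A i" for W i using that insert(2) by (auto simp: A_def shattered_def)
    have sub: "?U \<union> Set.insert z ` ?I \<subseteq> shattered k (insert z Z) S"
    proof
      fix W assume "W \<in> ?U \<union> Set.insert z ` ?I"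
      then consider "W \<in> ?U" | W' where "W' \<in> ?I" "W = Set.insert z W'" by blast
      then show "W \<in> shattered k (insert z Z) S"
      proof cases
        case 1 then show ?thesis by (fastforce simp: A_def shattered_def)
      next
        case 2
        have "W' \<subseteq> Z" using 2(1) one by (auto simp: A_def shattered_def)
        moreover have "\<exists>y\<in>S. \<forall>w\<in>Set.insert z W'. y w = \<sigma> w" if \<sigma>: "\<sigma> \<in> Set.insert z W' \<rightarrow> {1..k}" for \<sigma>
        proof -
          have "\<sigma> z \<in> {1..k}" "\<sigma> \<in> W' \<rightarrow> {1..k}" using \<sigma> by auto
          then have "\<exists>y\<in>?Si (\<sigma> z). \<forall>w\<in>W'. y w = \<sigma> w"
            using 2(1) by (auto simp: A_def shattered_def)
          then show ?thesis by auto
        qed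
        ultimately show ?thesis using 2(2) by (auto simp: shattered_def)
      qed
    qed
    have inj: "inj_on (Set.insert z) ?I"
      using zA one by (intro inj_onI) (metis INT_E insert_ident)
    have disj: "?U \<inter> Set.insert z ` ?I = {}" using zA by blast
    have "card ?U + card ?I = card (?U \<union> Set.insert z ` ?I)"
      using finU finI inj disj by (subst card_Un_disjoint) (auto simp: card_image)
    also have "\<dots> \<le> card (shattered k (insert z Z) S)"
      by (rule card_mono[OF fin_sh[OF finZ] sub])
    finally have lower: "real (card ?U) + real (card ?I) \<le> card (shattered k (insert z Z) S)"
      by (simp add: of_nat_add[symmetric] del: of_nat_add)
    have "real k * M = (\<Sum>i\<in>{1..k}. M)" by simp
    also have "\<dots> \<le> (\<Sum>i\<in>{1..k}. real (card (A i)))" by (rule sum_mono) (rule MA)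
    also have "\<dots> \<le> real (k - 1) * card ?U + card ?I"
    proof -
      have "(\<Sum>i\<in>{1..k}. card (A i)) \<le> (k - 1) * card ?U + card ?I"
        using sum_card_le_card_UN_INT[of k A] finA assms(2) by fastforce
      then have "real (\<Sum>i\<in>{1..k}. card (A i)) \<le> real ((k - 1) * card ?U + card ?I)"
        by (rule of_nat_mono)
      then show ?thesis unfolding of_nat_sum of_nat_mult of_nat_add .
    qed
    also have "\<dots> \<le> real (k - 1) * (real (card ?U) + real (card ?I))"
      using assms(2) mult_right_mono[of 1 "real (k - 1)" "real (card ?I)"] by (simp add: algebra_simps)
    also have "\<dots> \<le> real (k - 1) * card (shattered k (insert z Z) S)"
      using lower by (intro mult_left_mono) auto
    finally have "real k / real (k - 1) * M \<le> card (shattered k (insert z Z) S)"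
      using assms(2) by (simp add: field_simps)
    moreover have "((1 - \<epsilon>) ^ card (insert z Z) * ?N) powr a \<le> real k / real (k - 1) * M"
    proof -
      have "((1 - \<epsilon>) ^ card (insert z Z) * ?N) powr a \<le> ((1 - \<epsilon>) ^ ?n * ?N) powr a"
        using insert(1,2) assms(3-5) by (intro powr_mono2 mult_right_mono) (auto simp: mult_left_le_one_le)
      also have "\<dots> = 1 * ((1 - \<epsilon>) ^ ?n * ?N) powr a" by simp
      also have "\<dots> \<le> real k / real (k - 1) * \<epsilon> powr a * ((1 - \<epsilon>) ^ ?n * ?N) powr a"
        by (rule mult_right_mono[OF a]) simp
      also have "\<dots> = real k / real (k - 1) * M"
        using assms(3,4) by (simp add: M_def powr_mult)
      finally show ?thesis .
    qed
    ultimately show ?thesis by (rule order_trans[rotated])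
  qed
qed

lemma sum_power_card_Pow:
  fixes t :: real
  assumes "finite Z"
  shows "(\<Sum>W\<in>Pow Z. t ^ card W) = (1 + t) ^ card Z"
  using assms
proof (induction Z rule: finite_induct)
  case (insert z Z)
  have inj: "inj_on (Set.insert z) (Pow Z)"
    using insert(2) by (intro inj_onI) (auto simp: insert_ident)
  have "(\<Sum>W\<in>Pow (Set.insert z Z). t ^ card W) =
    (\<Sum>W\<in>Pow Z. t ^ card W) + (\<Sum>W\<in>Set.insert z ` Pow Z. t ^ card W)"
    unfolding Pow_insert using insert(1,2) by (intro sum.union_disjoint) auto
  also have "(\<Sum>W\<in>Set.insert z ` Pow Z. t ^ card W) = (\<Sum>W\<in>Pow Z. t ^ card (Set.insert z W))"
    using inj by (simp add: sum.reindex)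
  also have "\<dots> = (\<Sum>W\<in>Pow Z. t * t ^ card W)"
  proof (rule sum.cong[OF refl])
    fix W assume "W \<in> Pow Z"
    then have "finite W" "z \<notin> W" using insert(1,2) by (auto intro: finite_subset)
    then show "t ^ card (Set.insert z W) = t * t ^ card W" by simp
  qed
  finally show ?case
    using insert by (simp add: sum_distrib_left[symmetric] algebra_simps)
qed simp

text \<open>
  The subsets \<open>W\<close> of \<open>Z\<close> have total weight \<open>(1 + t) ^ card Z\<close> under \<open>t ^ card W\<close>. For small \<open>t\<close> this leaves
  room for fewer than \<open>\<rho> ^ card Z\<close> sets with less than \<open>c card Z\<close> elements.
\<close>

lemma large_family_has_large_member:
  fixes \<rho> :: real
  assumes "\<rho> > 1"
  shows "\<exists>c>0. \<forall>(Z :: 'z set) \<W>. finite Z \<longrightarrow> \<W> \<subseteq> Pow Z \<longrightarrow> real (card \<W>) \<ge> \<rho> ^ card Z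
           \<longrightarrow> (\<exists>W\<in>\<W>. real (card W) \<ge> c * real (card Z))"
proof -
  define t where "t = min (1/2) ((sqrt \<rho> - 1) / 2)"
  have sr: "sqrt \<rho> > 1" using assms by simp
  then have t: "0 < t" "t < 1" "1 + t < sqrt \<rho>" by (auto simp: t_def min_def field_simps)
  define c where "c = ln (sqrt \<rho>) / (- ln t)"
  have lnt: "ln t < 0" using t by simp
  have c: "c > 0" using sr lnt by (simp add: c_def divide_pos_neg)
  have tc: "t powr (- c) = sqrt \<rho>"
    using t lnt sr by (simp add: powr_def c_def field_simps)
  show ?thesis
  proof (intro exI[of _ c] conjI c allI impI)
    fix Z :: "'z set" and \<W>
    assume Z: "finite Z" and \<W>: "\<W> \<subseteq> Pow Z" and big: "real (card \<W>) \<ge> \<rho> ^ card Z"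
    show "\<exists>W\<in>\<W>. real (card W) \<ge> c * real (card Z)"
    proof (rule ccontr)
      assume "\<not> ?thesis"
      then have small: "real (card W) < c * real (card Z)" if "W \<in> \<W>" for W
        using that by (auto simp: not_le)
      have "\<rho> ^ card Z > 0" using assms by simp
      then have "\<W> \<noteq> {}" using big by auto
      then obtain W0 where W0: "W0 \<in> \<W>" by blast
      from small[OF W0] have n: "card Z > 0"
        using c by (cases "card Z = 0") auto
      have finW: "finite \<W>" using Z \<W> by (auto intro: finite_subset)
      have "t powr (c * card Z) * real (card \<W>) = (\<Sum>W\<in>\<W>. t powr (c * card Z))" by simp
      also have "\<dots> \<le> (\<Sum>W\<in>\<W>. t ^ card W)"
      proof (rule sum_mono)
        fix W assume "W \<in> \<W>"
        from small[OF this] have "t powr (c * card Z) \<le> t powr real (card W)"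
          using t by (intro powr_mono') auto
        then show "t powr (c * card Z) \<le> t ^ card W" using t by (simp add: powr_realpow)
      qed
      also have "\<dots> \<le> (\<Sum>W\<in>Pow Z. t ^ card W)"
        using Z \<W> t by (intro sum_mono2) auto
      also have "\<dots> = (1 + t) ^ card Z" by (rule sum_power_card_Pow[OF Z])
      also have "\<dots> < sqrt \<rho> ^ card Z"
        using t n by (intro power_strict_mono) auto
      finally have 1: "t powr (c * card Z) * real (card \<W>) < sqrt \<rho> ^ card Z" .
      have "t powr (c * card Z) * sqrt \<rho> ^ card Z = 1"
      proof -
        have "sqrt \<rho> ^ card Z = (t powr (- c)) powr card Z"
          using t by (simp add: tc[symmetric] powr_realpow)
        also have "\<dots> = t powr (- (c * card Z))" by (simp add: powr_powr)
        finally show ?thesis using t by (simp add: powr_add[symmetric])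
      qed
      then have "real (card \<W>) = (t powr (c * card Z) * real (card \<W>)) * sqrt \<rho> ^ card Z"
        by (simp add: mult.commute mult.left_commute)
      also have "\<dots> < sqrt \<rho> ^ card Z * sqrt \<rho> ^ card Z"
        using 1 sr by (intro mult_strict_right_mono) auto
      also have "\<dots> = \<rho> ^ card Z"
        using assms by (simp add: power_mult_distrib[symmetric])
      finally show False using big by simp
    qed
  qed
qed

text \<open>
  The constants are chosen such that the counting bound grows like \<open>((1 - \<epsilon>) \<beta>) powr a\<close> to the power
  \<open>card Z\<close>, with base above 1.
\<close>

lemma large_cover_number_shatters:
  fixes \<beta> :: real
  assumes "k \<ge> 2" "\<beta> > 1"
  shows "\<exists>c>0. \<forall>(Z :: 'z set) S. finite Z \<longrightarrow> real (cover_number k Z S) \<ge> \<beta> ^ card Z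
           \<longrightarrow> (\<exists>W\<in>shattered k Z S. real (card W) \<ge> c * real (card Z))"
proof -
  define \<epsilon> where "\<epsilon> = (1 - 1 / \<beta>) / 2"
  have \<epsilon>: "0 < \<epsilon>" "\<epsilon> < 1" "(1 - \<epsilon>) * \<beta> > 1"
    using assms(2) by (auto simp: \<epsilon>_def field_simps)
  define r where "r = real k / real (k - 1)"
  have r: "r > 1" using assms(1) by (simp add: r_def field_simps)
  define a where "a = ln r / (- ln \<epsilon>)"
  have a: "a > 0" using r \<epsilon> by (simp add: a_def divide_pos_neg)
  have "\<epsilon> powr a = 1 / r"
    using \<epsilon> r by (simp add: powr_def a_def exp_minus inverse_eq_divide)
  then have ra: "real k / real (k - 1) * \<epsilon> powr a \<ge> 1"
    using r unfolding r_def[symmetric] by simp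
  define \<rho> where "\<rho> = ((1 - \<epsilon>) * \<beta>) powr a"
  have "\<rho> > 1" using \<epsilon>(3) a unfolding \<rho>_def by simp
  from large_family_has_large_member[OF this] obtain c where c: "c > 0"
    and C: "\<And>(Z :: 'z set) \<W>. finite Z \<Longrightarrow> \<W> \<subseteq> Pow Z \<Longrightarrow> real (card \<W>) \<ge> \<rho> ^ card Z
           \<Longrightarrow> \<exists>W\<in>\<W>. real (card W) \<ge> c * real (card Z)"
    by metis
  show ?thesis
  proof (intro exI[of _ c] conjI c allI impI)
    fix Z :: "'z set" and S
    assume Z: "finite Z" and big: "real (cover_number k Z S) \<ge> \<beta> ^ card Z"
    have "\<rho> ^ card Z = (((1 - \<epsilon>) * \<beta>) ^ card Z) powr a"
      using \<epsilon> assms(2) by (simp add: \<rho>_def powr_realpow[symmetric] powr_powr mult.commute)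
    also have "\<dots> = ((1 - \<epsilon>) ^ card Z * \<beta> ^ card Z) powr a"
      by (simp add: power_mult_distrib)
    also have "\<dots> \<le> ((1 - \<epsilon>) ^ card Z * real (cover_number k Z S)) powr a"
      using \<epsilon> a big assms(2) by (intro powr_mono2 mult_left_mono) auto
    also have "\<dots> \<le> card (shattered k Z S)"
      by (rule card_shattered_ge[OF Z assms(1) \<epsilon>(1,2) a ra])
    finally show "\<exists>W\<in>shattered k Z S. real (card W) \<ge> c * real (card Z)"
      using Z by (intro C) (auto simp: shattered_def)
  qed
qed

section \<open>Families of independent sets\<close>

text \<open>
  The combinatorial core of independence relative to \<open>D\<close>, with \<open>E z i\<close> in the role of the preimage
  \<open>\<phi> z -` A i\<close>; the sets may overlap and no group is involved.
\<close>

definition independent_over :: "nat \<Rightarrow> ('z \<Rightarrow> nat \<Rightarrow> 'p set) \<Rightarrow> 'p set \<Rightarrow> 'z set \<Rightarrow> bool" where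
  "independent_over k E D W \<longleftrightarrow> (\<forall>\<sigma>\<in>W \<rightarrow> {1..k}. \<exists>p\<in>D. \<forall>z\<in>W. p \<in> E z (\<sigma> z))"

lemma independent_over_shattered:
  assumes "W \<in> shattered k Z S"
    and "\<And>y. y \<in> S \<Longrightarrow> \<exists>p\<in>D. \<forall>z\<in>Z. y z \<in> {1..k} \<longrightarrow> p \<in> E z (y z)"
  shows "independent_over k E D W"
  unfolding independent_over_def
proof
  fix \<sigma> assume \<sigma>: "\<sigma> \<in> W \<rightarrow> {1..k}"
  then obtain y where y: "y \<in> S" "\<forall>w\<in>W. y w = \<sigma> w" and WZ: "W \<subseteq> Z"
    using assms(1) by (auto simp: shattered_def)
  from assms(2)[OF y(1)] obtain p where p: "p \<in> D" "\<forall>z\<in>Z. y z \<in> {1..k} \<longrightarrow> p \<in> E z (y z)" by blast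
  have "p \<in> E z (\<sigma> z)" if "z \<in> W" for z
    using p(2) y(2) WZ \<sigma> that by (metis PiE funcset_mem subsetD)
  then show "\<exists>p\<in>D. \<forall>z\<in>W. p \<in> E z (\<sigma> z)" using p(1) by blast
qed

text \<open>
  A box contains only \<open>(k - 1) ^ card Z\<close> patterns with values in \<open>{1..k}\<close>.
\<close>

lemma card_le_cover_number:
  assumes "finite Z" "k \<ge> 2" "R \<subseteq> Z \<rightarrow>\<^sub>E {1..k}"
  shows "card R \<le> cover_number k Z R * (k - 1) ^ card Z"
proof -
  obtain V where V: "cover_by k Z R V" "card V = cover_number k Z R"
    by (rule cover_number_attained[OF assms(1,2)])
  have "R \<subseteq> (\<Union>\<iota>\<in>V. PiE Z (\<lambda>z. {1..k} - {\<iota> z}))"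
  proof
    fix y assume y: "y \<in> R"
    then obtain \<iota> where \<iota>: "\<iota> \<in> V" "\<forall>z\<in>Z. y z \<noteq> \<iota> z" using V(1) by (auto simp: cover_by_def)
    have "y \<in> PiE Z (\<lambda>z. {1..k} - {\<iota> z})"
      using subsetD[OF assms(3) y] \<iota>(2) by (simp add: PiE_iff)
    then show "y \<in> (\<Union>\<iota>\<in>V. PiE Z (\<lambda>z. {1..k} - {\<iota> z}))"
      using \<iota>(1) by (rule UN_I[rotated])
  qed
  moreover have finV: "finite V" using V(1) by (simp add: cover_by_def)
  ultimately have "card R \<le> card (\<Union>\<iota>\<in>V. PiE Z (\<lambda>z. {1..k} - {\<iota> z}))"
    using assms(1) by (intro card_mono finite_UN_I finite_PiE) simp_all
  also have "\<dots> \<le> (\<Sum>\<iota>\<in>V. card (PiE Z (\<lambda>z. {1..k} - {\<iota> z})))"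
    by (rule card_UN_le[OF finV])
  also have "\<dots> = (\<Sum>\<iota>\<in>V. (k - 1) ^ card Z)"
  proof (rule sum.cong[OF refl])
    fix \<iota> assume "\<iota> \<in> V"
    then have "\<iota> z \<in> {1..k}" for z using V(1) by (auto simp: cover_by_def)
    then have "card ({1..k} - {\<iota> z}) = k - 1" for z by simp
    then show "card (PiE Z (\<lambda>z. {1..k} - {\<iota> z})) = (k - 1) ^ card Z"
      using assms(1) by (simp add: card_PiE)
  qed
  finally show ?thesis using V(2) by simp
qed

text \<open>
  A proportion \<open>\<theta>\<close> of all patterns has cover number at least \<open>\<theta> (k / (k - 1)) ^ card Z\<close>. The choice
  \<open>\<theta> = sqrt ((k - 1) / k)\<close> makes this exponentially large for every nonempty \<open>Z\<close>. For \<open>k = 1\<close> there is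
  only one pattern, which no box contains, so this case is treated directly.
\<close>

lemma dense_patterns_independent:
  assumes "k \<ge> 1"
  shows "\<exists>\<theta>::real. \<exists>c>0. 0 < \<theta> \<and> \<theta> < 1 \<and> (\<forall>(Z :: 'z set) (D :: 'p set) E. finite Z \<longrightarrow>
     real (card {\<sigma>\<in>Z \<rightarrow>\<^sub>E {1..k}. \<exists>p\<in>D. \<forall>z\<in>Z. p \<in> E z (\<sigma> z)}) \<ge> \<theta> * real k ^ card Z \<longrightarrow>
     (\<exists>W\<subseteq>Z. real (card W) \<ge> c * real (card Z) \<and> independent_over k E D W))"
proof (cases "k = 1")
  case True
  have "\<exists>W\<subseteq>Z. real (card W) \<ge> 1 * real (card Z) \<and> independent_over k E D W"
    if Z: "finite Z" "real (card {\<sigma>\<in>Z \<rightarrow>\<^sub>E {1..k}. \<exists>p\<in>D. \<forall>z\<in>Z. p \<in> E z (\<sigma> z)}) \<ge> 1/2 * real k ^ card Z"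
    for Z :: "'z set" and D :: "'p set" and E
  proof -
    have "real (card {\<sigma>\<in>Z \<rightarrow>\<^sub>E {1..k}. \<exists>p\<in>D. \<forall>z\<in>Z. p \<in> E z (\<sigma> z)}) > 0"
      using Z(2) unfolding True by simp
    then have "{\<sigma>\<in>Z \<rightarrow>\<^sub>E {1..k}. \<exists>p\<in>D. \<forall>z\<in>Z. p \<in> E z (\<sigma> z)} \<noteq> {}"
      by (simp only: of_nat_0_less_iff card_gt_0_iff simp_thms)
    then obtain \<sigma> p where \<sigma>: "\<sigma> \<in> Z \<rightarrow>\<^sub>E {1..k}" "p \<in> D" "\<forall>z\<in>Z. p \<in> E z (\<sigma> z)" by auto
    have one: "\<tau> z = 1" if "\<tau> \<in> Z \<rightarrow> {1..k}" "z \<in> Z" for \<tau> z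
      using funcset_mem[OF that] True by simp
    have \<sigma>': "\<sigma> \<in> Z \<rightarrow> {1..k}" using \<sigma>(1) by (simp add: PiE_def)
    have "p \<in> E z (\<tau> z)" if "\<tau> \<in> Z \<rightarrow> {1..k}" "z \<in> Z" for \<tau> z
      using \<sigma>(3) one[OF that] one[OF \<sigma>' that(2)] that(2) by metis
    then have "independent_over k E D Z"
      unfolding independent_over_def using \<sigma>(2) by blast
    then show ?thesis by auto
  qed
  then show ?thesis by (intro exI[of _ "1/2"] exI[of _ 1]) auto
next
  case False
  then have k: "k \<ge> 2" using assms by simp
  define r where "r = real k / real (k - 1)"
  have r: "r > 1" using k by (simp add: r_def field_simps)
  then have "sqrt r > 1" by simp
  from large_cover_number_shatters[OF k this] obtain c where c: "c > 0"
    and C: "\<And>(Z :: 'z set) S. finite Z \<Longrightarrow> real (cover_number k Z S) \<ge> sqrt r ^ card Z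
           \<Longrightarrow> \<exists>W\<in>shattered k Z S. real (card W) \<ge> c * real (card Z)"
    by metis
  define \<theta> where "\<theta> = 1 / sqrt r"
  have \<theta>: "0 < \<theta>" "\<theta> < 1" using r by (auto simp: \<theta>_def)
  have "\<exists>W\<subseteq>Z. real (card W) \<ge> c * real (card Z) \<and> independent_over k E D W"
    if Z: "finite Z" "real (card {\<sigma>\<in>Z \<rightarrow>\<^sub>E {1..k}. \<exists>p\<in>D. \<forall>z\<in>Z. p \<in> E z (\<sigma> z)}) \<ge> \<theta> * real k ^ card Z"
    for Z :: "'z set" and D :: "'p set" and E
  proof -
    let ?R = "{\<sigma>\<in>Z \<rightarrow>\<^sub>E {1..k}. \<exists>p\<in>D. \<forall>z\<in>Z. p \<in> E z (\<sigma> z)}"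
    have "\<exists>W\<in>shattered k Z ?R. real (card W) \<ge> c * real (card Z)"
    proof (cases "Z = {}")
      case True
      have "real (card ?R) > 0" using Z(2) \<theta> unfolding True by simp
      then have "?R \<noteq> {}" by (simp only: of_nat_0_less_iff card_gt_0_iff simp_thms)
      then show ?thesis using True by (intro bexI[of _ "{}"]) (auto simp: shattered_def)
    next
      case False
      then have n: "card Z \<ge> 1" using Z(1) by (simp add: Suc_leI card_gt_0_iff)
      have "card ?R \<le> cover_number k Z ?R * (k - 1) ^ card Z"
        by (rule card_le_cover_number[OF Z(1) k]) blast
      then have "\<theta> * real k ^ card Z \<le> real (cover_number k Z ?R * (k - 1) ^ card Z)"
        using Z(2) by (meson of_nat_mono order_trans)
      then have "\<theta> * r ^ card Z \<le> real (cover_number k Z ?R)"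
        using k by (simp add: r_def power_divide field_simps)
      moreover have "\<theta> * r ^ card Z \<ge> sqrt r ^ card Z"
      proof -
        have "r ^ card Z = sqrt r ^ card Z * sqrt r ^ card Z"
          using r by (simp add: power_mult_distrib[symmetric])
        moreover have "sqrt r ^ 1 \<le> sqrt r ^ card Z"
          using n r by (intro power_increasing) auto
        ultimately show ?thesis using r by (simp add: \<theta>_def field_simps)
      qed
      ultimately show ?thesis by (intro C Z(1)) linarith
    qed
    then obtain W where W: "W \<in> shattered k Z ?R" "real (card W) \<ge> c * real (card Z)" by blast
    have "independent_over k E D W"
      by (rule independent_over_shattered[OF W(1)]) blast
    then show ?thesis using W by (auto simp: shattered_def)
  qed
  then show ?thesis using c \<theta> by blast
qed

text \<open>
  Choose for every pattern \<open>\<sigma>\<close> a point realising it. Wherever \<open>\<sigma>\<close> has the label \<open>j\<close>, this point lies in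
  \<open>B\<close> or in \<open>C\<close>. Let \<open>f B \<sigma>\<close> keep the label \<open>j\<close> only where the point lies in \<open>B\<close>, writing 0 elsewhere, and
  likewise \<open>f C \<sigma>\<close>. A box for \<open>f B \<sigma>\<close> and one for \<open>f C \<sigma>\<close> combine to a box for \<open>\<sigma>\<close>, so the product of the
  two cover numbers is at least that of the set of all patterns, and one factor is at least its square
  root. For \<open>k = 1\<close> one point realises everything, and the larger of its two parts will do.
\<close>

lemma split_independent:
  assumes "k \<ge> 1"
  shows "\<exists>c>0. \<forall>(Z :: 'z set) (D :: 'p set) E j B C. finite Z \<longrightarrow> j \<in> {1..k} \<longrightarrow>
     independent_over k E D Z \<longrightarrow> (\<forall>z\<in>Z. E z j \<subseteq> B z \<union> C z) \<longrightarrow>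
     (\<exists>W\<subseteq>Z. real (card W) \<ge> c * real (card Z) \<and>
        (independent_over k (\<lambda>z. (E z)(j := B z)) D W \<or> independent_over k (\<lambda>z. (E z)(j := C z)) D W))"
proof (cases "k = 1")
  case True
  have "\<exists>W\<subseteq>Z. real (card W) \<ge> 1/2 * real (card Z) \<and>
        (independent_over k (\<lambda>z. (E z)(j := B z)) D W \<or> independent_over k (\<lambda>z. (E z)(j := C z)) D W)"
    if Z: "finite Z" and j: "j \<in> {1..k}" and ind: "independent_over k E D Z"
      and sub: "\<forall>z\<in>Z. E z j \<subseteq> B z \<union> C z"
    for Z :: "'z set" and D :: "'p set" and E j B C
  proof -
    have j1: "j = 1" using True j by simp
    have "(\<lambda>_. 1) \<in> Z \<rightarrow> {1..k}" using True by auto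
    then obtain p where p: "p \<in> D" "\<forall>z\<in>Z. p \<in> E z 1"
      using ind unfolding independent_over_def by (metis (no_types))
    let ?W = "\<lambda>B. {z \<in> Z. p \<in> B z}"
    have ind': "independent_over k (\<lambda>z. (E z)(j := B z)) D (?W B)" for B
      unfolding independent_over_def
    proof
      fix \<sigma> assume \<sigma>: "\<sigma> \<in> ?W B \<rightarrow> {1..k}"
      have "p \<in> ((E z)(j := B z)) (\<sigma> z)" if "z \<in> ?W B" for z
        using funcset_mem[OF \<sigma> that] True j1 that by simp
      then show "\<exists>p\<in>D. \<forall>z\<in>?W B. p \<in> ((E z)(j := B z)) (\<sigma> z)" using p(1) by blast
    qed
    have "Z = ?W B \<union> ?W C" using p(2) sub j1 by blast
    then have "card Z \<le> card (?W B) + card (?W C)" using card_Un_le[of "?W B" "?W C"] by simp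
    then have "real (card Z) \<le> real (card (?W B)) + real (card (?W C))"
      by linarith
    then consider "real (card (?W B)) \<ge> 1/2 * real (card Z)" | "real (card (?W C)) \<ge> 1/2 * real (card Z)"
      by linarith
    then show ?thesis
    proof cases
      case 1 with ind'[of B] show ?thesis by (intro exI[of _ "?W B"]) auto
    next
      case 2 with ind'[of C] show ?thesis by (intro exI[of _ "?W C"]) auto
    qed
  qed
  then show ?thesis by (intro exI[of _ "1/2"]) auto
next
  case False
  then have k: "k \<ge> 2" using assms by simp
  define r where "r = real k / real (k - 1)"
  have r: "r > 1" using k by (simp add: r_def field_simps)
  then have "sqrt r > 1" by simp
  from large_cover_number_shatters[OF k this] obtain c where c: "c > 0"
    and L: "\<And>(Z :: 'z set) S. finite Z \<Longrightarrow> real (cover_number k Z S) \<ge> sqrt r ^ card Z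
           \<Longrightarrow> \<exists>W\<in>shattered k Z S. real (card W) \<ge> c * real (card Z)"
    by metis
  have "\<exists>W\<subseteq>Z. real (card W) \<ge> c * real (card Z) \<and>
        (independent_over k (\<lambda>z. (E z)(j := B z)) D W \<or> independent_over k (\<lambda>z. (E z)(j := C z)) D W)"
    if Z: "finite Z" and j: "j \<in> {1..k}" and ind: "independent_over k E D Z"
      and sub: "\<forall>z\<in>Z. E z j \<subseteq> B z \<union> C z"
    for Z :: "'z set" and D :: "'p set" and E j B C
  proof -
    let ?P = "Z \<rightarrow>\<^sub>E {1..k}"
    have "\<forall>\<sigma>\<in>?P. \<exists>p\<in>D. \<forall>z\<in>Z. p \<in> E z (\<sigma> z)"
      using ind unfolding independent_over_def by (auto simp: PiE_def)
    then obtain p where p: "\<And>\<sigma>. \<sigma> \<in> ?P \<Longrightarrow> p \<sigma> \<in> D" "\<And>\<sigma> z. \<sigma> \<in> ?P \<Longrightarrow> z \<in> Z \<Longrightarrow> p \<sigma> \<in> E z (\<sigma> z)"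
      by metis
    define f where "f B \<sigma> = (\<lambda>z. if \<sigma> z = j \<and> p \<sigma> \<notin> B z then 0 else \<sigma> z)" for B \<sigma>
    have indep: "independent_over k (\<lambda>z. (E z)(j := B z)) D W" if "W \<in> shattered k Z (f B ` ?P)" for B W
    proof (rule independent_over_shattered[OF that])
      fix y assume "y \<in> f B ` ?P"
      then obtain \<sigma> where \<sigma>: "\<sigma> \<in> ?P" "y = f B \<sigma>" by blast
      have "p \<sigma> \<in> ((E z)(j := B z)) (y z)" if "z \<in> Z" "y z \<in> {1..k}" for z
        using that p(2)[OF \<sigma>(1) that(1)] unfolding \<sigma>(2) f_def by (auto split: if_splits)
      then show "\<exists>q\<in>D. \<forall>z\<in>Z. y z \<in> {1..k} \<longrightarrow> q \<in> ((E z)(j := B z)) (y z)"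
        using p(1)[OF \<sigma>(1)] by blast
    qed
    obtain V1 where V1: "cover_by k Z (f B ` ?P) V1" "card V1 = cover_number k Z (f B ` ?P)"
      by (rule cover_number_attained[OF Z k])
    obtain V2 where V2: "cover_by k Z (f C ` ?P) V2" "card V2 = cover_number k Z (f C ` ?P)"
      by (rule cover_number_attained[OF Z k])
    \<comment> \<open>If \<open>\<iota>\<close> forbids a label other than \<open>j\<close>, then \<open>\<sigma>\<close> avoids it as well. If both \<open>\<iota>\<close> and \<open>\<kappa>\<close> forbid \<open>j\<close>,
      then the point of \<open>\<sigma>\<close> would lie neither in \<open>B\<close> nor in \<open>C\<close> if \<open>\<sigma>\<close> had the label \<open>j\<close>.\<close>
    define g where "g = (\<lambda>(\<iota>, \<kappa>) (z :: 'z). if \<iota> z = j then \<kappa> z else \<iota> z :: nat)"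
    have cov: "cover_by k Z ?P (g ` (V1 \<times> V2))"
      unfolding cover_by_def
    proof (intro conjI ballI allI)
      show "finite (g ` (V1 \<times> V2))" using V1(1) V2(1) by (simp add: cover_by_def)
    next
      fix \<theta> z assume "\<theta> \<in> g ` (V1 \<times> V2)"
      then show "\<theta> z \<in> {1..k}" using V1(1) V2(1) by (auto simp: cover_by_def g_def)
    next
      fix \<sigma> assume \<sigma>: "\<sigma> \<in> ?P"
      then obtain \<iota> \<kappa> where i: "\<iota> \<in> V1" "\<forall>z\<in>Z. f B \<sigma> z \<noteq> \<iota> z" and k: "\<kappa> \<in> V2" "\<forall>z\<in>Z. f C \<sigma> z \<noteq> \<kappa> z"
        using V1(1) V2(1) unfolding cover_by_def by (metis imageI)
      have "\<sigma> z \<noteq> g (\<iota>, \<kappa>) z" if z: "z \<in> Z" for z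
      proof -
        have "\<sigma> z = j \<Longrightarrow> p \<sigma> \<in> B z \<or> p \<sigma> \<in> C z"
          using p(2)[OF \<sigma> z] sub z by auto
        then show ?thesis
          using i(2)[rule_format, OF z] k(2)[rule_format, OF z] by (auto simp: f_def g_def split: if_splits)
      qed
      then show "\<exists>\<theta>\<in>g ` (V1 \<times> V2). \<forall>z\<in>Z. \<sigma> z \<noteq> \<theta> z"
        using i(1) k(1) by blast
    qed
    have "cover_number k Z ?P \<le> card (g ` (V1 \<times> V2))" by (rule cover_number_le[OF cov])
    also have "\<dots> \<le> card (V1 \<times> V2)"
      using V1(1) V2(1) by (intro card_image_le) (simp add: cover_by_def)
    also have "\<dots> = cover_number k Z (f B ` ?P) * cover_number k Z (f C ` ?P)"
      using V1(2) V2(2) by (simp add: card_cartesian_product)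
    finally have prod: "cover_number k Z ?P \<le> cover_number k Z (f B ` ?P) * cover_number k Z (f C ` ?P)" .
    have "card ?P \<le> cover_number k Z ?P * (k - 1) ^ card Z"
      by (rule card_le_cover_number[OF Z k]) simp
    then have "real k ^ card Z \<le> real (cover_number k Z ?P * (k - 1) ^ card Z)"
      using Z by (simp add: card_PiE flip: of_nat_power of_nat_mult)
    then have "r ^ card Z \<le> real (cover_number k Z ?P)"
      using k by (simp add: r_def power_divide field_simps)
    also have "\<dots> \<le> real (cover_number k Z (f B ` ?P)) * real (cover_number k Z (f C ` ?P))"
      using prod by (simp flip: of_nat_mult)
    finally have le: "sqrt r ^ card Z * sqrt r ^ card Z \<le>
      real (cover_number k Z (f B ` ?P)) * real (cover_number k Z (f C ` ?P))"
      using r by (simp add: power_mult_distrib[symmetric])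
    have "sqrt r ^ card Z \<le> real (cover_number k Z (f B ` ?P)) \<or> sqrt r ^ card Z \<le>
      real (cover_number k Z (f C ` ?P))"
    proof (rule ccontr)
      assume "\<not> ?thesis"
      then have "real (cover_number k Z (f B ` ?P)) * real (cover_number k Z (f C ` ?P)) < sqrt r ^ card
        Z * sqrt r ^ card Z"
        by (intro mult_strict_mono') auto
      with le show False by simp
    qed
    then show ?thesis
    proof
      assume "sqrt r ^ card Z \<le> real (cover_number k Z (f B ` ?P))"
      from L[OF Z this] indep[of _ B] show ?thesis by (auto simp: shattered_def)
    next
      assume "sqrt r ^ card Z \<le> real (cover_number k Z (f C ` ?P))"
      from L[OF Z this] indep[of _ C] show ?thesis by (auto simp: shattered_def)
    qed
  qed
  note main = this
  show ?thesis
    by (intro exI[of _ c] conjI c allI impI) (rule main; assumption)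
qed

section \<open>Positive density relative to a measure\<close>

lemma independence_set_iff_independent_over:
  assumes "finite J" "J \<noteq> {}" "k \<ge> 1" "J \<subseteq> carrier G"
  shows "independence_set G \<phi> k A D J \<longleftrightarrow> independent_over k (\<lambda>s i. \<phi> s -` A i) D J"
  unfolding independence_set_finite_iff[OF assms(1-3)] independent_over_def using assms(4) by simp

lemma upper_mu_density_pos_iff:
  "upper_mu_density G \<phi> \<mu> k A > 0 \<longleftrightarrow>
     (\<exists>\<delta>>0. inv_limsup G (\<lambda>F. real (mu_max_independence G \<phi> \<mu> k A \<delta> F)) > 0)"
  unfolding upper_mu_density_def by (auto simp: less_SUP_iff)

lemma borel_large_UNIV:
  assumes "regular_borel_prob \<mu>" "\<delta> \<ge> 0"
  shows "UNIV \<in> borel_large \<mu> \<delta>"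
proof -
  interpret prob_space \<mu> using assms(1) by (simp add: regular_borel_prob_def)
  have "space \<mu> = UNIV"
    using assms(1) sets_eq_imp_space_eq[of \<mu> borel] by (simp add: regular_borel_prob_def)
  then have "measure \<mu> UNIV = 1" using prob_space by simp
  then show ?thesis using assms(2) by (simp add: borel_large_def)
qed

lemma borel_large_Int:
  assumes "regular_borel_prob \<mu>" "D1 \<in> borel_large \<mu> \<delta>1" "D2 \<in> borel_large \<mu> \<delta>2"
  shows "D1 \<inter> D2 \<in> borel_large \<mu> (\<delta>1 + \<delta>2)"
proof -
  interpret prob_space \<mu> using assms(1) by (simp add: regular_borel_prob_def)
  have s: "sets \<mu> = sets borel" using assms(1) by (simp add: regular_borel_prob_def)
  have D: "D1 \<in> events" "D2 \<in> events" "measure \<mu> D1 \<ge> 1 - \<delta>1" "measure \<mu> D2 \<ge> 1 - \<delta>2"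
    using assms(2,3) s by (auto simp: borel_large_def)
  have "measure \<mu> (D1 \<union> D2) = measure \<mu> D1 + measure \<mu> D2 - measure \<mu> (D1 \<inter> D2)"
    using D by (intro measure_Un3) (auto simp: fmeasurable_eq_sets)
  then have "measure \<mu> (D1 \<inter> D2) \<ge> 1 - (\<delta>1 + \<delta>2)"
    using D(3,4) prob_le_1[of "D1 \<union> D2"] by linarith
  then show ?thesis using D(1,2) s by (auto simp: borel_large_def)
qed

lemma mu_max_independence_le:
  assumes "finite F" "D \<in> borel_large \<mu> \<delta>"
  shows "mu_max_independence G \<phi> \<mu> k A \<delta> F \<le> max_independence G \<phi> k A D F"
proof -
  have "borel_large \<mu> \<delta> \<noteq> {}" using assms(2) by blast
  from mu_max_independence_attained[OF assms(1) this, of G \<phi> k A] assms(2) show ?thesis by metis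
qed

lemma mu_max_independence_mono:
  assumes "regular_borel_prob \<mu>" "\<delta> \<ge> 0" "finite F" "\<And>i. i \<in> {1..k} \<Longrightarrow> A i \<subseteq> A' i"
  shows "mu_max_independence G \<phi> \<mu> k A \<delta> F \<le> mu_max_independence G \<phi> \<mu> k A' \<delta> F"
proof -
  have "borel_large \<mu> \<delta> \<noteq> {}" using borel_large_UNIV[OF assms(1,2)] by blast
  then obtain D where D: "D \<in> borel_large \<mu> \<delta>"
    "mu_max_independence G \<phi> \<mu> k A' \<delta> F = max_independence G \<phi> k A' D F"
    using mu_max_independence_attained[OF assms(3), of \<mu> \<delta> G \<phi> k A'] by metis
  have "mu_max_independence G \<phi> \<mu> k A \<delta> F \<le> max_independence G \<phi> k A D F"
    by (rule mu_max_independence_le[OF assms(3) D(1)])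
  also have "\<dots> \<le> max_independence G \<phi> k A' D F"
    by (rule max_independence_mono[OF assms(3) order_refl assms(4)])
  finally show ?thesis using D(2) by simp
qed

lemma inv_limsup_pos_mono:
  assumes "inv_limsup G f > 0" "\<And>F. finite F \<Longrightarrow> f F \<le> g F"
  shows "inv_limsup G g > 0"
proof -
  obtain \<epsilon> where \<epsilon>: "\<epsilon> > 0" "\<And>K \<delta>. (K, \<delta>) \<in> invariance_index G \<Longrightarrow>
        \<exists>F\<in>almost_invariant G K \<delta>. f F \<ge> \<epsilon> * real (card F)"
    using assms(1) unfolding inv_limsup_pos_iff by blast
  have "\<exists>F\<in>almost_invariant G K \<delta>. g F \<ge> \<epsilon> * real (card F)" if i: "(K, \<delta>) \<in> invariance_index G" for K \<delta>
  proof -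
    obtain F where F: "F \<in> almost_invariant G K \<delta>" "f F \<ge> \<epsilon> * real (card F)" using \<epsilon>(2)[OF i] by blast
    then have "f F \<le> g F" by (intro assms(2)) (simp add: almost_invariant_def)
    with F show ?thesis by (intro bexI[of _ F]) auto
  qed
  then show ?thesis unfolding inv_limsup_pos_iff using \<epsilon>(1) by blast
qed

lemma upper_mu_density_pos_mono:
  assumes "regular_borel_prob \<mu>" "\<And>i. i \<in> {1..k} \<Longrightarrow> A i \<subseteq> A' i"
    and "upper_mu_density G \<phi> \<mu> k A > 0"
  shows "upper_mu_density G \<phi> \<mu> k A' > 0"
proof -
  obtain \<delta> where \<delta>: "\<delta> > 0" "inv_limsup G (\<lambda>F. real (mu_max_independence G \<phi> \<mu> k A \<delta> F)) > 0"
    using assms(3) unfolding upper_mu_density_pos_iff by blast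
  have "mu_max_independence G \<phi> \<mu> k A \<delta> F \<le> mu_max_independence G \<phi> \<mu> k A' \<delta> F" if "finite F" for F
    using \<delta>(1) by (intro mu_max_independence_mono[OF assms(1) _ that assms(2)]) simp
  then have "inv_limsup G (\<lambda>F. real (mu_max_independence G \<phi> \<mu> k A' \<delta> F)) > 0"
    by (intro inv_limsup_pos_mono[OF \<delta>(2)]) simp
  then show ?thesis unfolding upper_mu_density_pos_iff using \<delta>(1) by blast
qed

lemma max_independence_pos_of_density:
  assumes "regular_borel_prob \<mu>" "upper_mu_density G \<phi> \<mu> k A > 0"
  shows "inv_limsup G (\<lambda>F. real (max_independence G \<phi> k A UNIV F)) > 0"
proof -
  obtain \<delta> where \<delta>: "\<delta> > 0" "inv_limsup G (\<lambda>F. real (mu_max_independence G \<phi> \<mu> k A \<delta> F)) > 0"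
    using assms(2) unfolding upper_mu_density_pos_iff by blast
  have "UNIV \<in> borel_large \<mu> \<delta>" using borel_large_UNIV[OF assms(1)] \<delta>(1) by simp
  then show ?thesis
    by (intro inv_limsup_pos_mono[OF \<delta>(2)] of_nat_mono mu_max_independence_le)
qed

text \<open>
  With an empty entry, no nonempty set is independent: label one of its elements by \<open>j\<close>.
\<close>

lemma upper_mu_density_empty:
  assumes "regular_borel_prob \<mu>" "j \<in> {1..k}" "A j = {}"
  shows "\<not> upper_mu_density G \<phi> \<mu> k A > 0"
proof
  assume "upper_mu_density G \<phi> \<mu> k A > 0"
  then have "inv_limsup G (\<lambda>F. real (max_independence G \<phi> k A UNIV F)) > 0"
    by (rule max_independence_pos_of_density[OF assms(1)])
  then obtain \<epsilon> where \<epsilon>: "\<epsilon> > 0" "\<And>K \<delta>. (K, \<delta>) \<in> invariance_index G \<Longrightarrow>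
        \<exists>F\<in>almost_invariant G K \<delta>. real (max_independence G \<phi> k A UNIV F) \<ge> \<epsilon> * real (card F)"
    unfolding inv_limsup_pos_iff by blast
  have "({}, 1) \<in> invariance_index G" by (simp add: invariance_index_def)
  from \<epsilon>(2)[OF this] obtain F where F: "F \<in> almost_invariant G {} 1"
    "real (max_independence G \<phi> k A UNIV F) \<ge> \<epsilon> * real (card F)" by blast
  then have fin: "finite F" "card F > 0" by (auto simp: almost_invariant_def card_gt_0_iff)
  obtain J where J: "J \<subseteq> F" "independence_set G \<phi> k A UNIV J" "card J = max_independence G \<phi> k A UNIV F"
    by (rule max_independence_attained[OF fin(1)])
  have "real (card J) > 0" using F(2) J(3) \<epsilon>(1) fin(2) by (smt (verit) mult_pos_pos of_nat_0_less_iff)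
  then have "J \<noteq> {}" "finite J" by (simp_all add: card_gt_0_iff)
  then obtain s where s: "s \<in> J" by blast
  have "UNIV \<inter> (\<Inter>t\<in>{s}. \<phi> t -` A ((\<lambda>_. j) t)) \<noteq> {}"
    by (rule J(2)[unfolded independence_set_def, THEN conjunct2, rule_format, of "{s}" "\<lambda>_. j"])
      (use s assms(2) in auto)
  then show False using assms(3) by simp
qed

text \<open>
  Suppose that neither part is \<open>\<mu>\<close>-dense. Then at one and the same almost invariant \<open>F\<close> there are sets
  \<open>D1\<close> and \<open>D2\<close> of measure at least \<open>1 - \<delta> / 2\<close> relative to which the two parts have only small
  independence sets. Relative to \<open>D1 \<inter> D2\<close> the whole tuple still has a large one, and splitting it
  contradicts the choice of \<open>D1\<close> or of \<open>D2\<close>.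
\<close>

lemma upper_mu_density_split:
  fixes G :: "('g, 'm) monoid_scheme" and \<phi> :: "'g \<Rightarrow> 'x::topological_space \<Rightarrow> 'x"
  assumes reg: "regular_borel_prob \<mu>" and k: "k \<ge> 1" and j: "j \<in> {1..k}"
    and sub: "A j \<subseteq> B \<union> C" and pos: "upper_mu_density G \<phi> \<mu> k A > 0"
  shows "upper_mu_density G \<phi> \<mu> k (A(j := B)) > 0 \<or> upper_mu_density G \<phi> \<mu> k (A(j := C)) > 0"
proof (rule ccontr)
  assume neg: "\<not> ?thesis"
  obtain \<delta> where \<delta>: "\<delta> > 0" "inv_limsup G (\<lambda>F. real (mu_max_independence G \<phi> \<mu> k A \<delta> F)) > 0"
    using pos unfolding upper_mu_density_pos_iff by blast
  obtain \<epsilon> where \<epsilon>: "\<epsilon> > 0" "\<And>K \<eta>. (K, \<eta>) \<in> invariance_index G \<Longrightarrow>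
        \<exists>F\<in>almost_invariant G K \<eta>. real (mu_max_independence G \<phi> \<mu> k A \<delta> F) \<ge> \<epsilon> * real (card F)"
    using \<delta>(2) unfolding inv_limsup_pos_iff by blast
  obtain c where c: "c > 0" and split: "\<forall>(Z :: 'g set) (D :: 'x set) E j B C. finite Z \<longrightarrow> j \<in> {1..k} \<longrightarrow>
     independent_over k E D Z \<longrightarrow> (\<forall>z\<in>Z. E z j \<subseteq> B z \<union> C z) \<longrightarrow>
     (\<exists>W\<subseteq>Z. real (card W) \<ge> c * real (card Z) \<and>
        (independent_over k (\<lambda>z. (E z)(j := B z)) D W \<or> independent_over k (\<lambda>z. (E z)(j := C z)) D W))"
    using split_independent[OF k, where 'z = 'g and 'p = 'x] by (elim exE conjE)
  have d2: "\<delta> / 2 > 0" using \<delta>(1) by simp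
  have small: "\<exists>K \<eta>. (K, \<eta>) \<in> invariance_index G \<and> (\<forall>F\<in>almost_invariant G K \<eta>.
      real (mu_max_independence G \<phi> \<mu> k A' (\<delta>/2) F) < c * \<epsilon> * real (card F))"
    if "\<not> upper_mu_density G \<phi> \<mu> k A' > 0" for A'
  proof -
    have "\<not> inv_limsup G (\<lambda>F. real (mu_max_independence G \<phi> \<mu> k A' (\<delta>/2) F)) > 0"
      using that d2 unfolding upper_mu_density_pos_iff by blast
    moreover have "c * \<epsilon> > 0" using c \<epsilon>(1) by simp
    ultimately show ?thesis unfolding inv_limsup_pos_iff by (meson not_le)
  qed
  obtain K1 \<eta>1 where 1: "(K1, \<eta>1) \<in> invariance_index G" "\<And>F. F \<in> almost_invariant G K1 \<eta>1 \<Longrightarrow>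
      real (mu_max_independence G \<phi> \<mu> k (A(j := B)) (\<delta>/2) F) < c * \<epsilon> * real (card F)"
    using small[of "A(j := B)"] neg by blast
  obtain K2 \<eta>2 where 2: "(K2, \<eta>2) \<in> invariance_index G" "\<And>F. F \<in> almost_invariant G K2 \<eta>2 \<Longrightarrow>
      real (mu_max_independence G \<phi> \<mu> k (A(j := C)) (\<delta>/2) F) < c * \<epsilon> * real (card F)"
    using small[of "A(j := C)"] neg by blast
  have "(K1 \<union> K2, min \<eta>1 \<eta>2) \<in> invariance_index G" using 1(1) 2(1) by (auto simp: invariance_index_def)
  from \<epsilon>(2)[OF this] obtain F where F: "F \<in> almost_invariant G (K1 \<union> K2) (min \<eta>1 \<eta>2)"
    "real (mu_max_independence G \<phi> \<mu> k A \<delta> F) \<ge> \<epsilon> * real (card F)" by blast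
  have F1: "F \<in> almost_invariant G K1 \<eta>1" and F2: "F \<in> almost_invariant G K2 \<eta>2"
    using F(1) almost_invariant_antimono[of K1 "K1 \<union> K2" "min \<eta>1 \<eta>2" \<eta>1 G]
      almost_invariant_antimono[of K2 "K1 \<union> K2" "min \<eta>1 \<eta>2" \<eta>2 G] by auto
  have finF: "finite F" "F \<subseteq> carrier G" "card F > 0"
    using F(1) by (auto simp: almost_invariant_def card_gt_0_iff)
  have ne: "borel_large \<mu> (\<delta>/2) \<noteq> {}" using borel_large_UNIV[OF reg, of "\<delta>/2"] d2 by auto
  obtain D1 where D1: "D1 \<in> borel_large \<mu> (\<delta>/2)"
    "mu_max_independence G \<phi> \<mu> k (A(j := B)) (\<delta>/2) F = max_independence G \<phi> k (A(j := B)) D1 F"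
    by (rule mu_max_independence_attained[OF finF(1) ne])
  obtain D2 where D2: "D2 \<in> borel_large \<mu> (\<delta>/2)"
    "mu_max_independence G \<phi> \<mu> k (A(j := C)) (\<delta>/2) F = max_independence G \<phi> k (A(j := C)) D2 F"
    by (rule mu_max_independence_attained[OF finF(1) ne])
  let ?D = "D1 \<inter> D2"
  have D: "?D \<in> borel_large \<mu> \<delta>" using borel_large_Int[OF reg D1(1) D2(1)] by simp
  obtain J where J: "J \<subseteq> F" "independence_set G \<phi> k A ?D J" "card J = max_independence G \<phi> k A ?D F"
    by (rule max_independence_attained[OF finF(1)])
  have cardJ: "real (card J) \<ge> \<epsilon> * real (card F)"
    using F(2) mu_max_independence_le[OF finF(1) D, of G \<phi> k A] J(3) by linarith
  moreover have "\<epsilon> * real (card F) > 0" using \<epsilon>(1) finF(3) by simp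
  ultimately have Jpos: "card J > 0" by linarith
  then have Jne: "finite J" "J \<noteq> {}" by (auto simp: card_gt_0_iff)
  have Jc: "J \<subseteq> carrier G" using J(1) finF(2) by blast
  let ?E = "\<lambda>A s i. \<phi> s -` A i"
  have "independent_over k (?E A) ?D J"
    by (rule iffD1[OF independence_set_iff_independent_over[OF Jne k Jc] J(2)])
  moreover have "\<forall>s\<in>J. ?E A s j \<subseteq> \<phi> s -` B \<union> \<phi> s -` C" using sub by auto
  ultimately obtain W where W: "W \<subseteq> J" "real (card W) \<ge> c * real (card J)"
    "independent_over k (\<lambda>s. (?E A s)(j := \<phi> s -` B)) ?D W \<or> independent_over k
      (\<lambda>s. (?E A s)(j := \<phi> s -` C)) ?D W"
    using split[rule_format, OF Jne(1) j, of "?E A" ?D "\<lambda>s. \<phi> s -` B" "\<lambda>s. \<phi> s -` C"] by blast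
  have upd: "(\<lambda>s. (?E A s)(j := \<phi> s -` B)) = ?E (A(j := B))" for B by (auto simp: fun_eq_iff)
  have "c * real (card J) \<ge> c * (\<epsilon> * real (card F))" using cardJ c by (intro mult_left_mono) auto
  then have cardW: "real (card W) \<ge> c * \<epsilon> * real (card F)" using W(2) by (simp add: mult.assoc)
  moreover have "c * \<epsilon> * real (card F) > 0" using c \<epsilon>(1) finF(3) by simp
  ultimately have "card W > 0" by linarith
  then have Wne: "finite W" "W \<noteq> {}" by (auto simp: card_gt_0_iff)
  have Wc: "W \<subseteq> carrier G" "W \<subseteq> F" using W(1) Jc J(1) by auto
  have ind: "real (card W) \<le> max_independence G \<phi> k A' D' F" if "independent_over k (?E A') ?D W"
    "?D \<subseteq> D'" for A' D'
  proof -
    have "independence_set G \<phi> k A' ?D W"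
      by (rule iffD2[OF independence_set_iff_independent_over[OF Wne k Wc(1)] that(1)])
    then have "independence_set G \<phi> k A' D' W"
      by (rule independence_set_mono) (use that(2) in auto)
    from card_le_max_independence[OF finF(1) this Wc(2)] show ?thesis by simp
  qed
  from W(3) show False unfolding upd
  proof
    assume "independent_over k (?E (A(j := B))) ?D W"
    from ind[OF this Int_lower1] 1(2)[OF F1] D1(2) cardW show False by linarith
  next
    assume "independent_over k (?E (A(j := C))) ?D W"
    from ind[OF this Int_lower2] 2(2)[OF F2] D2(2) cardW show False by linarith
  qed
qed

text \<open>
  Otherwise finitely many open sets without the property cover the space.
\<close>

lemma cluster_point_of_splitting:
  fixes Q :: "'x::topological_space set \<Rightarrow> bool"
  assumes cp: "compact (UNIV :: 'x set)" and Q: "Q UNIV" "\<not> Q {}"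
    and split: "\<And>B C. Q (B \<union> C) \<Longrightarrow> Q B \<or> Q C"
  shows "\<exists>y. \<forall>W. open W \<longrightarrow> y \<in> W \<longrightarrow> Q W"
proof (rule ccontr)
  assume "\<not> ?thesis"
  then have "\<forall>y. \<exists>W. open W \<and> y \<in> W \<and> \<not> Q W" by simp
  from choice[OF this] obtain W where "\<forall>y. open (W y) \<and> y \<in> W y \<and> \<not> Q (W y)"
    by (elim exE)
  then have W: "\<And>y. open (W y)" "\<And>y. y \<in> W y" "\<And>y. \<not> Q (W y)" by simp_all
  have "UNIV \<subseteq> (\<Union>y\<in>UNIV. W y)" using W(2) by blast
  then obtain Y where Y: "finite Y" "UNIV \<subseteq> (\<Union>y\<in>Y. W y)"
    using compactE_image[OF cp, of UNIV W] W(1) by metis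
  have "\<not> Q (\<Union>y\<in>Z. W y)" if "finite Z" for Z
    using that
  proof (induction Z rule: finite_induct)
    case (insert z Z)
    then show ?case using split[of "W z" "\<Union>y\<in>Z. W y"] W(3) by auto
  qed (simp add: Q(2))
  from this[OF Y(1)] have "\<not> Q (\<Union>y\<in>Y. W y)" .
  moreover have "(\<Union>y\<in>Y. W y) = UNIV" using Y(2) by blast
  ultimately show False using Q(1) by simp
qed

text \<open>
  The entries of \<open>x\<close> are found one after the other. When \<open>j\<close> entries are fixed, the property of \<open>B\<close> that
  all neighbourhoods of these entries together with \<open>B\<close> at place \<open>Suc j\<close> satisfy \<open>P\<close> is again partition
  regular: neighbourhoods that fail for \<open>B\<close> and for \<open>C\<close> can be intersected.
\<close>

lemma cluster_tuple_of_splitting: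
  fixes P :: "(nat \<Rightarrow> 'x::topological_space set) \<Rightarrow> bool"
  assumes cp: "compact (UNIV :: 'x set)" and PA: "P A"
    and mono: "\<And>U U'. P U \<Longrightarrow> (\<And>i. i \<in> {1..k} \<Longrightarrow> U i \<subseteq> U' i) \<Longrightarrow> P U'"
    and empty: "\<And>U j. j \<in> {1..k} \<Longrightarrow> U j = {} \<Longrightarrow> \<not> P U"
    and split: "\<And>U j B C. j \<in> {1..k} \<Longrightarrow> P U \<Longrightarrow> U j \<subseteq> B \<union> C \<Longrightarrow> P (U(j := B)) \<or> P (U(j := C))"
  shows "\<exists>x. \<forall>U. (\<forall>i\<in>{1..k}. x i \<in> interior (U i)) \<longrightarrow> P (\<lambda>i. U i \<inter> A i)"
proof -
  define T where "T j U = (\<lambda>i. if i \<le> j then U i \<inter> A i else A i)" for j :: nat and U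
  have "\<exists>x. \<forall>U. (\<forall>i\<in>{1..j}. x i \<in> interior (U i)) \<longrightarrow> P (T j U)" if "j \<le> k" for j
    using that
  proof (induction j)
    case 0
    have "P (T 0 U)" for U
      by (rule mono[OF PA]) (auto simp: T_def)
    then show ?case by blast
  next
    case (Suc j)
    then obtain x where x: "\<And>U. (\<forall>i\<in>{1..j}. x i \<in> interior (U i)) \<Longrightarrow> P (T j U)" by auto
    have Sj: "Suc j \<in> {1..k}" using Suc.prems by simp
    define N where "N U \<longleftrightarrow> (\<forall>i\<in>{1..j}. x i \<in> interior (U i))" for U
    define Q where "Q B \<longleftrightarrow> (\<forall>U. N U \<longrightarrow> P (T (Suc j) (U(Suc j := B))))" for B
    have "\<exists>y. \<forall>W. open W \<longrightarrow> y \<in> W \<longrightarrow> Q W"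
    proof (rule cluster_point_of_splitting[OF cp])
      show "Q UNIV"
        unfolding Q_def
      proof (intro allI impI)
        fix U assume "N U"
        then have "P (T j U)" unfolding N_def by (rule x)
        then show "P (T (Suc j) (U(Suc j := UNIV)))" by (rule mono) (auto simp: T_def)
      qed
      have "N (\<lambda>_. UNIV)" by (simp add: N_def)
      moreover have "\<not> P (T (Suc j) ((\<lambda>_. UNIV)(Suc j := {})))"
        by (rule empty[OF Sj]) (simp add: T_def)
      ultimately show "\<not> Q {}" unfolding Q_def by blast
    next
      fix B C assume BC: "Q (B \<union> C)"
      show "Q B \<or> Q C"
      proof (rule ccontr)
        assume "\<not> ?thesis"
        then obtain U1 U2 where U1: "N U1" "\<not> P (T (Suc j) (U1(Suc j := B)))"
          and U2: "N U2" "\<not> P (T (Suc j) (U2(Suc j := C)))" unfolding Q_def by blast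
        let ?U = "\<lambda>i. U1 i \<inter> U2 i"
        have "N ?U" using U1(1) U2(1) by (simp add: N_def)
        then have "P (T (Suc j) (?U(Suc j := B \<union> C)))" using BC unfolding Q_def by blast
        then have "P ((T (Suc j) (?U(Suc j := B \<union> C)))(Suc j := B \<inter> A (Suc j))) \<or>
            P ((T (Suc j) (?U(Suc j := B \<union> C)))(Suc j := C \<inter> A (Suc j)))"
          by (rule split[OF Sj]) (auto simp: T_def)
        then show False
        proof
          assume "P ((T (Suc j) (?U(Suc j := B \<union> C)))(Suc j := B \<inter> A (Suc j)))"
          then have "P (T (Suc j) (U1(Suc j := B)))" by (rule mono) (auto simp: T_def)
          with U1(2) show False ..
        next
          assume "P ((T (Suc j) (?U(Suc j := B \<union> C)))(Suc j := C \<inter> A (Suc j)))"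
          then have "P (T (Suc j) (U2(Suc j := C)))" by (rule mono) (auto simp: T_def)
          with U2(2) show False ..
        qed
      qed
    qed
    then obtain y where y: "\<And>W. open W \<Longrightarrow> y \<in> W \<Longrightarrow> Q W" by blast
    have "P (T (Suc j) U)" if U: "\<forall>i\<in>{1..Suc j}. (x(Suc j := y)) i \<in> interior (U i)" for U
    proof -
      have "y \<in> interior (U (Suc j))" using bspec[OF U, of "Suc j"] by simp
      then have "Q (interior (U (Suc j)))" by (intro y) auto
      moreover have "N U"
        unfolding N_def
      proof
        fix i assume "i \<in> {1..j}"
        then show "x i \<in> interior (U i)" using bspec[OF U, of i] by simp
      qed
      ultimately have "P (T (Suc j) (U(Suc j := interior (U (Suc j)))))" unfolding Q_def by blast
      then show ?thesis
        by (rule mono) (use interior_subset in \<open>auto simp: T_def\<close>)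
    qed
    then show ?case by blast
  qed
  from this[of k] obtain x where x: "\<And>U. (\<forall>i\<in>{1..k}. x i \<in> interior (U i)) \<Longrightarrow> P (T k U)" by auto
  have "P (\<lambda>i. U i \<inter> A i)" if "\<forall>i\<in>{1..k}. x i \<in> interior (U i)" for U
    using x[OF that] by (rule mono) (auto simp: T_def)
  then show ?thesis by blast
qed

lemma mu_IE_tuple_exists:
  fixes A :: "nat \<Rightarrow> 'x::topological_space set"
  assumes cp: "compact (UNIV :: 'x set)" and reg: "regular_borel_prob \<mu>" and k: "k \<ge> 1"
    and cl: "\<And>i. i \<in> {1..k} \<Longrightarrow> closed (A i)" and pos: "upper_mu_density G \<phi> \<mu> k A > 0"
  shows "\<exists>x\<in>mu_IE_tuples G \<phi> \<mu> k. \<forall>i\<in>{1..k}. x i \<in> A i"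
proof -
  let ?P = "\<lambda>U. upper_mu_density G \<phi> \<mu> k U > 0"
  have "\<exists>x. \<forall>U. (\<forall>i\<in>{1..k}. x i \<in> interior (U i)) \<longrightarrow> ?P (\<lambda>i. U i \<inter> A i)"
    using cp pos upper_mu_density_pos_mono[OF reg] upper_mu_density_empty[OF reg]
      upper_mu_density_split[OF reg k]
    by (rule cluster_tuple_of_splitting)
  then obtain x where x: "\<And>U. (\<forall>i\<in>{1..k}. x i \<in> interior (U i)) \<Longrightarrow> ?P (\<lambda>i. U i \<inter> A i)" by blast
  have xA: "x i \<in> A i" if i: "i \<in> {1..k}" for i
  proof (rule ccontr)
    assume n: "x i \<notin> A i"
    have "?P (\<lambda>l. ((\<lambda>_. UNIV)(i := - A i)) l \<inter> A l)"
      by (rule x) (use n cl[OF i] in \<open>auto simp: interior_open open_Compl\<close>)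
    moreover have "\<not> ?P (\<lambda>l. ((\<lambda>_. UNIV)(i := - A i)) l \<inter> A l)"
      by (rule upper_mu_density_empty[OF reg i]) simp
    ultimately show False by blast
  qed
  have "restrict x {1..k} \<in> mu_IE_tuples G \<phi> \<mu> k"
    unfolding mu_IE_tuples_def
  proof (intro CollectI conjI allI impI)
    fix U :: "nat \<Rightarrow> 'x set" assume "\<forall>i\<in>{1..k}. restrict x {1..k} i \<in> interior (U i)"
    then have "?P (\<lambda>i. U i \<inter> A i)" by (intro x) simp
    then show "?P U" by (rule upper_mu_density_pos_mono[OF reg, rotated]) auto
  qed simp
  then show ?thesis using xA by (intro bexI[of _ "restrict x {1..k}"]) auto
qed

section \<open>Regular measures from finitely additive ones\<close>

lemma normal_space_compact_t2:
  assumes "compact (UNIV :: 'x::t2_space set)"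
  shows "normal_space (euclidean :: 'x topology)"
proof (rule compact_Hausdorff_or_regular_imp_normal_space)
  show "compact_space (euclidean :: 'x topology)" by (simp add: compact_space_def assms)
  have "\<exists>U V. openin euclidean U \<and> openin euclidean V \<and> x \<in> U \<and> y \<in> V \<and> disjnt U V" if "x \<noteq> y" for x y :: 'x
    using hausdorff[OF that] by (auto simp: disjnt_def)
  then show "Hausdorff_space (euclidean :: 'x topology) \<or> regular_space (euclidean :: 'x topology)"
    unfolding Hausdorff_space_def by blast
qed

context
  fixes m :: "'x::t2_space set \<Rightarrow> real"
  assumes compact_UNIV: "compact (UNIV :: 'x set)"
    and m_nonneg: "\<And>A. 0 \<le> m A"
    and m_UNIV: "m UNIV = 1"
    and m_add: "\<And>A B. A \<inter> B = {} \<Longrightarrow> m (A \<union> B) = m A + m B"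
begin

lemma mean_mono: "A \<subseteq> B \<Longrightarrow> m A \<le> m B"
  using m_add[of A "B - A"] m_nonneg[of "B - A"] by (simp add: Un_absorb1)

lemma mean_subadd: "m (A \<union> B) \<le> m A + m B"
  using m_add[of A "B - A"] mean_mono[of "B - A" B] by simp

text \<open>
  On open sets, the mass that \<open>m\<close> keeps on closed subsets. In contrast to \<open>m\<close> it is countably
  subadditive, because closed subsets are compact.
\<close>

definition inner_open :: "'x set \<Rightarrow> ennreal" where
  "inner_open V = (SUP C\<in>{C. closed C \<and> C \<subseteq> V}. ennreal (m C))"

definition outer :: "'x set \<Rightarrow> ennreal" where
  "outer E = (INF V\<in>{V. open V \<and> E \<subseteq> V}. inner_open V)"

lemma inner_open_ge: "closed C \<Longrightarrow> C \<subseteq> V \<Longrightarrow> ennreal (m C) \<le> inner_open V"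
  unfolding inner_open_def by (rule SUP_upper) simp

lemma inner_open_mono: "V \<subseteq> W \<Longrightarrow> inner_open V \<le> inner_open W"
  unfolding inner_open_def by (rule SUP_subset_mono) auto

lemma inner_open_le: "inner_open V \<le> ennreal (m V)"
  unfolding inner_open_def by (rule SUP_least) (auto intro!: ennreal_leI mean_mono)

lemma inner_open_UNIV: "inner_open UNIV = 1"
proof (rule antisym)
  show "inner_open UNIV \<le> 1" using inner_open_le[of UNIV] by (simp add: m_UNIV)
  show "1 \<le> inner_open UNIV" using inner_open_ge[of UNIV UNIV] by (simp add: m_UNIV)
qed

lemma inner_open_le_1: "inner_open V \<le> 1"
  using inner_open_mono[of V UNIV] inner_open_UNIV by simp

lemma inner_open_empty: "inner_open {} = 0"
proof -
  have "m {} = 0" using m_add[of "{}" "{}"] by simp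
  then show ?thesis using inner_open_le[of "{}"] by simp
qed

lemma inner_open_approx:
  assumes "e > 0"
  obtains C where "closed C" "C \<subseteq> V" "inner_open V \<le> ennreal (m C) + ennreal e"
proof -
  have "inner_open V \<noteq> \<infinity>" using inner_open_le_1[of V] by (auto simp: top_unique)
  moreover have "{C. closed C \<and> C \<subseteq> V} \<noteq> {}" by blast
  ultimately have "\<exists>C\<in>{C. closed C \<and> C \<subseteq> V}. inner_open V < ennreal (m C) + ennreal e"
    using assms by (intro SUP_approx_ennreal inner_open_def)
  then obtain C where "C \<in> {C. closed C \<and> C \<subseteq> V}" "inner_open V < ennreal (m C) + ennreal e"
    by (elim bexE)
  then show ?thesis by (intro that[of C]) (auto intro: less_imp_le)
qed

text \<open>
  By normality the disjoint closed sets \<open>C - V1\<close> and \<open>C - V2\<close> have disjoint open neighbourhoods; remove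
  one of them from \<open>C\<close> in each case.
\<close>

lemma closed_split:
  assumes C: "closed (C :: 'x set)" "C \<subseteq> V1 \<union> V2" and V: "open V1" "open V2"
  obtains C1 C2 where "closed C1" "closed C2" "C1 \<subseteq> V1" "C2 \<subseteq> V2" "C = C1 \<union> C2"
proof -
  have norm: "normal_space (euclidean :: 'x topology)"
    by (rule normal_space_compact_t2[OF compact_UNIV])
  have "closedin euclidean (C - V1) \<and> closedin euclidean (C - V2) \<and> disjnt (C - V1) (C - V2)"
    using C V by (auto simp: disjnt_def)
  then obtain W1 W2 where W: "open W1" "open W2" "C - V1 \<subseteq> W1" "C - V2 \<subseteq> W2" "disjnt W1 W2"
    using norm unfolding normal_space_def by (metis open_openin)
  show ?thesis
    by (rule that[of "C - W1" "C - W2"]) (use C W in \<open>auto simp: disjnt_def\<close>)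
qed

lemma inner_open_Un:
  assumes "open V1" "open V2"
  shows "inner_open (V1 \<union> V2) \<le> inner_open V1 + inner_open V2"
  unfolding inner_open_def[of "V1 \<union> V2"]
proof (rule SUP_least)
  fix C assume "C \<in> {C. closed C \<and> C \<subseteq> V1 \<union> V2}"
  then obtain C1 C2 where C: "closed C1" "closed C2" "C1 \<subseteq> V1" "C2 \<subseteq> V2" "C = C1 \<union> C2"
    using closed_split[OF _ _ assms] by auto
  have "ennreal (m C) \<le> ennreal (m C1) + ennreal (m C2)"
    using mean_subadd[of C1 C2] m_nonneg C(5) by (simp flip: ennreal_plus add: ennreal_leI)
  also have "\<dots> \<le> inner_open V1 + inner_open V2"
    using C by (intro add_mono inner_open_ge)
  finally show "ennreal (m C) \<le> inner_open V1 + inner_open V2" .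
qed

lemma inner_open_finite_UN:
  assumes "finite I" "\<And>i. i \<in> I \<Longrightarrow> open (V i)"
  shows "inner_open (\<Union>i\<in>I. V i) \<le> (\<Sum>i\<in>I. inner_open (V i))"
  using assms
proof (induction I rule: finite_induct)
  case empty then show ?case by (simp add: inner_open_empty)
next
  case (insert i I)
  have "inner_open (V i \<union> \<Union>(V ` I)) \<le> inner_open (V i) + inner_open (\<Union>(V ` I))"
    using insert.prems by (intro inner_open_Un) auto
  also have "\<dots> \<le> inner_open (V i) + (\<Sum>i\<in>I. inner_open (V i))"
    using insert by (intro add_mono) auto
  finally show ?case using insert by simp
qed

text \<open>
  Closed subsets are compact, so a closed subset of the union lies in finitely many of the open sets.
\<close>

lemma inner_open_countable_UN:
  fixes V :: "nat \<Rightarrow> 'x set"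
  assumes "\<And>i. open (V i)"
  shows "inner_open (\<Union>i. V i) \<le> (\<Sum>i. inner_open (V i))"
  unfolding inner_open_def[of "\<Union>i. V i"]
proof (rule SUP_least)
  fix C assume C: "C \<in> {C. closed C \<and> C \<subseteq> (\<Union>i. V i)}"
  then have "compact C" using compact_UNIV closed_Int_compact
    by (metis inf_top.right_neutral mem_Collect_eq)
  then obtain I where I: "finite I" "C \<subseteq> (\<Union>i\<in>I. V i)"
    using C assms by (elim compactE_image[of C UNIV V]) auto
  have "ennreal (m C) \<le> inner_open (\<Union>i\<in>I. V i)" using C I by (intro inner_open_ge) auto
  also have "\<dots> \<le> (\<Sum>i\<in>I. inner_open (V i))" using I assms by (intro inner_open_finite_UN)
  also have "\<dots> \<le> (\<Sum>i. inner_open (V i))" using I by (intro sum_le_suminf) auto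
  finally show "ennreal (m C) \<le> (\<Sum>i. inner_open (V i))" .
qed

lemma outer_open: "open V \<Longrightarrow> outer V = inner_open V"
  unfolding outer_def by (intro antisym INF_lower INF_greatest) (auto intro: inner_open_mono)

lemma outer_mono: "A \<subseteq> B \<Longrightarrow> outer A \<le> outer B"
  unfolding outer_def by (rule INF_superset_mono) auto

lemma outer_le: "open V \<Longrightarrow> E \<subseteq> V \<Longrightarrow> outer E \<le> inner_open V"
  unfolding outer_def by (rule INF_lower) simp

lemma outer_le_1: "outer E \<le> 1"
  using outer_le[of UNIV E] inner_open_UNIV by simp

lemma outer_approx:
  assumes "e > 0"
  obtains V where "open V" "E \<subseteq> V" "inner_open V \<le> outer E + ennreal e"
proof -
  have "outer E \<noteq> \<infinity>" using outer_le_1[of E] by (auto simp: top_unique)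
  then have "\<exists>V\<in>{V. open V \<and> E \<subseteq> V}. inner_open V < outer E + ennreal e"
    using assms by (intro INF_approx_ennreal outer_def)
  then obtain V where "V \<in> {V. open V \<and> E \<subseteq> V}" "inner_open V < outer E + ennreal e"
    by (elim bexE)
  then show ?thesis by (intro that[of V]) (auto intro: less_imp_le)
qed

lemma outer_measure_space_outer: "outer_measure_space UNIV outer"
  unfolding outer_measure_space_def
proof (intro conjI)
  show "positive UNIV outer" using outer_open[of "{}"] by (simp add: positive_def inner_open_empty)
  show "increasing UNIV outer" by (simp add: increasing_def outer_mono)
  show "countably_subadditive UNIV outer"
    unfolding countably_subadditive_def
  proof (intro allI impI)
    fix A :: "nat \<Rightarrow> 'x set"
    show "outer (\<Union>i. A i) \<le> (\<Sum>i. outer (A i))"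
    proof (rule ennreal_le_epsilon)
      fix e :: real assume e: "e > 0"
      have "\<forall>i. \<exists>V. open V \<and> A i \<subseteq> V \<and> inner_open V \<le> outer (A i) + ennreal (e * (1/2) ^ Suc i)"
      proof
        fix i
        have "e * (1/2) ^ Suc i > 0" using e by simp
        then obtain V where "open V" "A i \<subseteq> V" "inner_open V \<le> outer (A i) + ennreal (e * (1/2) ^ Suc i)"
          by (rule outer_approx)
        then show "\<exists>V. open V \<and> A i \<subseteq> V \<and> inner_open V \<le> outer (A i) + ennreal (e * (1/2) ^ Suc i)"
          by (intro exI[of _ V] conjI)
      qed
      from choice[OF this] obtain V where
        "\<forall>i. open (V i) \<and> A i \<subseteq> V i \<and> inner_open (V i) \<le> outer (A i) + ennreal (e * (1/2) ^ Suc i)"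
        by (elim exE)
      then have V: "\<And>i. open (V i)" "\<And>i. A i \<subseteq> V i"
        "\<And>i. inner_open (V i) \<le> outer (A i) + ennreal (e * (1/2) ^ Suc i)" by simp_all
      have "outer (\<Union>i. A i) \<le> inner_open (\<Union>i. V i)"
        using V by (intro outer_le) auto
      also have "\<dots> \<le> (\<Sum>i. inner_open (V i))" by (rule inner_open_countable_UN[OF V(1)])
      also have "\<dots> \<le> (\<Sum>i. outer (A i) + ennreal (e * (1/2) ^ Suc i))"
        by (intro suminf_le V(3)) auto
      also have "\<dots> = (\<Sum>i. outer (A i)) + (\<Sum>i. ennreal (e * (1/2) ^ Suc i))"
        by (rule suminf_add[symmetric]) auto
      also have "(\<Sum>i. ennreal (e * (1/2) ^ Suc i)) = ennreal e"
        using sums_mult[OF power_half_series, of e] e by (intro suminf_ennreal_eq) auto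
      finally show "outer (\<Union>i. A i) \<le> (\<Sum>i. outer (A i)) + ennreal e" .
    qed
  qed
qed

text \<open>
  For open \<open>V\<close>, take an almost optimal closed \<open>C \<subseteq> V \<inter> U\<close> and then an almost optimal closed subset of
  \<open>V - C\<close>, which contains \<open>V - U\<close>. The two are disjoint, so their masses under \<open>m\<close> add up inside \<open>V\<close>.
\<close>

lemma outer_caratheodory:
  assumes U: "open U"
  shows "outer (E \<inter> U) + outer (E - U) \<le> outer E"
proof -
  have op: "outer (V \<inter> U) + outer (V - U) \<le> inner_open V" if V: "open V" for V
  proof (rule ennreal_le_epsilon)
    fix e :: real assume e: "e > 0"
    then have e2: "e / 2 > 0" by simp
    obtain C where C: "closed C" "C \<subseteq> V \<inter> U" "inner_open (V \<inter> U) \<le> ennreal (m C) + ennreal (e/2)"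
      by (rule inner_open_approx[OF e2])
    obtain C' where C': "closed C'" "C' \<subseteq> V - C" "inner_open (V - C) \<le> ennreal (m C') + ennreal (e/2)"
      by (rule inner_open_approx[OF e2])
    have "outer (V \<inter> U) \<le> inner_open (V \<inter> U)" using V U by (simp add: outer_open open_Int)
    moreover have "outer (V - U) \<le> inner_open (V - C)"
      using C V by (intro outer_le open_Diff) auto
    ultimately have "outer (V \<inter> U) + outer (V - U) \<le>
      (ennreal (m C) + ennreal (e/2)) + (ennreal (m C') + ennreal (e/2))"
      using C(3) C'(3) by (intro add_mono) (auto intro: order_trans)
    also have "\<dots> = ennreal (m C + m C') + ennreal e"
      using e m_nonneg by (simp flip: ennreal_plus add: add_ac)
    also have "m C + m C' = m (C \<union> C')" using C' by (intro m_add[symmetric]) auto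
    also have "ennreal (m (C \<union> C')) \<le> inner_open V"
      using C C' by (intro inner_open_ge) auto
    finally show "outer (V \<inter> U) + outer (V - U) \<le> inner_open V + ennreal e" by simp
  qed
  show ?thesis
    unfolding outer_def[of E]
  proof (rule INF_greatest)
    fix V assume "V \<in> {V. open V \<and> E \<subseteq> V}"
    then have "open V" "outer (E \<inter> U) \<le> outer (V \<inter> U)" "outer (E - U) \<le> outer (V - U)"
      by (auto intro!: outer_mono)
    then show "outer (E \<inter> U) + outer (E - U) \<le> inner_open V"
      using op[of V] by (meson add_mono order_trans)
  qed
qed

definition radon :: "'x measure" where
  "radon = measure_of UNIV (sets borel) outer"

lemma sets_radon: "sets radon = sets borel"
  unfolding radon_def using sets.sigma_sets_eq[of borel] by simp

lemma space_radon: "space radon = UNIV"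
  using sets_eq_imp_space_eq[OF sets_radon] by simp

lemma emeasure_radon:
  assumes "B \<in> sets borel"
  shows "emeasure radon B = outer B"
proof -
  interpret P: sigma_algebra UNIV "UNIV :: 'x set set"
    using sigma_algebra_Pow[of "UNIV :: 'x set"] by simp
  let ?L = "lambda_system UNIV UNIV outer"
  have ms: "measure_space UNIV ?L outer"
    by (rule P.caratheodory_lemma[OF outer_measure_space_outer])
  have "subadditive UNIV outer"
    using outer_measure_space_outer unfolding outer_measure_space_def
    by (intro P.countably_subadditive_subadditive) simp_all
  then have subadd: "outer (A \<union> B) \<le> outer A + outer B" if "A \<inter> B = {}" for A B
    using that by (simp add: subadditive_def)
  have "outer (E \<inter> V) + outer (E - V) = outer E" if V: "open V" for V E
  proof (rule antisym[OF outer_caratheodory[OF V]])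
    have "(E \<inter> V) \<union> (E - V) = E" by blast
    then show "outer E \<le> outer (E \<inter> V) + outer (E - V)"
      using subadd[of "E \<inter> V" "E - V"] by auto
  qed
  then have "V \<in> ?L" if "open V" for V
    using that unfolding P.lambda_system_eq by simp
  then have "Collect open \<subseteq> ?L" by blast
  moreover have "sigma_algebra UNIV ?L" using ms by (simp add: measure_space_def)
  ultimately have sub: "sets borel \<subseteq> ?L"
    unfolding borel_def by (simp add: sigma_algebra.sigma_sets_subset)
  have sa: "sigma_algebra UNIV (sets (borel :: 'x measure))"
    using sets.sigma_algebra_axioms[of "borel :: 'x measure"] by simp
  have "measure_space UNIV (sets borel) outer"
    using measure_down[OF ms sa sub] .
  then have "positive (sets borel) outer" "countably_additive (sets borel) outer"
    by (auto simp: measure_space_def)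
  then show ?thesis
    unfolding radon_def by (rule emeasure_measure_of_sigma[OF sa _ _ assms])
qed

lemma emeasure_radon_open_le: "open V \<Longrightarrow> emeasure radon V \<le> ennreal (m V)"
  using inner_open_le[of V] by (simp add: emeasure_radon outer_open)

lemma prob_space_radon: "prob_space radon"
  by (rule prob_spaceI) (simp add: space_radon emeasure_radon outer_open inner_open_UNIV)

text \<open>
  Outer regularity holds by construction. Applied to the complement of \<open>B\<close> it gives inner regularity,
  since complements of open sets are compact.
\<close>

lemma regular_borel_prob_radon: "regular_borel_prob radon"
  unfolding regular_borel_prob_def
proof (intro conjI ballI prob_space_radon sets_radon)
  interpret prob_space radon by (rule prob_space_radon)
  fix B :: "'x set" assume B: "B \<in> sets borel"
  have openU: "open U \<Longrightarrow> U \<in> sets radon" for U by (simp add: sets_radon)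
  show out: "emeasure radon B = (INF U\<in>{U. open U \<and> B \<subseteq> U}. emeasure radon U)"
    using B by (simp add: emeasure_radon outer_def[of B] outer_open)
  show "emeasure radon B = (SUP K\<in>{K. compact K \<and> K \<subseteq> B}. emeasure radon K)"
  proof (rule ennreal_approx_SUP)
    fix K assume "K \<in> {K. compact K \<and> K \<subseteq> B}"
    then show "emeasure radon K \<le> emeasure radon B"
      using B by (intro emeasure_mono) (auto simp: sets_radon)
  next
    fix e :: real assume e: "e > 0"
    have Bc: "- B \<in> sets borel" using B by (metis borel_comp)
    obtain V where V: "open V" "- B \<subseteq> V" "inner_open V \<le> outer (- B) + ennreal e"
      by (rule outer_approx[OF e])
    have K: "compact (- V)" "- V \<subseteq> B"
      using V compact_UNIV closed_Int_compact[of "- V" UNIV] by auto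
    have "emeasure radon V \<le> emeasure radon (- B) + ennreal e"
      using V Bc by (simp add: emeasure_radon outer_open)
    then have "measure radon V \<le> measure radon (- B) + e"
      using e by (simp add: emeasure_eq_measure flip: ennreal_plus)
    moreover have "measure radon (- B) = 1 - measure radon B"
      using prob_compl[of B] B by (simp add: sets_radon space_radon Compl_eq_Diff_UNIV)
    moreover have "measure radon (- V) = 1 - measure radon V"
      using prob_compl[of V] V by (simp add: sets_radon space_radon Compl_eq_Diff_UNIV)
    ultimately have "measure radon B \<le> measure radon (- V) + e" by simp
    then have "emeasure radon B \<le> emeasure radon (- V) + ennreal e"
      using e by (simp add: emeasure_eq_measure flip: ennreal_plus)
    then show "\<exists>K\<in>{K. compact K \<and> K \<subseteq> B}. emeasure radon B \<le> emeasure radon K + ennreal e"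
      using K by blast
  qed
qed

lemma distr_radon:
  assumes h: "homeomorphic_map euclidean euclidean h" and inv: "\<And>A. m (h -` A) = m A"
  shows "distr radon borel h = radon"
proof -
  have cont: "continuous_on UNIV h"
    using homeomorphic_imp_continuous_map[OF h] by simp
  have bij: "bij h"
    using homeomorphic_imp_injective_map[OF h] homeomorphic_imp_surjective_map[OF h] by (simp add: bij_def)
  have closed_im: "closed (h ` C)" if "closed C" for C
    using homeomorphic_imp_closed_map[OF h] that by (simp add: closed_map_def)
  have open_im: "open (h ` C)" if "open C" for C
    using homeomorphic_imp_open_map[OF h] that by (simp add: open_map_def)
  have vi: "h -` (h ` C) = C" for C using bij by (simp add: bij_is_inj inj_vimage_image_eq)
  have iv: "h ` (h -` C) = C" for C using bij by (simp add: bij_is_surj surj_image_vimage_eq)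
  have io: "inner_open (h -` V) = inner_open V" for V
  proof (rule antisym)
    show "inner_open (h -` V) \<le> inner_open V"
      unfolding inner_open_def[of "h -` V"]
    proof (rule SUP_least)
      fix C assume C: "C \<in> {C. closed C \<and> C \<subseteq> h -` V}"
      have "ennreal (m C) = ennreal (m (h ` C))" using inv[of "h ` C"] vi[of C] by simp
      also have "\<dots> \<le> inner_open V" using C by (intro inner_open_ge closed_im) auto
      finally show "ennreal (m C) \<le> inner_open V" .
    qed
    show "inner_open V \<le> inner_open (h -` V)"
      unfolding inner_open_def[of V]
    proof (rule SUP_least)
      fix C assume C: "C \<in> {C. closed C \<and> C \<subseteq> V}"
      have "ennreal (m C) = ennreal (m (h -` C))" by (simp add: inv)
      also have "\<dots> \<le> inner_open (h -` V)"
        using C closed_vimage[OF _ cont] by (intro inner_open_ge) auto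
      finally show "ennreal (m C) \<le> inner_open (h -` V)" .
    qed
  qed
  have ou: "outer (h -` B) = outer B" for B
  proof (rule antisym)
    show "outer (h -` B) \<le> outer B"
      unfolding outer_def[of B]
    proof (rule INF_greatest)
      fix V assume V: "V \<in> {V. open V \<and> B \<subseteq> V}"
      then have "outer (h -` B) \<le> inner_open (h -` V)"
        using open_vimage[OF _ cont] by (intro outer_le) auto
      then show "outer (h -` B) \<le> inner_open V" by (simp add: io)
    qed
    show "outer B \<le> outer (h -` B)"
      unfolding outer_def[of "h -` B"]
    proof (rule INF_greatest)
      fix V assume V: "V \<in> {V. open V \<and> h -` B \<subseteq> V}"
      then have "B \<subseteq> h ` V" using image_mono[of "h -` B" V h] iv[of B] by auto
      then have "outer B \<le> inner_open (h ` V)" using V by (intro outer_le open_im) auto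
      then show "outer B \<le> inner_open V" using io[of "h ` V"] by (simp add: vi)
    qed
  qed
  have meas: "h \<in> measurable radon borel"
    using borel_measurable_continuous_onI[OF cont] by (simp add: measurable_cong_sets[OF sets_radon refl])
  show ?thesis
  proof (rule measure_eqI)
    show "sets (distr radon borel h) = sets radon" by (simp add: sets_radon)
    fix B assume "B \<in> sets (distr radon borel h)"
    then have B: "B \<in> sets borel" by simp
    have "h -` B \<in> sets borel" using measurable_sets[OF meas B] by (simp add: space_radon sets_radon)
    then show "emeasure (distr radon borel h) B = emeasure radon B"
      using B meas by (simp add: emeasure_distr space_radon emeasure_radon ou)
  qed
qed

end

text \<open>
  Invariance passes from \<open>m\<close> to the measure because homeomorphisms permute the closed and the open sets
  from which the measure is built.
\<close>

lemma invariant_measure_of_mean: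
  fixes m :: "'x::t2_space set \<Rightarrow> real"
  assumes cp: "compact (UNIV :: 'x set)"
    and m: "\<And>A. 0 \<le> m A" "m UNIV = 1" "\<And>A B. A \<inter> B = {} \<Longrightarrow> m (A \<union> B) = m A + m B"
    and homeo: "\<And>g. g \<in> carrier G \<Longrightarrow> homeomorphic_map euclidean euclidean (\<phi> g)"
    and inv: "\<And>g A. g \<in> carrier G \<Longrightarrow> m (\<phi> g -` A) = m A"
  shows "\<exists>\<mu>\<in>invariant_measures G \<phi>. \<forall>V. open V \<longrightarrow> measure \<mu> V \<le> m V"
proof
  let ?\<mu> = "radon m"
  interpret prob_space ?\<mu> by (rule prob_space_radon[OF cp m])
  show "?\<mu> \<in> invariant_measures G \<phi>"
    unfolding invariant_measures_def
    using regular_borel_prob_radon[OF cp m] distr_radon[OF cp m homeo inv] by blast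
  show "\<forall>V. open V \<longrightarrow> measure ?\<mu> V \<le> m V"
    using emeasure_radon_open_le[OF cp m] m(1) by (simp add: emeasure_eq_measure)
qed

section \<open>A measure of positive density\<close>

text \<open>
  Compactness of \<open>[0, 1]\<close> to the power of all subsets of the space. The conclusion says that \<open>m\<close> is
  approximated on any finite family of sets by \<open>M\<close> at arbitrarily large indices.
\<close>

lemma invariance_net_cluster_mean:
  fixes M :: "'g set \<times> real \<Rightarrow> 'x set \<Rightarrow> real"
  assumes "\<And>p B. M p B \<in> {0..1}"
  shows "\<exists>m. (\<forall>B. 0 \<le> m B) \<and> (\<forall>\<B> \<epsilon> K \<delta>. finite \<B> \<longrightarrow> \<epsilon> > 0 \<longrightarrow> (K, \<delta>) \<in> invariance_index G \<longrightarrow>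
     (\<exists>K' \<delta>'. (K', \<delta>') \<in> invariance_index G \<and> K \<subseteq> K' \<and> \<delta>' \<le> \<delta> \<and> (\<forall>B\<in>\<B>. \<bar>M (K', \<delta>') B - m B\<bar> < \<epsilon>)))"
proof -
  let ?X = "Pi\<^sub>E UNIV (\<lambda>_. {0..1}) :: ('x set \<Rightarrow> real) set"
  let ?F = "filtermap M (invariance_net G)"
  have "compactin (product_topology (\<lambda>_. euclidean) UNIV) ?X"
    by (simp add: compactin_PiE)
  then have cp: "compact ?X" by (simp add: euclidean_product_topology compactin_euclidean_iff)
  have ne: "?F \<noteq> bot" using invariance_net_neq_bot[of G] by (simp add: filtermap_bot_iff)
  have ev: "eventually (\<lambda>f. f \<in> ?X) ?F"
    using assms by (intro eventuallyI[THEN eventually_filtermap[THEN iffD2]] PiE_I) auto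
  have "\<exists>m\<in>?X. inf (nhds m) ?F \<noteq> bot"
    using cp[unfolded compact_filter, rule_format, OF ne ev] .
  then obtain m where m: "m \<in> ?X" "inf (nhds m) ?F \<noteq> bot" by (elim bexE)
  have "\<exists>K' \<delta>'. (K', \<delta>') \<in> invariance_index G \<and> K \<subseteq> K' \<and> \<delta>' \<le> \<delta> \<and> (\<forall>B\<in>\<B>. \<bar>M (K', \<delta>') B - m B\<bar> < \<epsilon>)"
    if \<B>: "finite \<B>" "\<epsilon> > 0" "(K, \<delta>) \<in> invariance_index G" for \<B> \<epsilon> K \<delta>
  proof (rule ccontr)
    assume neg: "\<not> ?thesis"
    let ?N = "\<Inter>B\<in>\<B>. {f. \<bar>f B - m B\<bar> < \<epsilon>}"
    have "open {f :: 'x set \<Rightarrow> real. \<bar>f B - m B\<bar> < \<epsilon>}" for B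
      by (intro open_Collect_less continuous_intros continuous_on_product_coordinates)
    then have "open ?N" using \<B>(1) by (intro open_INT) auto
    moreover have "m \<in> ?N" using \<B>(2) by simp
    ultimately have e1: "eventually (\<lambda>f. f \<in> ?N) (nhds m)" by (rule eventually_nhds_in_open)
    have e2: "eventually (\<lambda>f. f \<notin> ?N) ?F"
      unfolding eventually_filtermap eventually_invariance_net
      using neg \<B>(3) by (intro exI[of _ K] exI[of _ \<delta>] conjI allI impI) auto
    have "eventually (\<lambda>_. False) (inf (nhds m) ?F)"
      unfolding eventually_inf using e1 e2
        by (intro exI[of _ "\<lambda>f. f \<in> ?N"] exI[of _ "\<lambda>f. f \<notin> ?N"] conjI) auto
    then show False using m(2) by (simp add: trivial_limit_def)
  qed
  moreover have "\<forall>B. 0 \<le> m B" using m(1) by (auto simp: PiE_iff)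
  ultimately show ?thesis by (intro exI[of _ m] conjI allI impI) blast+
qed

lemma (in group) card_almost_invariant_shift:
  fixes \<delta> :: real
  assumes "finite F" "F \<subseteq> carrier G" "g \<in> carrier G" "finite S"
    and "(1 - \<delta>) * real (card F) \<le> real (card {s \<in> F. {g} #> s \<subseteq> F})"
  shows "real (card {p \<in> F \<times> S. R (g \<otimes> fst p) (snd p)})
     \<le> real (card {p \<in> F \<times> S. R (fst p) (snd p)}) + \<delta> * real (card (F \<times> S))"
proof -
  let ?I = "{s \<in> F. {g} #> s \<subseteq> F}"
  let ?A = "{p \<in> F \<times> S. R (g \<otimes> fst p) (snd p)}" and ?B = "{p \<in> F \<times> S. R (fst p) (snd p)}"
  have fin: "finite (F \<times> S)" using assms by simp
  let ?f = "\<lambda>p. (g \<otimes> fst p, snd p)"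
  have inj: "inj_on ?f (?A \<inter> ?I \<times> S)"
    using assms(2,3) by (intro inj_onI) (auto simp: subset_iff)
  have "?f ` (?A \<inter> ?I \<times> S) \<subseteq> ?B" by (auto simp: r_coset_def)
  then have 1: "card (?A \<inter> ?I \<times> S) \<le> card ?B"
    using card_inj_on_le[OF inj] fin by simp
  have "?A \<subseteq> (?A \<inter> ?I \<times> S) \<union> (F - ?I) \<times> S" by auto
  then have "card ?A \<le> card ((?A \<inter> ?I \<times> S) \<union> (F - ?I) \<times> S)"
    using fin assms(1,4) by (intro card_mono) auto
  also have "\<dots> \<le> card (?A \<inter> ?I \<times> S) + card ((F - ?I) \<times> S)" by (rule card_Un_le)
  finally have "card ?A \<le> card ?B + card (F - ?I) * card S"
    using 1 by (simp add: card_cartesian_product)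
  then have "real (card ?A) \<le> real (card ?B + card (F - ?I) * card S)"
    by (rule of_nat_mono)
  then have "real (card ?A) \<le> real (card ?B) + real (card (F - ?I)) * real (card S)"
    unfolding of_nat_add of_nat_mult .
  moreover have "real (card (F - ?I)) \<le> \<delta> * real (card F)"
  proof -
    have "card (F - ?I) = card F - card ?I" using assms(1) by (intro card_Diff_subset) auto
    moreover have "card ?I \<le> card F" using assms(1) by (intro card_mono) auto
    ultimately have "real (card (F - ?I)) = real (card F) - real (card ?I)" by simp
    then show ?thesis using assms(5) by (simp add: algebra_simps)
  qed
  then have "real (card (F - ?I)) * real (card S) \<le> \<delta> * real (card F) * real (card S)"
    by (rule mult_right_mono) simp
  ultimately show ?thesis by (simp add: card_cartesian_product mult.assoc)
qed

text \<open>
  Restriction along \<open>\<tau>\<close> maps good labellings of \<open>J\<close> to realised patterns on \<open>T\<close>, and a pattern has at most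
  \<open>k ^ (card J - card T)\<close> preimages.
\<close>

lemma card_patterns_ge_of_good_labels:
  fixes E :: "'z \<Rightarrow> nat \<Rightarrow> 'p set"
  assumes "finite J" "finite T" and inj: "inj_on \<tau> T" and \<tau>: "\<tau> ` T \<subseteq> J" and k: "k \<ge> 1"
    and good: "real (card {\<sigma>\<in>J \<rightarrow>\<^sub>E {1..k}. q \<sigma> \<in> V}) \<ge> \<theta> * real k ^ card J"
    and q: "\<And>\<sigma> t. \<sigma> \<in> J \<rightarrow>\<^sub>E {1..k} \<Longrightarrow> t \<in> T \<Longrightarrow> q \<sigma> \<in> E t (\<sigma> (\<tau> t))"
  shows "real (card {\<rho>\<in>T \<rightarrow>\<^sub>E {1..k}. \<exists>p\<in>V. \<forall>t\<in>T. p \<in> E t (\<rho> t)}) \<ge> \<theta> * real k ^ card T"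
proof -
  let ?R = "{\<rho>\<in>T \<rightarrow>\<^sub>E {1..k}. \<exists>p\<in>V. \<forall>t\<in>T. p \<in> E t (\<rho> t)}"
  let ?G = "{\<sigma>\<in>J \<rightarrow>\<^sub>E {1..k}. q \<sigma> \<in> V}"
  let ?J = "J - \<tau> ` T"
  let ?f = "\<lambda>\<sigma>. (restrict (\<lambda>t. \<sigma> (\<tau> t)) T, restrict \<sigma> ?J)"
  have "finite (T \<rightarrow>\<^sub>E {1..k})" "finite (?J \<rightarrow>\<^sub>E {1..k})"
    using assms(1,2) by (simp_all add: finite_PiE)
  then have fin: "finite (?R \<times> (?J \<rightarrow>\<^sub>E {1..k}))" by simp
  have "inj_on ?f ?G"
  proof (rule inj_onI)
    fix \<sigma> \<sigma>' assume \<sigma>: "\<sigma> \<in> ?G" "\<sigma>' \<in> ?G" and eq: "?f \<sigma> = ?f \<sigma>'"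
    have e: "\<sigma> u = \<sigma>' u" if u: "u \<in> J" for u
    proof (cases "u \<in> \<tau> ` T")
      case True
      then obtain t where "t \<in> T" "u = \<tau> t" by blast
      then show ?thesis using fun_cong[of _ _ t, OF conjunct1[OF eq[unfolded prod.inject]]] by simp
    next
      case False
      then show ?thesis using u fun_cong[of _ _ u, OF conjunct2[OF eq[unfolded prod.inject]]] by simp
    qed
    show "\<sigma> = \<sigma>'" by (rule PiE_ext[of _ J "\<lambda>_. {1..k}"]) (use \<sigma> e in auto)
  qed
  moreover have "?f ` ?G \<subseteq> ?R \<times> (?J \<rightarrow>\<^sub>E {1..k})"
  proof
    fix w assume "w \<in> ?f ` ?G"
    then obtain \<sigma> where \<sigma>: "\<sigma> \<in> J \<rightarrow>\<^sub>E {1..k}" "q \<sigma> \<in> V" "w = ?f \<sigma>" by blast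
    have v: "\<sigma> u \<in> {1..k}" if "u \<in> J" for u using PiE_mem[OF \<sigma>(1) that] .
    have "restrict (\<lambda>t. \<sigma> (\<tau> t)) T \<in> T \<rightarrow>\<^sub>E {1..k}" using v \<tau> by (intro restrict_PiE_iff[THEN iffD2]) blast
    moreover have "\<exists>p\<in>V. \<forall>t\<in>T. p \<in> E t (restrict (\<lambda>t. \<sigma> (\<tau> t)) T t)"
      using q[OF \<sigma>(1)] \<sigma>(2) by (intro bexI[of _ "q \<sigma>"]) auto
    moreover have "restrict \<sigma> ?J \<in> ?J \<rightarrow>\<^sub>E {1..k}" using v by (intro restrict_PiE_iff[THEN iffD2]) blast
    ultimately show "w \<in> ?R \<times> (?J \<rightarrow>\<^sub>E {1..k})" unfolding \<sigma>(3) by blast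
  qed
  ultimately have "card ?G \<le> card (?R \<times> (?J \<rightarrow>\<^sub>E {1..k}))"
    by (rule card_inj_on_le[OF _ _ fin])
  also have "\<dots> = card ?R * k ^ card ?J"
    using assms(1) by (simp add: card_cartesian_product card_PiE)
  finally have "real (card ?G) \<le> real (card ?R * k ^ card ?J)"
    by (rule of_nat_mono)
  then have "real (card ?G) \<le> real (card ?R) * real k ^ card ?J"
    unfolding of_nat_mult of_nat_power .
  then have le: "\<theta> * real k ^ card J \<le> real (card ?R) * real k ^ card ?J" using good by linarith
  have "card (\<tau> ` T) = card T" by (rule card_image[OF inj])
  then have "card J = card T + card ?J"
    using card_Diff_subset[of "\<tau> ` T" J] card_mono[OF assms(1) \<tau>] assms(2) \<tau> by simp
  then have "(\<theta> * real k ^ card T) * real k ^ card ?J \<le> real (card ?R) * real k ^ card ?J"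
    using le by (simp add: power_add mult.assoc)
  moreover have "real k ^ card ?J > 0" using k by simp
  ultimately show ?thesis by (simp add: mult_le_cancel_right_pos)
qed

text \<open>
  The measure regularises a cluster point \<open>m\<close> of the uniform distributions \<open>M p\<close> on the points
  \<open>\<phi> s (xx p \<sigma>)\<close>, where \<open>s\<close> runs through the almost invariant set \<open>FF p\<close> and \<open>\<sigma>\<close> through the labellings of
  the independence set \<open>JJ p\<close>. The heart is the bound \<open>key\<close>, valid at every finite set \<open>F0\<close> and every \<open>D\<close>
  of measure at least \<open>1 - \<delta>\<close>.
\<close>

lemma exists_measure_of_positive_density:
  fixes G :: "('g, 'm) monoid_scheme" (structure) and \<phi> :: "'g \<Rightarrow> 'x::t2_space \<Rightarrow> 'x"
  assumes am: "amenable_group G" and cp: "compact (UNIV :: 'x set)"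
    and act: "group_action G UNIV \<phi>"
    and homeo: "\<And>g. g \<in> carrier G \<Longrightarrow> homeomorphic_map euclidean euclidean (\<phi> g)"
    and k: "k \<ge> 1" and cl: "\<And>i. i \<in> {1..k} \<Longrightarrow> closed (A i)"
    and pos: "inv_limsup G (\<lambda>F. real (max_independence G \<phi> k A UNIV F)) > 0"
  shows "\<exists>\<mu>\<in>invariant_measures G \<phi>. upper_mu_density G \<phi> \<mu> k A > 0"
proof -
  interpret group_action G UNIV \<phi> by fact
  interpret group G using group_hom group_hom.axioms(1) by blast
  obtain L where L: "0 < ereal L" "ereal L < inv_limsup G (\<lambda>F. real (max_independence G \<phi> k A UNIV F))"
    using pos ereal_dense2 by blast
  have L0: "L > 0" using L(1) by simp
  have dens: "L * card F \<le> max_independence G \<phi> k A UNIV F" if F: "finite F" "F \<subseteq> carrier G" "F \<noteq> {}" for F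
  proof -
    have "ereal L < ereal (max_independence G \<phi> k A UNIV F / card F)"
      using L(2) inv_limsup_le_finite[OF act k F, of A] by (rule less_le_trans)
    moreover have "card F > 0" using F by (simp add: card_gt_0_iff)
    ultimately show ?thesis by (simp add: field_simps)
  qed
  \<comment> \<open>The data attached to an index \<open>p\<close>: an almost invariant set, an independence set inside it, and a point
    for every labelling of the latter.\<close>
  define good where "good p q \<longleftrightarrow> (case q of (F, J, x) \<Rightarrow> F \<in> almost_invariant G (fst p) (snd p) \<and> J \<subseteq> F \<and>
      L * real (card F) \<le> real (card J) \<and> (\<forall>\<sigma>\<in>J \<rightarrow>\<^sub>E {1..k}. \<forall>s\<in>J. \<phi> s (x \<sigma>) \<in> A (\<sigma> s)))"
    for p :: "'g set \<times> real" and q :: "'g set \<times> 'g set \<times> (('g \<Rightarrow> nat) \<Rightarrow> 'x)"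
  have "\<forall>p\<in>invariance_index G. \<exists>q. good p q"
  proof
    fix p assume p: "p \<in> invariance_index G"
    obtain F where F: "F \<in> almost_invariant G (fst p) (snd p)"
      using almost_invariant_nonempty[OF am, of "fst p" "snd p"] p by (auto simp: invariance_index_def)
    then have F': "finite F" "F \<subseteq> carrier G" "F \<noteq> {}" by (auto simp: almost_invariant_def)
    obtain J where J: "J \<subseteq> F" "independence_set G \<phi> k A UNIV J" "card J = max_independence G \<phi> k A UNIV F"
      by (rule max_independence_attained[OF F'(1)])
    have cJ: "L * real (card F) \<le> real (card J)" using dens[OF F'] J(3) by simp
    moreover have "L * real (card F) > 0" using L0 F' by (simp add: card_gt_0_iff)
    ultimately have "card J > 0" by linarith
    then have Jne: "finite J" "J \<noteq> {}" by (auto simp: card_gt_0_iff)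
    have "\<exists>p\<in>UNIV. \<forall>s\<in>J. \<phi> s p \<in> A (\<sigma> s)" if "\<sigma> \<in> J \<rightarrow>\<^sub>E {1..k}" for \<sigma>
      using independence_set_finite_iff[OF Jne k, THEN iffD1, OF J(2), THEN conjunct2] that
        by (simp add: PiE_def)
    then have "\<forall>\<sigma>\<in>J \<rightarrow>\<^sub>E {1..k}. \<exists>p. \<forall>s\<in>J. \<phi> s p \<in> A (\<sigma> s)" by simp
    from bchoice[OF this] obtain x where "\<forall>\<sigma>\<in>J \<rightarrow>\<^sub>E {1..k}. \<forall>s\<in>J. \<phi> s (x \<sigma>) \<in> A (\<sigma> s)" by (elim exE)
    then have "good p (F, J, x)" using F J(1) cJ unfolding good_def by simp
    then show "\<exists>q. good p q" by (rule exI)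
  qed
  from bchoice[OF this] obtain Q where Q: "\<forall>p\<in>invariance_index G. good p (Q p)" by (elim exE)
  define FF where "FF p = fst (Q p)" for p
  define JJ where "JJ p = fst (snd (Q p))" for p
  define xx where "xx p = snd (snd (Q p))" for p
  define \<Sigma> where "\<Sigma> p = JJ p \<rightarrow>\<^sub>E {1..k}" for p
  have g: "FF p \<in> almost_invariant G (fst p) (snd p)" "JJ p \<subseteq> FF p"
    "L * real (card (FF p)) \<le> real (card (JJ p))"
    "\<And>\<sigma> s. \<sigma> \<in> \<Sigma> p \<Longrightarrow> s \<in> JJ p \<Longrightarrow> \<phi> s (xx p \<sigma>) \<in> A (\<sigma> s)"
    if "p \<in> invariance_index G" for p
    using bspec[OF Q that] unfolding good_def FF_def JJ_def xx_def \<Sigma>_def by (simp_all add: case_prod_beta)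
  have fF: "finite (FF p)" "FF p \<subseteq> carrier G" "FF p \<noteq> {}" "card (FF p) > 0" "finite (JJ p)"
    "finite (\<Sigma> p)" "card (\<Sigma> p) = k ^ card (JJ p)" "card (\<Sigma> p) > 0"
    if "p \<in> invariance_index G" for p
  proof -
    show F: "finite (FF p)" "FF p \<subseteq> carrier G" "FF p \<noteq> {}" using g(1)[OF that]
      by (auto simp: almost_invariant_def)
    then show "card (FF p) > 0" by (simp add: card_gt_0_iff)
    show J: "finite (JJ p)" using g(2)[OF that] F(1) by (rule finite_subset)
    then show "finite (\<Sigma> p)" unfolding \<Sigma>_def by (intro finite_PiE) auto
    show "card (\<Sigma> p) = k ^ card (JJ p)" unfolding \<Sigma>_def using J by (simp add: card_PiE)
    then show "card (\<Sigma> p) > 0" using k by simp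
  qed
  define N where "N p B = {w \<in> FF p \<times> \<Sigma> p. \<phi> (fst w) (xx p (snd w)) \<in> B}" for p B
  define M where "M p B = (if p \<in> invariance_index G then real (card (N p B)) / real (card (FF p \<times> \<Sigma> p))
    else 0)" for p B
  have finO: "finite (FF p \<times> \<Sigma> p)" "card (FF p \<times> \<Sigma> p) > 0" if "p \<in> invariance_index G" for p
    using fF[OF that] by (auto simp: card_cartesian_product)
  have finN: "finite (N p B)" if "p \<in> invariance_index G" for p B
    unfolding N_def using finO[OF that] by simp
  have M01: "M p B \<in> {0..1}" for p B
  proof (cases "p \<in> invariance_index G")
    case True
    have "card (N p B) \<le> card (FF p \<times> \<Sigma> p)" unfolding N_def using finO[OF True] by (intro card_mono) auto
    then have "real (card (N p B)) / real (card (FF p \<times> \<Sigma> p)) \<le> 1"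
      by (intro divide_le_eq_1[THEN iffD2]) linarith
    then show ?thesis using True by (simp add: M_def)
  qed (simp add: M_def)
  have MU: "M p UNIV = 1" if "p \<in> invariance_index G" for p
  proof -
    have "N p UNIV = FF p \<times> \<Sigma> p" unfolding N_def by auto
    moreover have "real (card (FF p \<times> \<Sigma> p)) \<noteq> 0" using finO(2)[OF that] by linarith
    ultimately show ?thesis using that unfolding M_def by (simp only: divide_self if_True simp_thms)
  qed
  have Madd: "M p (B \<union> C) = M p B + M p C" if "p \<in> invariance_index G" "B \<inter> C = {}" for p B C
  proof -
    have "N p (B \<union> C) = N p B \<union> N p C" "N p B \<inter> N p C = {}" using that(2) by (auto simp: N_def)
    then have "card (N p (B \<union> C)) = card (N p B) + card (N p C)"
      using finN[OF that(1)] by (simp add: card_Un_disjoint)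
    then show ?thesis using that(1) by (simp add: M_def add_divide_distrib)
  qed
  have Minv: "M p (\<phi> g -` B) \<le> M p B + snd p" if p: "p \<in> invariance_index G" "g \<in> fst p" for p g B
  proof -
    have gc: "g \<in> carrier G" using p by (auto simp: invariance_index_def)
    have "FF p \<in> almost_invariant G {g} (snd p)"
      using g(1)[OF p(1)] almost_invariant_antimono[of "{g}" "fst p" "snd p" "snd p" G] p(2) by auto
    then have inv: "(1 - snd p) * real (card (FF p)) \<le> real (card {s \<in> FF p. {g} #> s \<subseteq> FF p})"
      by (simp add: almost_invariant_def)
    have "N p (\<phi> g -` B) = {w \<in> FF p \<times> \<Sigma> p. \<phi> (g \<otimes> fst w) (xx p (snd w)) \<in> B}"
      unfolding N_def using composition_rule[OF _ gc] fF(2)[OF p(1)] by auto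
    then have "real (card (N p (\<phi> g -` B))) \<le> real (card (N p B)) + snd p * real (card (FF p \<times> \<Sigma> p))"
      using card_almost_invariant_shift[OF fF(1,2)[OF p(1)] gc fF(6)[OF p(1)] inv, of
        "\<lambda>s \<sigma>. \<phi> s (xx p \<sigma>) \<in> B"]
      by (simp add: N_def)
    then show ?thesis using finO(2)[OF p(1)] p(1) by (simp add: M_def field_simps)
  qed
  obtain m where m0: "\<forall>B. 0 \<le> m B" and m: "\<forall>\<B> \<epsilon> K \<delta>. finite \<B> \<longrightarrow> \<epsilon> > 0 \<longrightarrow> (K, \<delta>) \<in> invariance_index G \<longrightarrow>
     (\<exists>K' \<delta>'. (K', \<delta>') \<in> invariance_index G \<and> K \<subseteq> K' \<and> \<delta>' \<le> \<delta> \<and> (\<forall>B\<in>\<B>. \<bar>M (K', \<delta>') B - m B\<bar> < \<epsilon>))"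
    using invariance_net_cluster_mean[of M G, OF M01] by (elim exE conjE)
  have near: "\<exists>p\<in>invariance_index G. K \<subseteq> fst p \<and> snd p \<le> \<delta> \<and> (\<forall>B\<in>\<B>. \<bar>M p B - m B\<bar> < \<epsilon>)"
    if "finite \<B>" "\<epsilon> > 0" "finite K" "K \<subseteq> carrier G" "\<delta> > 0" for \<B> \<epsilon> K \<delta>
  proof -
    have "(K, \<delta>) \<in> invariance_index G" using that by (simp add: invariance_index_def)
    from m[rule_format, OF that(1,2) this] obtain K' \<delta>' where
      "(K', \<delta>') \<in> invariance_index G" "K \<subseteq> K'" "\<delta>' \<le> \<delta>" "\<forall>B\<in>\<B>. \<bar>M (K', \<delta>') B - m B\<bar> < \<epsilon>" by (elim exE conjE)
    then show ?thesis by (intro bexI[of _ "(K', \<delta>')"]) auto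
  qed
  have mU: "m UNIV = 1"
  proof (rule ccontr)
    assume "m UNIV \<noteq> 1"
    then obtain p where "p \<in> invariance_index G" "\<bar>M p UNIV - m UNIV\<bar> < \<bar>1 - m UNIV\<bar>"
      using near[of "{UNIV}" "\<bar>1 - m UNIV\<bar>" "{}" 1] by auto
    then show False using MU by auto
  qed
  have madd: "m (B \<union> C) = m B + m C" if BC: "B \<inter> C = {}" for B C
  proof (rule ccontr)
    assume n: "m (B \<union> C) \<noteq> m B + m C"
    define \<epsilon> where "\<epsilon> = \<bar>m (B \<union> C) - (m B + m C)\<bar> / 3"
    have "\<epsilon> > 0" using n by (simp add: \<epsilon>_def)
    then obtain p where p: "p \<in> invariance_index G" "\<bar>M p B - m B\<bar> < \<epsilon>" "\<bar>M p C - m C\<bar> < \<epsilon>"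
      "\<bar>M p (B \<union> C) - m (B \<union> C)\<bar> < \<epsilon>"
      using near[of "{B, C, B \<union> C}" \<epsilon> "{}" 1] by auto
    have "\<bar>m (B \<union> C) - (m B + m C)\<bar> < 3 * \<epsilon>"
      using p(2-4) Madd[OF p(1) BC] by (simp add: abs_if split: if_splits)
    then show False by (simp add: \<epsilon>_def)
  qed
  have minv_le: "m (\<phi> g -` B) \<le> m B" if gc: "g \<in> carrier G" for g B
  proof (rule field_le_epsilon)
    fix e :: real assume "e > 0"
    then have e: "e / 3 > 0" by simp
    obtain p where p: "p \<in> invariance_index G" "{g} \<subseteq> fst p" "snd p \<le> e / 3"
      "\<bar>M p B - m B\<bar> < e / 3" "\<bar>M p (\<phi> g -` B) - m (\<phi> g -` B)\<bar> < e / 3"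
      using near[of "{B, \<phi> g -` B}" "e/3" "{g}" "e/3"] e gc by auto
    have "M p (\<phi> g -` B) \<le> M p B + snd p" using Minv[OF p(1), of g B] p(2) by simp
    then show "m (\<phi> g -` B) \<le> m B + e" using p(3-5) by linarith
  qed
  \<comment> \<open>The other inequality is the same one for the complement.\<close>
  have mcompl: "m (- B) = 1 - m B" for B using madd[of B "- B"] mU by simp
  have minv: "m (\<phi> g -` B) = m B" if gc: "g \<in> carrier G" for g B
    using minv_le[OF gc, of B] minv_le[OF gc, of "- B"] by (simp add: vimage_Compl mcompl)
  have "\<exists>\<mu>\<in>invariant_measures G \<phi>. \<forall>V. open V \<longrightarrow> measure \<mu> V \<le> m V"
    by (rule invariant_measure_of_mean[OF cp spec[OF m0] mU madd homeo minv])
  then obtain \<mu> where \<mu>: "\<mu> \<in> invariant_measures G \<phi>" "\<forall>V. open V \<longrightarrow> measure \<mu> V \<le> m V"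
    by (elim bexE)
  have reg: "regular_borel_prob \<mu>" using \<mu>(1) by (simp add: invariant_measures_def)
  interpret P: prob_space \<mu> using reg by (simp add: regular_borel_prob_def)
  have sets: "sets \<mu> = sets borel" using reg by (simp add: regular_borel_prob_def)
  obtain \<theta> c :: real where c: "c > 0" and \<theta>: "0 < \<theta>" "\<theta> < 1"
    and dense: "\<forall>(Z :: 'g set) (D :: 'x set) E. finite Z \<longrightarrow>
     real (card {\<sigma>\<in>Z \<rightarrow>\<^sub>E {1..k}. \<exists>p\<in>D. \<forall>z\<in>Z. p \<in> E z (\<sigma> z)}) \<ge> \<theta> * real k ^ card Z \<longrightarrow>
     (\<exists>W\<subseteq>Z. real (card W) \<ge> c * real (card Z) \<and> independent_over k E D W)"
    using dense_patterns_independent[OF k, where 'z = 'g and 'p = 'x] by (elim exE conjE)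
  \<comment> \<open>At most a fraction \<open>3 \<delta>\<close> of the pairs \<open>(s, \<sigma>)\<close> will be bad, so at most a fraction
    \<open>3 \<delta> / (1 - \<theta>) = L / 4\<close> of the \<open>s\<close> has too many bad labellings. This is less than the average
    weight \<open>3 L / 4\<close> can afford to lose.\<close>
  define \<delta> where "\<delta> = (1 - \<theta>) * L / 12"
  have \<delta>: "\<delta> > 0" using \<theta> L0 by (simp add: \<delta>_def)
  have cont: "closed (\<phi> s -` A i)" if "s \<in> carrier G" "i \<in> {1..k}" for s i
  proof -
    have "continuous_on UNIV (\<phi> s)" using homeomorphic_imp_continuous_map[OF homeo[OF that(1)]] by simp
    from closed_vimage[OF cl[OF that(2)] this] show ?thesis .
  qed
  have key: "real (max_independence G \<phi> k A D F0) \<ge> c * (L / 4) * real (card F0)"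
    if D: "D \<in> borel_large \<mu> \<delta>" and F0: "finite F0" "F0 \<subseteq> carrier G" "F0 \<noteq> {}" for D F0
  proof -
    have D': "D \<in> sets borel" "measure \<mu> D \<ge> 1 - \<delta>" using D by (auto simp: borel_large_def)
    have inner: "emeasure \<mu> D = (SUP K\<in>{K. compact K \<and> K \<subseteq> D}. emeasure \<mu> K)"
      using reg D'(1) unfolding regular_borel_prob_def by blast
    have "{K. compact K \<and> K \<subseteq> D} \<noteq> {}" "emeasure \<mu> D \<noteq> \<infinity>" by (blast, simp)
    from SUP_approx_ennreal[OF \<delta> this(1) inner this(2)]
    have "\<exists>K\<in>{K. compact K \<and> K \<subseteq> D}. emeasure \<mu> D < emeasure \<mu> K + ennreal \<delta>" .
    then obtain K where K: "compact K" "K \<subseteq> D" "emeasure \<mu> D < emeasure \<mu> K + ennreal \<delta>" by blast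
    have mK: "measure \<mu> K \<ge> 1 - 2 * \<delta>"
      using K(3) D'(2) \<delta> by (simp add: P.emeasure_eq_measure ennreal_less_iff flip: ennreal_plus)
    \<comment> \<open>\<open>V\<close> is an open neighbourhood of \<open>K\<close> that misses every closed set \<open>C w\<close> disjoint from \<open>K\<close>. Hence a
      pattern on a subset of \<open>F0\<close> that is realised in \<open>V\<close> is realised in \<open>K\<close>, so also in \<open>D\<close>.\<close>
    define C where "C w = (\<Inter>s\<in>fst w. \<phi> s -` A (snd w s))" for w :: "'g set \<times> ('g \<Rightarrow> nat)"
    define \<W> where "\<W> = {w \<in> Sigma (Pow F0) (\<lambda>W. W \<rightarrow>\<^sub>E {1..k}). C w \<inter> K = {}}"
    have fin\<W>: "finite \<W>"
    proof (rule finite_subset)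
      show "\<W> \<subseteq> Sigma (Pow F0) (\<lambda>W. W \<rightarrow>\<^sub>E {1..k})" by (auto simp: \<W>_def)
      show "finite (Sigma (Pow F0) (\<lambda>W. W \<rightarrow>\<^sub>E {1..k}))"
        using F0(1) by (intro finite_SigmaI finite_PiE) (auto intro: finite_subset)
    qed
    have "closed (C w)" if "w \<in> \<W>" for w
      unfolding C_def
    proof (intro closed_INT ballI)
      fix s assume s: "s \<in> fst w"
      have "fst w \<subseteq> F0" "snd w \<in> fst w \<rightarrow>\<^sub>E {1..k}" using that by (auto simp: \<W>_def)
      then have "s \<in> carrier G" "snd w s \<in> {1..k}" using s F0(2) by (blast, metis PiE_mem)
      then show "closed (\<phi> s -` A (snd w s))" by (rule cont)
    qed
    then have "closed (\<Union>w\<in>\<W>. C w)" using fin\<W> by (intro closed_UN ballI)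
    define V where "V = - (\<Union>w\<in>\<W>. C w)"
    have V: "open V" unfolding V_def using \<open>closed (\<Union>w\<in>\<W>. C w)\<close> by (rule open_Compl)
    have KV: "K \<subseteq> V" by (auto simp: V_def \<W>_def)
    have "measure \<mu> K \<le> measure \<mu> V"
      using KV V by (intro P.finite_measure_mono) (auto simp: sets)
    then have mV: "m V \<ge> 1 - 2 * \<delta>" using mK \<mu>(2) V by force
    let ?K0 = "(\<lambda>t. inv t) ` F0"
    obtain p where p: "p \<in> invariance_index G" "?K0 \<subseteq> fst p" "snd p \<le> L / 4" "\<bar>M p V - m V\<bar> < \<delta>"
    proof -
      have "finite ?K0" "?K0 \<subseteq> carrier G" "L / 4 > 0" using F0 L0 by auto
      from near[OF _ \<delta> this, of "{V}"] show ?thesis using that by auto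
    qed
    let ?F = "FF p" and ?J = "JJ p" and ?S = "\<Sigma> p"
    have MV: "M p V \<ge> 1 - 3 * \<delta>" using p(4) mV by linarith
    \<comment> \<open>An element \<open>s\<close> is useful if few labellings are bad at \<open>s\<close> and if the translate \<open>F0 s\<close> meets the
      independence set in a proportional part, measured by \<open>wt s\<close>.\<close>
    define bad where "bad s = card {\<sigma> \<in> ?S. \<phi> s (xx p \<sigma>) \<notin> V}" for s
    define wt where "wt s = card {t \<in> F0. t \<otimes> s \<in> ?J}" for s
    have sumbad: "(\<Sum>s\<in>?F. real (bad s)) \<le> 3 * \<delta> * (real (card ?F) * real (card ?S))"
    proof -
      have "N p (- V) = Sigma ?F (\<lambda>s. {\<sigma> \<in> ?S. \<phi> s (xx p \<sigma>) \<notin> V})" by (auto simp: N_def)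
      then have "card (N p (- V)) = (\<Sum>s\<in>?F. bad s)"
        unfolding bad_def using fF(1,6)[OF p(1)] by (simp add: card_SigmaI)
      then have "(\<Sum>s\<in>?F. real (bad s)) = real (card (N p (- V)))" by simp
      also have "\<dots> = M p (- V) * real (card (?F \<times> ?S))"
        using finO(2)[OF p(1)] p(1) by (simp add: M_def)
      also have "M p (- V) = 1 - M p V" using Madd[OF p(1), of V "- V"] MU[OF p(1)] by simp
      also have "(1 - M p V) * real (card (?F \<times> ?S)) \<le> 3 * \<delta> * real (card (?F \<times> ?S))"
        using MV by (intro mult_right_mono) auto
      finally show ?thesis by (simp add: card_cartesian_product)
    qed
    have sumwt: "(\<Sum>s\<in>?F. real (wt s)) \<ge> real (card F0) * (3 * L / 4 * real (card ?F))"
    proof -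
      have "?F \<in> almost_invariant G ?K0 (L / 4)"
        using g(1)[OF p(1)] almost_invariant_antimono[OF p(2,3), of G] by auto
      then have "(1 - L / 4) * real (card ?F) \<le> real (card {s \<in> ?F. ?K0 #> s \<subseteq> ?F})"
        by (simp add: almost_invariant_def)
      from sum_card_translates[OF F0(1,2) fF(1,2)[OF p(1)] g(2)[OF p(1)] this]
      have "real (card F0) * (real (card ?J) - L / 4 * real (card ?F)) \<le> (\<Sum>s\<in>?F. real (wt s))"
        unfolding wt_def .
      moreover have "real (card F0) * (3 * L / 4 * real (card ?F)) \<le>
        real (card F0) * (real (card ?J) - L / 4 * real (card ?F))"
        using g(3)[OF p(1)] by (intro mult_left_mono) (auto simp: algebra_simps)
      ultimately show ?thesis by linarith
    qed
    have "\<exists>s\<in>?F. real (wt s) \<ge> L / 4 * real (card F0) \<and> real (bad s) \<le> (1 - \<theta>) * real (card ?S)"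
    proof (rule ccontr)
      assume neg: "\<not> ?thesis"
      have cS: "real (card ?S) > 0" using fF(8)[OF p(1)] by simp
      have c0: "real (card F0) > 0" using F0 by (simp add: card_gt_0_iff)
      have cF: "real (card ?F) > 0" using fF(4)[OF p(1)] by simp
      let ?b = "(1 - \<theta>) * real (card ?S)"
      have b: "?b > 0" using cS \<theta> by simp
      \<comment> \<open>Whichever of the two requirements \<open>s\<close> violates, one of the two summands is large enough.\<close>
      have each: "real (wt s) \<le> L / 4 * real (card F0) + real (card F0) / ?b * real (bad s)"
        if s: "s \<in> ?F" for s
      proof (cases "real (bad s) \<le> ?b")
        case True
        then have "real (wt s) < L / 4 * real (card F0)" using neg s by force
        moreover have "real (card F0) / ?b * real (bad s) \<ge> 0" using b by simp
        ultimately show ?thesis by linarith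
      next
        case False
        have "wt s \<le> card F0" unfolding wt_def using F0(1) by (intro card_mono) auto
        moreover have "real (card F0) / ?b * ?b = real (card F0)"
          unfolding times_divide_eq_left
          by (rule nonzero_mult_div_cancel_right) (rule less_imp_neq[OF b, symmetric])
        ultimately have "real (wt s) \<le> real (card F0) / ?b * ?b" by linarith
        also have "\<dots> \<le> real (card F0) / ?b * real (bad s)"
          using False b by (intro mult_left_mono) auto
        finally show ?thesis using L0 by (simp add: add_increasing)
      qed
      have "real (card F0) * (3 * L / 4 * real (card ?F)) \<le> (\<Sum>s\<in>?F. real (wt s))" by (rule sumwt)
      also have "\<dots> \<le> (\<Sum>s\<in>?F. L / 4 * real (card F0) + real (card F0) / ?b * real (bad s))"
        by (rule sum_mono) (rule each)
      also have "\<dots> = real (card ?F) * (L / 4 * real (card F0)) + real (card F0) / ?b *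
        (\<Sum>s\<in>?F. real (bad s))"
        by (simp add: sum.distrib sum_distrib_left)
      also have "\<dots> \<le> real (card ?F) * (L / 4 * real (card F0)) + real (card F0) / ?b *
        (3 * \<delta> * (real (card ?F) * real (card ?S)))"
        using b by (intro add_left_mono mult_left_mono sumbad) auto
      also have "real (card F0) / ?b * (3 * \<delta> * (real (card ?F) * real (card ?S))) =
        L / 4 * real (card F0) * real (card ?F)"
        using cS \<theta> unfolding \<delta>_def by (simp add: field_simps)
      finally have "(L / 4) * (real (card F0) * real (card ?F)) \<le> 0"
        by (simp add: algebra_simps)
      moreover have "(L / 4) * (real (card F0) * real (card ?F)) > 0" using L0 c0 cF by simp
      ultimately show False by linarith
    qed
    then obtain s where s: "s \<in> ?F" "real (wt s) \<ge> L / 4 * real (card F0)"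
      "real (bad s) \<le> (1 - \<theta>) * real (card ?S)" by blast
    have sc: "s \<in> carrier G" using s(1) fF(2)[OF p(1)] by blast
    \<comment> \<open>The patterns on \<open>T\<close> are the labellings of the independence set, read along \<open>t \<mapsto> t s\<close>.\<close>
    define T where "T = {t \<in> F0. t \<otimes> s \<in> ?J}"
    have T: "finite T" "T \<subseteq> F0" "T \<subseteq> carrier G" using F0 by (auto simp: T_def)
    have injT: "inj_on (\<lambda>t. t \<otimes> s) T"
      using T(3) sc by (intro inj_onI) (simp add: subset_iff)
    let ?E = "\<lambda>t i. \<phi> t -` A i"
    have goodS: "real (card {\<sigma>\<in>?J \<rightarrow>\<^sub>E {1..k}. \<phi> s (xx p \<sigma>) \<in> V}) \<ge> \<theta> * real k ^ card ?J"
    proof -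
      have "?S = {\<sigma>\<in>?S. \<phi> s (xx p \<sigma>) \<in> V} \<union> {\<sigma>\<in>?S. \<phi> s (xx p \<sigma>) \<notin> V}" by blast
      then have "card ?S = card ({\<sigma>\<in>?S. \<phi> s (xx p \<sigma>) \<in> V} \<union> {\<sigma>\<in>?S. \<phi> s (xx p \<sigma>) \<notin> V})"
        by (rule arg_cong)
      also have "\<dots> \<le> card {\<sigma>\<in>?S. \<phi> s (xx p \<sigma>) \<in> V} + bad s"
        unfolding bad_def by (rule card_Un_le)
      finally have "card ?S \<le> card {\<sigma>\<in>?S. \<phi> s (xx p \<sigma>) \<in> V} + bad s" .
      then have "real (card ?S) \<le> real (card {\<sigma>\<in>?S. \<phi> s (xx p \<sigma>) \<in> V}) + real (bad s)" by linarith
      then have "\<theta> * real (card ?S) \<le> real (card {\<sigma>\<in>?S. \<phi> s (xx p \<sigma>) \<in> V})"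
        using s(3) by (simp add: algebra_simps)
      then show ?thesis using fF(7)[OF p(1)] unfolding \<Sigma>_def[of p] by simp
    qed
    have pts: "\<phi> s (xx p \<sigma>) \<in> ?E t (\<sigma> (t \<otimes> s))" if \<sigma>: "\<sigma> \<in> ?J \<rightarrow>\<^sub>E {1..k}" and t: "t \<in> T" for \<sigma> t
    proof -
      have "t \<otimes> s \<in> ?J" "t \<in> carrier G" using t T(3) by (auto simp: T_def)
      then have "\<phi> (t \<otimes> s) (xx p \<sigma>) \<in> A (\<sigma> (t \<otimes> s))"
        using g(4)[OF p(1), of \<sigma> "t \<otimes> s"] \<sigma> by (simp add: \<Sigma>_def)
      then show ?thesis using composition_rule[OF UNIV_I \<open>t \<in> carrier G\<close> sc] by simp
    qed
    have "real (card {\<rho>\<in>T \<rightarrow>\<^sub>E {1..k}. \<exists>q\<in>V. \<forall>t\<in>T. q \<in> ?E t (\<rho> t)}) \<ge> \<theta> * real k ^ card T"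
      by (rule card_patterns_ge_of_good_labels[where q =
        "\<lambda>\<sigma>. \<phi> s (xx p \<sigma>)", OF fF(5)[OF p(1)] T(1) injT _ k goodS pts])
        (auto simp: T_def)
    from dense[rule_format, OF T(1) this] obtain W where W: "W \<subseteq> T" "real (card W) \<ge> c * real (card T)"
      "independent_over k ?E V W" by (elim exE conjE)
    have cW: "real (card W) \<ge> c * (L / 4) * real (card F0)"
    proof -
      have "c * (L / 4 * real (card F0)) \<le> c * real (card T)"
        using s(2) c unfolding wt_def T_def by (intro mult_left_mono) auto
      then show ?thesis using W(2) by simp
    qed
    moreover have "c * (L / 4) * real (card F0) > 0" using c L0 F0 by (simp add: card_gt_0_iff)
    ultimately have "card W > 0" by linarith
    then have Wne: "finite W" "W \<noteq> {}" by (auto simp: card_gt_0_iff)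
    have WF: "W \<subseteq> F0" "W \<subseteq> carrier G" using W(1) T by auto
    have "\<exists>q\<in>D. \<forall>t\<in>W. \<phi> t q \<in> A (\<sigma> t)" if \<sigma>: "\<sigma> \<in> W \<rightarrow> {1..k}" for \<sigma>
    proof -
      from bspec[OF W(3)[unfolded independent_over_def] \<sigma>] obtain q where q: "q \<in> V" "\<forall>t\<in>W. q \<in> ?E t (\<sigma> t)"
        by (elim bexE)
      let ?w = "(W, restrict \<sigma> W)"
      have "q \<in> C ?w" using q(2) by (simp add: C_def)
      then have "?w \<notin> \<W>" using q(1) by (auto simp: V_def)
      moreover have "?w \<in> Sigma (Pow F0) (\<lambda>W. W \<rightarrow>\<^sub>E {1..k})" using WF(1) \<sigma> by auto
      ultimately have "C ?w \<inter> K \<noteq> {}" unfolding \<W>_def by blast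
      then obtain r where "r \<in> K" "r \<in> C ?w" by blast
      then show ?thesis using K(2) by (intro bexI[of _ r]) (auto simp: C_def)
    qed
    then have "independence_set G \<phi> k A D W"
      using independence_set_finite_iff[OF Wne k, of G \<phi> A D] WF(2) by simp
    from card_le_max_independence[OF F0(1) this WF(1)] show ?thesis using cW by linarith
  qed
  have "inv_limsup G (\<lambda>F. real (mu_max_independence G \<phi> \<mu> k A \<delta> F)) > 0"
    unfolding inv_limsup_pos_iff
  proof (intro exI[of _ "c * (L / 4)"] conjI allI impI)
    show "c * (L / 4) > 0" using c L0 by simp
    fix K \<eta> assume "(K, \<eta>) \<in> invariance_index G"
    then obtain F where F: "F \<in> almost_invariant G K \<eta>"
      using almost_invariant_nonempty[OF am, of K \<eta>] by (auto simp: invariance_index_def)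
    then have F': "finite F" "F \<subseteq> carrier G" "F \<noteq> {}" by (auto simp: almost_invariant_def)
    have ne: "borel_large \<mu> \<delta> \<noteq> {}" using borel_large_UNIV[OF reg, of \<delta>] \<delta> by auto
    obtain D where D: "D \<in> borel_large \<mu> \<delta>"
      "mu_max_independence G \<phi> \<mu> k A \<delta> F = max_independence G \<phi> k A D F"
      by (rule mu_max_independence_attained[OF F'(1) ne])
    show "\<exists>F\<in>almost_invariant G K \<eta>. c * (L / 4) * real (card F) \<le> real (mu_max_independence G \<phi> \<mu> k A \<delta> F)"
      using key[OF D(1) F'] D(2) F by (intro bexI[of _ F]) simp_all
  qed
  then have "upper_mu_density G \<phi> \<mu> k A > 0" unfolding upper_mu_density_pos_iff using \<delta> by blast
  then show ?thesis using \<mu>(1) by (intro bexI[of _ \<mu>])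
qed

section \<open>Independence tuples and measures\<close>

text \<open>
  Regularity of compact Hausdorff spaces.
\<close>

lemma closed_neighbourhood_exists:
  fixes x :: "'x::t2_space"
  assumes cp: "compact (UNIV :: 'x set)" and U: "open U" "x \<in> U"
  shows "\<exists>C. closed C \<and> x \<in> interior C \<and> C \<subseteq> U"
proof -
  have "closedin euclidean {x} \<and> closedin euclidean (- U) \<and> disjnt {x} (- U)"
    using U by (auto simp: disjnt_def)
  then obtain V W where "openin euclidean V" "openin euclidean W" "{x} \<subseteq> V" "- U \<subseteq> W" "disjnt V W"
    using normal_space_compact_t2[OF cp] unfolding normal_space_def by metis
  then have VW: "open V" "open W" "x \<in> V" "- U \<subseteq> W" "V \<inter> W = {}" by (auto simp: disjnt_def)
  have "x \<in> interior (- W)" using VW by (intro interiorI[of V]) auto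
  then show ?thesis using VW by (intro exI[of _ "- W"]) (auto simp: closed_Compl)
qed

theorem theorem2p21:
  fixes G :: "('g, 'm) monoid_scheme"
    and \<phi> :: "'g \<Rightarrow> 'x::t2_space \<Rightarrow> 'x"
    and k :: nat
  assumes "amenable_group G"
    and "compact (UNIV :: 'x set)"
    and "group_action G UNIV \<phi>"
    and "\<And>g. g \<in> carrier G \<Longrightarrow> homeomorphic_map euclidean euclidean (\<phi> g)"
    and "k \<ge> 1"
  shows "IE_tuples G \<phi> k =
    product_topology (\<lambda>_. euclidean) {1..k} closure_of
      (\<Union>\<mu>\<in>invariant_measures G \<phi>. mu_IE_tuples G \<phi> \<mu> k)"
proof (intro subset_antisym subsetI)
  note iff = IE_tuples_iff[OF assms(1,3,5)]
  let ?X = "product_topology (\<lambda>_. euclidean :: 'x topology) {1..k}"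
  let ?M = "\<Union>\<mu>\<in>invariant_measures G \<phi>. mu_IE_tuples G \<phi> \<mu> k"
  {
    fix x assume x: "x \<in> IE_tuples G \<phi> k"
    then have xE: "x \<in> {1..k} \<rightarrow>\<^sub>E UNIV" by (simp add: iff)
    show "x \<in> ?X closure_of ?M"
      unfolding in_closure_of
    proof (intro conjI allI impI)
      show "x \<in> topspace ?X" using xE by simp
      fix T assume T: "x \<in> T \<and> openin ?X T"
      obtain U where U: "x \<in> Pi\<^sub>E {1..k} U" "\<And>i. open (U i)" "Pi\<^sub>E {1..k} U \<subseteq> T"
        using product_topology_open_contains_basis[of "\<lambda>_. euclidean" "{1..k}" T x] T by auto
      have "\<exists>C. closed C \<and> x i \<in> interior C \<and> C \<subseteq> U i" if "i \<in> {1..k}" for i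
        by (rule closed_neighbourhood_exists[OF assms(2) U(2) PiE_mem[OF U(1) that]])
      then have "\<forall>i\<in>{1..k}. \<exists>C. closed C \<and> x i \<in> interior C \<and> C \<subseteq> U i" by blast
      from bchoice[OF this] obtain A where A: "\<forall>i\<in>{1..k}. closed (A i) \<and> x i \<in> interior (A i) \<and> A i \<subseteq> U i"
        by (elim exE)
      have "inv_limsup G (\<lambda>F. real (max_independence G \<phi> k A UNIV F)) > 0"
        using x[unfolded iff, THEN conjunct2, rule_format, of A] A by simp
      from exists_measure_of_positive_density[OF assms _ this]
      obtain \<mu> where \<mu>: "\<mu> \<in> invariant_measures G \<phi>" "upper_mu_density G \<phi> \<mu> k A > 0" using A by blast
      have reg: "regular_borel_prob \<mu>" using \<mu>(1) by (simp add: invariant_measures_def)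
      have "closed (A i)" if "i \<in> {1..k}" for i using A that by blast
      from mu_IE_tuple_exists[OF assms(2) reg assms(5) this \<mu>(2)]
      obtain y where y: "y \<in> mu_IE_tuples G \<phi> \<mu> k" "\<forall>i\<in>{1..k}. y i \<in> A i" by blast
      have "y \<in> {1..k} \<rightarrow>\<^sub>E UNIV" using y(1) by (simp add: mu_IE_tuples_def)
      then have "y \<in> Pi\<^sub>E {1..k} U" using y(2) A by (auto simp: PiE_iff)
      then show "\<exists>y. y \<in> ?M \<and> y \<in> T" using U(3) y(1) \<mu>(1) by blast
    qed
  }
  {
    fix x assume x: "x \<in> ?X closure_of ?M"
    show "x \<in> IE_tuples G \<phi> k"
      unfolding iff
    proof (intro conjI allI impI)
      show xE: "x \<in> {1..k} \<rightarrow>\<^sub>E UNIV" using x by (simp add: in_closure_of)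
      fix U assume U: "\<forall>i\<in>{1..k}. x i \<in> interior (U i)"
      let ?T = "Pi\<^sub>E {1..k} (\<lambda>i. interior (U i))"
      have "openin ?X ?T" by (simp add: openin_PiE_gen)
      moreover have "x \<in> ?T" using U xE by (simp add: PiE_iff)
      ultimately obtain y where y: "y \<in> ?M" "y \<in> ?T"
        using x[unfolded in_closure_of, THEN conjunct2, rule_format, of ?T] by blast
      then obtain \<mu> where \<mu>: "\<mu> \<in> invariant_measures G \<phi>" "y \<in> mu_IE_tuples G \<phi> \<mu> k" by blast
      have reg: "regular_borel_prob \<mu>" using \<mu>(1) by (simp add: invariant_measures_def)
      have "\<forall>i\<in>{1..k}. y i \<in> interior (U i)" using PiE_mem[OF y(2)] by blast
      then have "upper_mu_density G \<phi> \<mu> k U > 0"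
        using \<mu>(2) unfolding mu_IE_tuples_def by blast
      then show "inv_limsup G (\<lambda>F. real (max_independence G \<phi> k U UNIV F)) > 0"
        by (rule max_independence_pos_of_density[OF reg])
    qed
  }
qed

end
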